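(* For every integer $r\geq 1$, $$I_r(x)=\sum_{\rho\in K_{2r+2}}\left(\frac{x^{s(\rho)}}{(1-x^2)^{d(\rho)}(1-x)^{dd(\rho)}}\sum_{r_1+\dots+r_{f(\rho)}=r-c(\rho)}\ \prod_{j=1}^{f(\rho)}I_{r_j}(x)\right),$$ where the inner sum is over all tuples of integers $r_j\geq 0$, $1\leq j\leq f(\rho)$, with the indicated sum (it is empty, hence $0$, if $r<c(\rho)$).
   Context: Permutations are in one-line notation. $\mathcal{I}_n$ is the set of involutions ($\pi=\pi^{-1}$) of $\{1,\dots,n\}$, $n\ge 0$. An occurrence of $3412$ in $\pi$ is a subsequence of four entries of $\pi$ order-isomorphic to $3412$; similarly for $12$ and $21$. $I_r(x)=\sum_{n\ge 0}|\{\pi\in\mathcal{I}_n:\pi\text{ has exactly } r \text{ occurrences of }3412\}|\,x^n$. Graph and kernel. For $\pi\in\mathcal{I}_n$, $G_\pi$ is the bipartite graph whose vertices are the entries of $\pi$ (one part) and the occurrences of $3412$ in $\pi$ (other part), an entry being joined to an occurrence iff it belongs to it. For $n\ge1$ the kernel $\ker\pi$ consists of the entries of $\pi$ lying in the connected component of $G_\pi$ containing the entry $1$, together with the entry $\pi(1)$ (so if the entry $1$ lies in no occurrence of $3412$, the kernel is $\{1,\pi(1)\}$, of shape $1$ or $21$). Let $\pi(i_1),\dots,\pi(i_s)$, $i_1<\dots<i_s$, be the kernel entries. The kernel shape of $\pi$ is the involution $\rho\in\mathcal{I}_s$ order-isomorphic to $\ker\pi$; $s$ is the size of the kernel and the number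 of occurrences of $3412$ in $\ker\pi$ is its capacity. A kernel involution is an involution that is the kernel shape of some involution. $\mathcal{I}(\rho)$ is the set of all involutions (of all sizes) with kernel shape $\rho$. $K_t$ is the set of all kernel shapes of involutions in $\mathcal{I}_t$. Cells. Let $\pi\in\mathcal{I}(\rho)\cap\mathcal{I}_n$, $\rho\in\mathcal{I}_s$, with kernel positions $i_1<\dots<i_s$ and kernel values $v_1<\dots<v_s$, and put $i_{s+1}=v_{s+1}=n+1$. For $1\le m,\ell\le s$ the cell $C_{m\ell}$ is the set of entries $\pi(j)$ with $i_\ell<j<i_{\ell+1}$ and $v_m<\pi(j)<v_{m+1}$. A cell $C$ is infeasible if the existence of an entry $a\in C$ would imply an occurrence of $3412$ that contains $a$, two other entries of $\ker\pi$, and another entry $z$ of $\pi$ (so infeasible cells are empty for every $\pi\in\mathcal{I}(\rho)$); otherwise it is feasible. Feasible cells are of three kinds: a diagonal-decreasing-cell is a feasible cell $C_{ii}$ whose entries, read left to right, are necessarily decreasing; a decreasing-cell is a feasible cell $C_{ij}$, $i\ne j$, whose entries, read left to right, are necessarily decreasing; a free-cell is a feasible cell whose entries may, or may not, contain occurrences of $12$ or $21$ (no such restriction). Parameters. For a kernel involution $\rho$: $s(\rho)$ is its size, $c(\rho)$ its capacity (number of occurrences of $3412$ in $\rho$), $f(\rho)$ the number of free-cells, $dd(\rho)$ the number of diagonal-decreasing-cells, and $d(\rho)$ the number of decreasing-cells lying above the diagonal, in the cell decomposition associated with $\rho$. *)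

theory Defs
  imports
    "HOL-Library.Sublist"
    "HOL-Combinatorics.Multiset_Permutations"
    "HOL-Computational_Algebra.Formal_Power_Series"
begin

(* One-line notation: a permutation of {1..n} is a list p of length n, and p(i) is the list
   element with 0-based index i - 1.  The size of a permutation is its length. *)

definition entry :: "nat list \<Rightarrow> nat \<Rightarrow> nat" where
  "entry p i = p ! (i - 1)"

definition involutions :: "nat \<Rightarrow> nat list set" where
  "involutions n =
     {p \<in> permutations_of_set {1..n}. \<forall>i\<in>{1..n}. entry p (entry p i) = i}"

definition order_iso :: "nat list \<Rightarrow> nat list \<Rightarrow> bool" where
  "order_iso xs ys \<longleftrightarrow> length xs = length ys \<and>
     (\<forall>i<length xs. \<forall>j<length xs. xs ! i < xs ! j \<longleftrightarrow> ys ! i < ys ! j)"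

(* The entries of a permutation are distinct, so a subsequence is determined by its list of values. *)
definition occurrences :: "nat list \<Rightarrow> nat list \<Rightarrow> nat list set" where
  "occurrences t p = {w. subseq w p \<and> order_iso w t}"

abbreviation occ3412 :: "nat list \<Rightarrow> nat list set" where
  "occ3412 \<equiv> occurrences [3, 4, 1, 2]"

definition inv_gf :: "nat \<Rightarrow> rat fps" where
  "inv_gf r = Abs_fps (\<lambda>n. of_nat (card {p \<in> involutions n. card (occ3412 p) = r}))"

(* The edge relation of the bipartite graph, in both directions: Inl marks an entry (its value),
   Inr an occurrence of 3412. *)
definition graph_edges :: "nat list \<Rightarrow> (nat + nat list) rel" where
  "graph_edges p =
     {(Inl a, Inr w) | a w. w \<in> occ3412 p \<and> a \<in> set w} \<union>
     {(Inr w, Inl a) | a w. w \<in> occ3412 p \<and> a \<in> set w}"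

definition kernel_entries :: "nat list \<Rightarrow> nat set" where
  "kernel_entries p = {a \<in> set p. (Inl 1, Inl a) \<in> (graph_edges p)\<^sup>*} \<union> {entry p 1}"

definition kernel :: "nat list \<Rightarrow> nat list" where
  "kernel p = filter (\<lambda>a. a \<in> kernel_entries p) p"

definition standardise :: "nat list \<Rightarrow> nat list" where
  "standardise xs = map (\<lambda>a. card {b \<in> set xs. b \<le> a}) xs"

lemma standardise_order_iso: "order_iso (standardise xs) xs"
proof -
  have "card {b \<in> set xs. b \<le> x} < card {b \<in> set xs. b \<le> y} \<longleftrightarrow> x < y"
    if "x \<in> set xs" "y \<in> set xs" for x y
  proof
    assume "x < y"
    then have "{b \<in> set xs. b \<le> x} \<subset> {b \<in> set xs. b \<le> y}"
      using that by force
    then show "card {b \<in> set xs. b \<le> x} < card {b \<in> set xs. b \<le> y}"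
      by (intro psubset_card_mono) auto
  next
    assume less: "card {b \<in> set xs. b \<le> x} < card {b \<in> set xs. b \<le> y}"
    show "x < y"
    proof (rule ccontr)
      assume "\<not> x < y"
      then have "card {b \<in> set xs. b \<le> y} \<le> card {b \<in> set xs. b \<le> x}"
        by (intro card_mono) auto
      with less show False by simp
    qed
  qed
  then show ?thesis
    by (auto simp: order_iso_def standardise_def)
qed

lemma standardise_permutation:
  assumes "distinct xs"
  shows "standardise xs \<in> permutations_of_set {1..length xs}"
proof -
  have inj: "inj_on (\<lambda>a. card {b \<in> set xs. b \<le> a}) (set xs)"
  proof (rule inj_onI)
    fix x y
    assume xy: "x \<in> set xs" "y \<in> set xs"
      and eq: "card {b \<in> set xs. b \<le> x} = card {b \<in> set xs. b \<le> y}"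
    have "{b \<in> set xs. b \<le> x} = {b \<in> set xs. b \<le> y}"
    proof (cases "x \<le> y")
      case True
      then show ?thesis using eq by (intro card_subset_eq) auto
    next
      case False
      then show ?thesis using eq by (intro card_subset_eq[symmetric]) auto
    qed
    with xy show "x = y" by (blast intro: order.antisym)
  qed
  then have dist: "distinct (standardise xs)"
    using assms by (simp add: standardise_def distinct_map)
  have "set (standardise xs) \<subseteq> {1..length xs}"
  proof
    fix k assume "k \<in> set (standardise xs)"
    then obtain a where a: "a \<in> set xs" "k = card {b \<in> set xs. b \<le> a}"
      by (auto simp: standardise_def)
    have "card {b \<in> set xs. b \<le> a} \<le> card (set xs)"
      by (intro card_mono) auto
    moreover have "0 < card {b \<in> set xs. b \<le> a}"
      using a by (auto simp: card_gt_0_iff)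
    ultimately show "k \<in> {1..length xs}"
      using a card_length[of xs] by simp
  qed
  moreover have "card (set (standardise xs)) = card {1..length xs}"
    using distinct_card[OF dist] by (simp add: standardise_def)
  ultimately have "set (standardise xs) = {1..length xs}"
    by (intro card_subset_eq) auto
  with dist show ?thesis by (simp add: permutations_of_set_def)
qed

definition kernel_shape :: "nat list \<Rightarrow> nat list" where
  "kernel_shape p = standardise (kernel p)"

definition kernel_shapes :: "nat \<Rightarrow> nat list set" where
  "kernel_shapes t = kernel_shape ` involutions t"

definition with_shape :: "nat list \<Rightarrow> nat list set" where
  "with_shape \<rho> = {p. \<exists>n\<ge>1. p \<in> involutions n \<and> kernel_shape p = \<rho>}"

(* Cells are taken relative to any subsequence k of p; the cells of p itself are those with
   k = kernel p.  The row index m refers to values, the column index l to positions. *)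

definition grid_positions :: "nat list \<Rightarrow> nat list \<Rightarrow> nat list" where
  "grid_positions p k =
     sorted_list_of_set {i \<in> {1..length p}. entry p i \<in> set k} @ [length p + 1]"

definition grid_values :: "nat list \<Rightarrow> nat list \<Rightarrow> nat list" where
  "grid_values p k = sorted_list_of_set (set k) @ [length p + 1]"

definition cell :: "nat list \<Rightarrow> nat list \<Rightarrow> nat \<Rightarrow> nat \<Rightarrow> nat set" where
  "cell p k m l = {entry p j | j. j \<in> {1..length p} \<and>
     grid_positions p k ! (l - 1) < j \<and> j < grid_positions p k ! l \<and>
     grid_values p k ! (m - 1) < entry p j \<and> entry p j < grid_values p k ! m}"

(* A subsequence of p that is order-isomorphic to \<rho> and on which p restricts to an involution. *)
definition copies :: "nat list \<Rightarrow> nat list \<Rightarrow> nat list set" where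
  "copies \<rho> p = {k \<in> occurrences \<rho> p. \<forall>a\<in>set k. entry p a \<in> set k}"

(* "The existence of an entry a in the cell would imply ..." is a hypothetical: if p has kernel
   shape \<rho> and k = kernel p, an infeasible cell has no entry, and the implication says nothing.
   Hence k ranges over all copies of \<rho> in involutions, not only over kernels.
   The fourth entry z may belong to k or not. *)
definition infeasible_cell :: "nat list \<Rightarrow> nat \<Rightarrow> nat \<Rightarrow> bool" where
  "infeasible_cell \<rho> m l \<longleftrightarrow>
     (\<forall>n. \<forall>p\<in>involutions n. \<forall>k\<in>copies \<rho> p. \<forall>a\<in>cell p k m l.
        \<exists>w\<in>occ3412 p. \<exists>b\<in>set k. \<exists>c\<in>set k. \<exists>z\<in>set p.
          distinct [a, b, c, z] \<and> set w = {a, b, c, z})"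

definition necessarily_decreasing :: "nat list \<Rightarrow> nat \<Rightarrow> nat \<Rightarrow> bool" where
  "necessarily_decreasing \<rho> m l \<longleftrightarrow>
     (\<forall>p\<in>with_shape \<rho>. sorted_wrt (>) (filter (\<lambda>a. a \<in> cell p (kernel p) m l) p))"

definition feasible_cells :: "nat list \<Rightarrow> (nat \<times> nat) set" where
  "feasible_cells \<rho> =
     {(m, l). m \<in> {1..length \<rho>} \<and> l \<in> {1..length \<rho>} \<and> \<not> infeasible_cell \<rho> m l}"

definition diagonal_decreasing_cells :: "nat list \<Rightarrow> (nat \<times> nat) set" where
  "diagonal_decreasing_cells \<rho> =
     {(m, l) \<in> feasible_cells \<rho>. m = l \<and> necessarily_decreasing \<rho> m l}"

definition decreasing_cells :: "nat list \<Rightarrow> (nat \<times> nat) set" where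
  "decreasing_cells \<rho> =
     {(m, l) \<in> feasible_cells \<rho>. m \<noteq> l \<and> necessarily_decreasing \<rho> m l}"

definition free_cells :: "nat list \<Rightarrow> (nat \<times> nat) set" where
  "free_cells \<rho> = {(m, l) \<in> feasible_cells \<rho>. \<not> necessarily_decreasing \<rho> m l}"

definition capacity :: "nat list \<Rightarrow> nat" where
  "capacity \<rho> = card (occ3412 \<rho>)"

definition num_free :: "nat list \<Rightarrow> nat" where
  "num_free \<rho> = card (free_cells \<rho>)"

definition num_diag_decr :: "nat list \<Rightarrow> nat" where
  "num_diag_decr \<rho> = card (diagonal_decreasing_cells \<rho>)"

(* Above the diagonal: the plot of a permutation has values increasing upwards, so m > l. *)
definition num_decr_above :: "nat list \<Rightarrow> nat" where
  "num_decr_above \<rho> = card {(m, l) \<in> decreasing_cells \<rho>. m > l}"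

end

theory Submission
  imports Defs
begin

text \<open>Draw an involution as arcs joining \<open>x\<close> and \<open>f x\<close>.  Two crossing arcs form a \<open>3412\<close>, and
  conversely the arcs crossing-connected to the arc at \<open>1\<close> cut \<open>{1..n}\<close> into gaps such that every
  other arc (or fixed point) lives inside a single gap, that is, in a box on the diagonal.  A \<open>3412\<close>
  that leaves such a box contains, up to mirroring, a crossing pair of arcs spanning the whole box.
  Hence an entry in a box not spanned by a crossing pair (a light gap) never interacts with anything
  outside, which gives the free cells.  In a spanned box every ascent is drawn into the kernel, so
  the entries left over are decreasing; two ascending entries in different feasible cells would put
  one of them into a \<open>3412\<close> with three kernel entries.  Therefore each column contains at most one
  feasible cell, all feasible cells can be filled independently, and every \<open>3412\<close> of the result is
  either inside the kernel or inside a single free cell.  Finally a kernel with \<open>c\<close> occurrences has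
  at most \<open>2 c + 2\<close> entries, since each further crossing arc brings two new entries and each further
  kernel entry lies in an occurrence with at least two entries of the crossing component.\<close>

section \<open>Occurrences of 3412 in an involution and the kernel\<close>

text \<open>Two kinds of gaps have to be kept apart. Relative to the crossing component of the arc
  at 1, every outside point lies in the same gap as its mirror image. Relative to the whole kernel
  it need not, since further kernel entries can subdivide such a gap, and this is where off-diagonal
  cells come from. Feasibility is defined hypothetically, through all copies of the shape; it is
  replaced by conditions on the shape alone: no point of the cell completes three kernel entries to
  a 3412 (\<open>bad3\<close>), and no kernel arc crosses the arc of the point
  (\<open>crossed\<close>). Connectivity of the shape forces every such cell off the diagonal to be
  spanned by a crossing pair. Its content is therefore decreasing, so there is one content for each
  length, shared with the mirror cell, whence the factors with x^2. The index 2r+2 serves twice: it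
  bounds the sizes of the shapes that occur, and every smaller shape is also attained at exactly
  this size, by adding fixed points after its last entry. Shapes of capacity above r have an empty
  inner sum.\<close>

definition inv_on :: "nat \<Rightarrow> (nat \<Rightarrow> nat) \<Rightarrow> bool" where
  "inv_on n f \<longleftrightarrow> (\<forall>i\<in>{1..n}. f i \<in> {1..n} \<and> f (f i) = i)"

lemma inv_onD:
  assumes "inv_on n f" "1 \<le> i" "i \<le> n"
  shows "1 \<le> f i" "f i \<le> n" "f (f i) = i"
  using assms by (auto simp: inv_on_def)

lemma inv_on_inj: "inv_on n f \<Longrightarrow> inj_on f {1..n}"
  by (rule inj_on_inverseI[where g = f]) (simp add: inv_on_def)

definition occ :: "nat \<Rightarrow> (nat \<Rightarrow> nat) \<Rightarrow> nat \<Rightarrow> nat \<Rightarrow> nat \<Rightarrow> nat \<Rightarrow> bool" where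
  "occ n f i j k l \<longleftrightarrow> 1 \<le> i \<and> i < j \<and> j < k \<and> k < l \<and> l \<le> n \<and>
     f k < f l \<and> f l < f i \<and> f i < f j"

text \<open>Sets of positions are enough: by \<open>Occ_mirror\<close> the same family of sets
  arises from the values of the occurrences of an involution, so the kernel can be read in positions
  or in values.\<close>

definition Occ :: "nat \<Rightarrow> (nat \<Rightarrow> nat) \<Rightarrow> nat set set" where
  "Occ n f = {{i, j, k, l} | i j k l. occ n f i j k l}"

lemma OccE:
  assumes "w \<in> Occ n f"
  obtains i j k l where "occ n f i j k l" "w = {i, j, k, l}"
  using assms by (auto simp: Occ_def)

lemma OccI: "occ n f i j k l \<Longrightarrow> {i, j, k, l} \<in> Occ n f"
  by (auto simp: Occ_def)

lemma Occ_subset: "w \<in> Occ n f \<Longrightarrow> w \<subseteq> {1..n}"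
  by (auto simp: Occ_def occ_def)

lemma finite_Occ: "finite (Occ n f)"
proof (rule finite_subset)
  show "Occ n f \<subseteq> Pow {1..n}" using Occ_subset by blast
qed simp

text \<open>The pattern 3412 is its own inverse, so reflection in the diagonal preserves it.
  Positions and values change places, which is why the new positions start with the smallest value
  \<open>f k\<close>.\<close>

lemma occ_mirror:
  assumes "inv_on n f" "occ n f i j k l"
  shows "occ n f (f k) (f l) (f i) (f j)"
proof -
  have "1 \<le> i" "i \<le> n" "1 \<le> j" "j \<le> n" "1 \<le> k" "k \<le> n" "1 \<le> l" "l \<le> n"
    using assms(2) by (auto simp: occ_def)
  with assms(2) show ?thesis
    using inv_onD[OF assms(1), of i] inv_onD[OF assms(1), of j]
      inv_onD[OF assms(1), of k] inv_onD[OF assms(1), of l]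
    by (simp add: occ_def)
qed

lemma Occ_mirror:
  assumes "inv_on n f" "w \<in> Occ n f"
  shows "f ` w \<in> Occ n f"
proof -
  obtain i j k l where w: "occ n f i j k l" "w = {i, j, k, l}"
    using assms(2) by (rule OccE)
  have "f ` w = {f k, f l, f i, f j}"
    using w(2) by auto
  then show ?thesis
    using OccI[OF occ_mirror[OF assms(1) w(1)]] by simp
qed

lemma occ_crossing_arcs:
  assumes "inv_on n f" "1 \<le> x" "x < y" "y < f x" "f x < f y" "y \<le> n"
  shows "occ n f x y (f x) (f y)"
  using assms inv_onD[OF assms(1), of x] inv_onD[OF assms(1), of y] by (auto simp: occ_def)

section \<open>Occurrences and square boxes on the diagonal\<close>

definition convex_set :: "nat set \<Rightarrow> bool" where
  "convex_set G \<longleftrightarrow> (\<forall>x\<in>G. \<forall>z\<in>G. \<forall>y. x \<le> y \<and> y \<le> z \<longrightarrow> y \<in> G)"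

lemma convex_setD: "convex_set G \<Longrightarrow> x \<in> G \<Longrightarrow> z \<in> G \<Longrightarrow> x \<le> y \<Longrightarrow> y \<le> z \<Longrightarrow> y \<in> G"
  unfolding convex_set_def by blast

text \<open>If an occurrence meets a square box on the diagonal but is not contained in it, then two of
  its entries (or of their mirror images) form a crossing pair of arcs spanning the whole box.\<close>

lemma box_first:
  assumes f: "inv_on n f" and o: "occ n f i j k l"
    and cG: "convex_set G"
    and closed: "f ` G \<subseteq> G" and GN: "G \<subseteq> {1..n}"
    and meet: "i \<in> G \<or> j \<in> G" and not_in: "\<not> {i, j, k, l} \<subseteq> G"
    and x: "x \<in> G"
  shows "f k < f l \<and> f l < x \<and> x < k \<and> k < l"
proof -
  note conv = convex_setD[OF cG]
  have r: "1 \<le> i" "i \<le> n" "1 \<le> j" "j \<le> n" "1 \<le> k" "k \<le> n" "1 \<le> l" "l \<le> n"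
    and lt: "i < j" "j < k" "k < l" "f k < f l" "f l < f i" "f i < f j"
    using o by (auto simp: occ_def)
  note ff = inv_onD(3)[OF f r(1,2)] inv_onD(3)[OF f r(3,4)] inv_onD(3)[OF f r(5,6)]
    inv_onD(3)[OF f r(7,8)]
  have cl: "a \<in> G \<longleftrightarrow> f a \<in> G" if "1 \<le> a" "a \<le> n" for a
  proof
    show "f a \<in> G" if "a \<in> G" using closed that by blast
    show "a \<in> G" if "f a \<in> G"
      using closed inv_onD(3)[OF f \<open>1 \<le> a\<close> \<open>a \<le> n\<close>] that by force
  qed
  \<comment> \<open>If k or l were in G, convexity in the positions would put k there, convexity in
    the values then \<open>f l\<close> and \<open>f i\<close>, and finally j lies between i and k,
    so the whole occurrence would be in G.\<close>
  have "k \<notin> G \<and> l \<notin> G"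
  proof (rule ccontr)
    assume "\<not> ?thesis"
    then have "k \<in> G"
      using meet conv[of i l k] conv[of j l k] lt by fastforce
    then have fk: "f k \<in> G" using cl r by blast
    have "f l \<in> G"
      using meet conv[OF fk, of "f i" "f l"] conv[OF fk, of "f j" "f l"] cl r lt by auto
    moreover have "f i \<in> G"
      using meet conv[OF fk, of "f j" "f i"] cl r lt by auto
    moreover have "j \<in> G"
      using conv[of i k j] \<open>k \<in> G\<close> \<open>f i \<in> G\<close> cl r lt by auto
    ultimately show False
      using not_in \<open>k \<in> G\<close> cl r by blast
  qed
  then have out: "k \<notin> G" "l \<notin> G" "f k \<notin> G" "f l \<notin> G"
    using cl r by auto
  have "x < k"
    using meet conv[of i x k] conv[of j x k] x out(1) lt by fastforce
  moreover have "f l < x"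
  proof (rule ccontr)
    assume "\<not> f l < x"
    moreover have "f i \<in> G \<or> f j \<in> G" using meet cl r by blast
    ultimately show False
      using conv[of x "f i" "f l"] conv[of x "f j" "f l"] x out lt by auto
  qed
  ultimately show ?thesis using lt by simp
qed

lemma box_second:
  assumes f: "inv_on n f" and o: "occ n f i j k l"
    and cG: "convex_set G"
    and closed: "f ` G \<subseteq> G" and GN: "G \<subseteq> {1..n}"
    and meet: "k \<in> G \<or> l \<in> G" and not_in: "\<not> {i, j, k, l} \<subseteq> G"
    and x: "x \<in> G"
  shows "i < j \<and> j < x \<and> x < f i \<and> f i < f j"
proof -
  have r: "1 \<le> i" "i \<le> n" "1 \<le> j" "j \<le> n" "1 \<le> k" "k \<le> n" "1 \<le> l" "l \<le> n"
    using o by (auto simp: occ_def)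
  have cl: "a \<in> G \<longleftrightarrow> f a \<in> G" if "1 \<le> a" "a \<le> n" for a
  proof
    show "f a \<in> G" if "a \<in> G" using closed that by blast
    show "a \<in> G" if "f a \<in> G"
      using closed inv_onD(3)[OF f \<open>1 \<le> a\<close> \<open>a \<le> n\<close>] that by force
  qed
  have "f k \<in> G \<or> f l \<in> G" "\<not> {f k, f l, f i, f j} \<subseteq> G"
    using meet not_in cl r by auto
  from box_first[OF f occ_mirror[OF f o] cG closed GN this x]
  show ?thesis using inv_onD(3)[OF f] r by auto
qed

text \<open>Here \<open>f 1\<close> generates further elements, whereas the kernel adjoins it to the
  component of 1 only as a single entry. The two agree by \<open>occ_one_linked\<close>, and in this
  form the closure is visibly symmetric under f.\<close>

inductive_set ker :: "nat \<Rightarrow> (nat \<Rightarrow> nat) \<Rightarrow> nat set" for n f where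
  ker_one: "1 \<in> ker n f"
| ker_image_one: "f 1 \<in> ker n f"
| ker_step: "w \<in> Occ n f \<Longrightarrow> a \<in> w \<Longrightarrow> a \<in> ker n f \<Longrightarrow> b \<in> w \<Longrightarrow> b \<in> ker n f"

lemma ker_subset:
  assumes "inv_on n f" "1 \<le> n"
  shows "ker n f \<subseteq> {1..n}"
proof
  fix x assume "x \<in> ker n f"
  then show "x \<in> {1..n}"
  proof induction
    case ker_one
    show ?case using assms by simp
  next
    case ker_image_one
    show ?case using inv_onD[OF assms(1), of 1] assms(2) by simp
  next
    case (ker_step w a b)
    then show ?case using Occ_subset by blast
  qed
qed

lemma ker_closed:
  assumes "inv_on n f" "1 \<le> n" "x \<in> ker n f"
  shows "f x \<in> ker n f"
  using assms(3)
proof induction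
  case ker_one
  show ?case by (rule ker.ker_image_one)
next
  case ker_image_one
  show ?case using inv_onD(3)[OF assms(1), of 1] assms(2) ker.ker_one by simp
next
  case (ker_step w a b)
  show ?case
    by (rule ker.ker_step[OF Occ_mirror[OF assms(1) ker_step(1)], of "f a"]) (use ker_step in auto)
qed

lemma ker_occ: "w \<in> Occ n f \<Longrightarrow> w \<inter> ker n f \<noteq> {} \<Longrightarrow> w \<subseteq> ker n f"
  by (auto intro: ker_step)

text \<open>These are the kernel involutions: kernel shapes have this property by
  \<open>conn_ker\<close>, and \<open>conn_kernel_shape_self\<close> realises every such g as a
  kernel shape.\<close>

definition conn :: "nat \<Rightarrow> (nat \<Rightarrow> nat) \<Rightarrow> bool" where
  "conn s g \<longleftrightarrow> 1 \<le> s \<and> inv_on s g \<and> ker s g = {1..s}"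

lemma conn_induct:
  assumes "conn s g" "1 \<in> T" "g 1 \<in> T"
    and "\<And>w. w \<in> Occ s g \<Longrightarrow> w \<inter> T \<noteq> {} \<Longrightarrow> w \<subseteq> T"
  shows "{1..s} \<subseteq> T"
proof -
  have "x \<in> T" if "x \<in> ker s g" for x
    using that by induction (use assms in auto)
  then show ?thesis using assms(1) by (auto simp: conn_def)
qed

text \<open>Gap \<open>l\<close> lies between \<open>l\<close> and \<open>l + 1\<close>, so \<open>i\<close> is to its left iff \<open>i \<le> l\<close>.  \<open>bad3 s g l m\<close>: a point
  with position in gap \<open>l\<close> and value in gap \<open>m\<close> would form a \<open>3412\<close> with three entries of \<open>g\<close>, playing
  the role of \<open>3\<close>, \<open>4\<close>, \<open>1\<close>, \<open>2\<close> in the four alternatives.\<close>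

definition bad3 :: "nat \<Rightarrow> (nat \<Rightarrow> nat) \<Rightarrow> nat \<Rightarrow> nat \<Rightarrow> bool" where
  "bad3 s g l m \<longleftrightarrow> (\<exists>i j k. 1 \<le> i \<and> i < j \<and> j < k \<and> k \<le> s \<and>
     (l < i \<and> g j < g k \<and> g k \<le> m \<and> m < g i \<or>
      i \<le> l \<and> l < j \<and> g j < g k \<and> g k < g i \<and> g i \<le> m \<or>
      j \<le> l \<and> l < k \<and> m < g k \<and> g k < g i \<and> g i < g j \<or>
      k \<le> l \<and> g k \<le> m \<and> m < g i \<and> g i < g j))"

text \<open>An arc of \<open>g\<close> crosses the arc joining the gaps \<open>l\<close> and \<open>m\<close>; such a point, its mirror image and the
  two ends of the arc would form a \<open>3412\<close>.\<close>

definition crossed :: "nat \<Rightarrow> (nat \<Rightarrow> nat) \<Rightarrow> nat \<Rightarrow> nat \<Rightarrow> bool" where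
  "crossed s g l m \<longleftrightarrow> (\<exists>i\<in>{1..s}. i \<in> {min l m<..max l m} \<and> g i \<notin> {min l m<..max l m})"

text \<open>A crossing pair of arcs of \<open>g\<close> spans everything between the gaps \<open>u\<close> and \<open>v\<close>.\<close>

definition covered :: "nat \<Rightarrow> (nat \<Rightarrow> nat) \<Rightarrow> nat \<Rightarrow> nat \<Rightarrow> bool" where
  "covered s g u v \<longleftrightarrow> (\<exists>c d. 1 \<le> c \<and> c < d \<and> d \<le> s \<and> g c < g d \<and> g d \<le> u \<and> v < c)"

abbreviation light :: "nat \<Rightarrow> (nat \<Rightarrow> nat) \<Rightarrow> nat \<Rightarrow> bool" where
  "light s g l \<equiv> \<not> covered s g l l"

section \<open>Feasible cells of a kernel involution\<close>

lemma bad3I: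
  assumes "1 \<le> i" "i < j" "j < k" "k \<le> s"
    and "(l < i \<and> g j < g k \<and> g k \<le> m \<and> m < g i) \<or>
      (i \<le> l \<and> l < j \<and> g j < g k \<and> g k < g i \<and> g i \<le> m) \<or>
      (j \<le> l \<and> l < k \<and> m < g k \<and> g k < g i \<and> g i < g j) \<or>
      (k \<le> l \<and> g k \<le> m \<and> m < g i \<and> g i < g j)"
  shows "bad3 s g l m"
  unfolding bad3_def using assms by blast

lemma bad3_cases_I:
  assumes "1 \<le> i" "i < j" "j < k" "k \<le> s"
  shows "l < i \<Longrightarrow> g j < g k \<Longrightarrow> g k \<le> m \<Longrightarrow> m < g i \<Longrightarrow> bad3 s g l m"
    and "i \<le> l \<Longrightarrow> l < j \<Longrightarrow> g j < g k \<Longrightarrow> g k < g i \<Longrightarrow> g i \<le> m \<Longrightarrow> bad3 s g l m"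
    and "j \<le> l \<Longrightarrow> l < k \<Longrightarrow> m < g k \<Longrightarrow> g k < g i \<Longrightarrow> g i < g j \<Longrightarrow> bad3 s g l m"
    and "k \<le> l \<Longrightarrow> g k \<le> m \<Longrightarrow> m < g i \<Longrightarrow> g i < g j \<Longrightarrow> bad3 s g l m"
  using bad3I[OF assms] by blast+

lemma coveredI:
  "1 \<le> c \<Longrightarrow> c < d \<Longrightarrow> d \<le> s \<Longrightarrow> g c < g d \<Longrightarrow> g d \<le> u \<Longrightarrow> v < c \<Longrightarrow> covered s g u v"
  unfolding covered_def by blast

lemma crossed_commute: "crossed s g l m \<longleftrightarrow> crossed s g m l"
  by (simp add: crossed_def min.commute max.commute)

lemma not_crossed_diag: "\<not> crossed s g l l"
  by (auto simp: crossed_def)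

text \<open>On the diagonal each alternative of \<open>bad3\<close> keeps either both small values
  1, 2 or both large values 3, 4 of the pattern among its three kernel points. That pair, or its
  mirror image in the second case, spans the gap.\<close>

lemma light_not_bad3:
  assumes g: "inv_on s g" and l: "light s g l"
  shows "\<not> bad3 s g l l"
proof
  assume "bad3 s g l l"
  then obtain i j k where ijk: "1 \<le> i" "i < j" "j < k" "k \<le> s"
    and d: "(l < i \<and> g j < g k \<and> g k \<le> l \<and> l < g i) \<or>
      (i \<le> l \<and> l < j \<and> g j < g k \<and> g k < g i \<and> g i \<le> l) \<or>
      (j \<le> l \<and> l < k \<and> l < g k \<and> g k < g i \<and> g i < g j) \<or>
      (k \<le> l \<and> g k \<le> l \<and> l < g i \<and> g i < g j)"
    by (auto simp: bad3_def)
  have "(l < j \<and> g j < g k \<and> g k \<le> l) \<or> (j \<le> l \<and> l < g i \<and> g i < g j)"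
    using d ijk by auto
  then show False
  proof
    assume "l < j \<and> g j < g k \<and> g k \<le> l"
    with l ijk have "covered s g l l"
      by (intro coveredI[of j k]) auto
    with l show False by simp
  next
    assume a: "j \<le> l \<and> l < g i \<and> g i < g j"
    have "1 \<le> g i" "g j \<le> s" "g (g i) = i" "g (g j) = j"
      using inv_onD[OF g, of i] inv_onD[OF g, of j] ijk by auto
    with a ijk have "covered s g l l"
      by (intro coveredI[of "g i" "g j"]) auto
    with l show False by simp
  qed
qed

text \<open>Reflection exchanges the roles 3 and 1 and the roles 4 and 2 of a point, so the first
  and third alternatives of \<open>bad3\<close> change places, and so do the second and
  fourth.\<close>

lemma bad3_mirror:
  assumes g: "inv_on s g" and b: "bad3 s g l m"
  shows "bad3 s g m l"
proof -
  obtain i j k where ijk: "1 \<le> i" "i < j" "j < k" "k \<le> s"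
    and d: "(l < i \<and> g j < g k \<and> g k \<le> m \<and> m < g i) \<or>
      (i \<le> l \<and> l < j \<and> g j < g k \<and> g k < g i \<and> g i \<le> m) \<or>
      (j \<le> l \<and> l < k \<and> m < g k \<and> g k < g i \<and> g i < g j) \<or>
      (k \<le> l \<and> g k \<le> m \<and> m < g i \<and> g i < g j)"
    using b by (auto simp: bad3_def)
  have r: "1 \<le> g i" "g i \<le> s" "g (g i) = i" "1 \<le> g j" "g j \<le> s" "g (g j) = j"
    "1 \<le> g k" "g k \<le> s" "g (g k) = k"
    using inv_onD[OF g, of i] inv_onD[OF g, of j] inv_onD[OF g, of k] ijk by auto
  from d show ?thesis
  proof (elim disjE conjE)
    assume "l < i" "g j < g k" "g k \<le> m" "m < g i"
    then show ?thesis using ijk r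
      by (intro bad3I[of "g j" "g k" "g i"]) auto
  next
    assume "i \<le> l" "l < j" "g j < g k" "g k < g i" "g i \<le> m"
    then show ?thesis using ijk r
      by (intro bad3I[of "g j" "g k" "g i"]) auto
  next
    assume "j \<le> l" "l < k" "m < g k" "g k < g i" "g i < g j"
    then show ?thesis using ijk r
      by (intro bad3I[of "g k" "g i" "g j"]) auto
  next
    assume "k \<le> l" "g k \<le> m" "m < g i" "g i < g j"
    then show ?thesis using ijk r
      by (intro bad3I[of "g k" "g i" "g j"]) auto
  qed
qed

text \<open>Let the lower point a and the upper point b of an ascent lie in different columns, both
  below the spanning pair c, d. Some kernel position e separates them. According to its value, e is
  a 4 for a, or a 3 for b, or its mirror image is a 3 for b, each time with c and d as 1 and 2;
  otherwise the arc at e crosses the arc of b.\<close>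

lemma ascending_covered_aux:
  assumes g: "inv_on s g"
    and a: "\<not> bad3 s g la ma"
    and b: "\<not> bad3 s g lb mb" "\<not> crossed s g lb mb"
    and le: "la < lb" "ma \<le> mb"
    and cd: "c < d" "g c < g d" "d \<le> s" "g d \<le> la" "g d \<le> ma" "lb < c" "mb < c"
  shows False
proof -
  \<comment> \<open>The last kernel position to the left of b; it is to the right of a because
    \<open>la < lb\<close>.\<close>
  define e where "e = lb"
  have e: "la < e" "e \<le> lb" "1 \<le> e" "e \<le> s" "e < c"
    using assms by (auto simp: e_def)
  have ge: "1 \<le> g e" "g e \<le> s" "g (g e) = e"
    using inv_onD[OF g e(3,4)] by auto
  show False
  proof (cases "ma < g e")
    case True
    then have "bad3 s g la ma" using e cd
      by (intro bad3I[of e c d]) auto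
    with a show False by simp
  next
    case False
    show False
    proof (cases "g d < g e")
      case True
      then have "bad3 s g lb mb" using e cd False le
        by (intro bad3I[of e c d]) auto
      with b show False by simp
    next
      case F2: False
      show False
      proof (cases "e \<le> mb")
        case True
        then have "bad3 s g lb mb" using e ge cd F2 le
          by (intro bad3I[of "g e" c d]) auto
        with b show False by simp
      next
        case F3: False
        then have "crossed s g lb mb" unfolding crossed_def using e F3 False le
          by (intro bexI[of _ e]) auto
        with b show False by simp
      qed
    qed
  qed
qed

lemma ascending_covered:
  assumes g: "inv_on s g"
    and a: "\<not> bad3 s g la ma" "\<not> crossed s g la ma"
    and b: "\<not> bad3 s g lb mb" "\<not> crossed s g lb mb"
    and le: "la \<le> lb" "ma \<le> mb" "la < lb \<or> ma < mb"
    and cd: "c < d" "g c < g d" "d \<le> s" "g d \<le> la" "g d \<le> ma" "lb < c" "mb < c"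
  shows False
proof (cases "la < lb")
  case True
  then show False using ascending_covered_aux assms by blast
next
  case False
  then have "ma < mb" using le by auto
  then show False
    using ascending_covered_aux[of s g ma la mb lb c d] assms bad3_mirror[OF g] crossed_commute
    by blast
qed

text \<open>If no arc crosses, the kernel entries between the two gaps form a box G closed under g
  and not containing 1. Connectivity demands an occurrence that meets both G and its complement, and
  by the box lemmas such an occurrence supplies a crossing pair spanning all of G.\<close>

lemma off_diagonal_covered:
  assumes c: "conn s g" and lm: "1 \<le> l" "l < m" "m \<le> s" and nc: "\<not> crossed s g l m"
  shows "covered s g l m"
proof -
  have g: "inv_on s g" using c by (simp add: conn_def)
  define G where "G = {l<..m}"
  have GN: "G \<subseteq> {1..s}" using lm by (auto simp: G_def)
  have closed: "g ` G \<subseteq> G" using nc lm by (auto simp: crossed_def G_def)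
  have cG: "convex_set G" by (auto simp: convex_set_def G_def)
  have "\<exists>w\<in>Occ s g. w \<inter> ({1..s} - G) \<noteq> {} \<and> \<not> w \<subseteq> {1..s} - G"
  proof (rule ccontr)
    assume no: "\<not> ?thesis"
    have "{1..s} \<subseteq> {1..s} - G"
    proof (rule conn_induct[OF c])
      have 1: "1 \<notin> G" "1 \<le> s" using lm by (auto simp: G_def)
      then show "1 \<in> {1..s} - G" by simp
      have "g 1 \<notin> G"
        using 1 closed inv_onD(3)[OF g, of 1] by (metis image_subset_iff order_refl)
      with 1 show "g 1 \<in> {1..s} - G"
        using inv_onD[OF g, of 1] by simp
    next
      show "w \<subseteq> {1..s} - G" if "w \<in> Occ s g" "w \<inter> ({1..s} - G) \<noteq> {}" for w
        using no that by blast
    qed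
    moreover have "m \<in> {1..s}" "m \<in> G" using lm by (auto simp: G_def)
    ultimately show False by blast
  qed
  then obtain w where w: "w \<in> Occ s g" "w \<inter> ({1..s} - G) \<noteq> {}" "\<not> w \<subseteq> {1..s} - G" by blast
  obtain i j k t where o: "occ s g i j k t" "w = {i, j, k, t}"
    using w(1) by (rule OccE)
  have not_in: "\<not> {i, j, k, t} \<subseteq> G" using w(2) o(2) by blast
  \<comment> \<open>The box lemmas bound one point of G at a time; the two extreme points give the
    bounds for the whole box.\<close>
  have ends: "l + 1 \<in> G" "m \<in> G" using lm by (auto simp: G_def)
  have "(i \<in> G \<or> j \<in> G) \<or> (k \<in> G \<or> t \<in> G)"
    using w(3) o(2) Occ_subset[OF w(1)] by blast
  then show ?thesis
  proof
    assume meet: "i \<in> G \<or> j \<in> G"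
    from box_first[OF g o(1) cG closed GN meet not_in ends(1)]
      box_first[OF g o(1) cG closed GN meet not_in ends(2)]
    have "1 \<le> k \<and> k < t \<and> t \<le> s \<and> g k < g t \<and> g t \<le> l \<and> m < k"
      using o(1) by (auto simp: occ_def)
    then show ?thesis unfolding covered_def by blast
  next
    assume meet: "k \<in> G \<or> t \<in> G"
    from box_second[OF g o(1) cG closed GN meet not_in ends(1)]
      box_second[OF g o(1) cG closed GN meet not_in ends(2)]
    have "1 \<le> g i \<and> g i < g j \<and> g j \<le> s \<and> g (g i) < g (g j) \<and> g (g j) \<le> l \<and> m < g i"
      using o(1) inv_onD[OF g, of i] inv_onD[OF g, of j] unfolding occ_def by auto
    then show ?thesis unfolding covered_def by blast
  qed
qed

text \<open>Points in two cells of one column can be taken to ascend, so by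
  \<open>ascending_covered\<close> it is enough to find one crossing pair spanning l, m and m'
  together. One of the two cells is off the diagonal and hence spanned; its pair reaches over the
  third index as well.\<close>

lemma feasible_unique_aux:
  assumes c: "conn s g" and r: "1 \<le> l" "l \<le> s" "1 \<le> m" "m < m'" "m' \<le> s"
    and a: "\<not> bad3 s g l m" "\<not> crossed s g l m"
    and b: "\<not> bad3 s g l m'" "\<not> crossed s g l m'"
  shows False
proof -
  have g: "inv_on s g" using c by (simp add: conn_def)
  have "\<exists>c d. 1 \<le> c \<and> c < d \<and> d \<le> s \<and> g c < g d \<and> g d \<le> l \<and> g d \<le> m \<and> l < c \<and> m' < c"
  proof (cases "l < m'")
    case lm': True
    show ?thesis
    proof (cases "l \<le> m")
      case True
      have "covered s g l m'" by (rule off_diagonal_covered[OF c]) (use r b lm' in auto)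
      then obtain x y where "1 \<le> x" "x < y" "y \<le> s" "g x < g y" "g y \<le> l" "m' < x"
        unfolding covered_def by blast
      then show ?thesis using True lm' by (intro exI[of _ x] exI[of _ y]) auto
    next
      case False
      have "covered s g m l"
        by (rule off_diagonal_covered[OF c]) (use r a False in \<open>auto simp: crossed_commute\<close>)
      then obtain x y where xy: "1 \<le> x" "x < y" "y \<le> s" "g x < g y" "g y \<le> m" "l < x"
        by (auto simp: covered_def)
      \<comment> \<open>Here m < l < m', and the pair found so far spans only from m to l. If x came
        before m', the arc at x would end below l and so cross the arc joining l and m'.\<close>
      have "m' < x"
      proof (rule ccontr)
        assume "\<not> m' < x"
        then have "crossed s g l m'" unfolding crossed_def using xy lm' False
          by (intro bexI[of _ x]) auto
        with b show False by simp
      qed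
      then show ?thesis using xy False by (intro exI[of _ x] exI[of _ y]) auto
    qed
  next
    case False
    have "covered s g m l"
      by (rule off_diagonal_covered[OF c]) (use r a False in \<open>auto simp: crossed_commute\<close>)
    then obtain x y where "1 \<le> x" "x < y" "y \<le> s" "g x < g y" "g y \<le> m" "l < x"
      unfolding covered_def by blast
    then show ?thesis using False r by (intro exI[of _ x] exI[of _ y]) auto
  qed
  then obtain x y where "1 \<le> x" "x < y" "y \<le> s" "g x < g y" "g y \<le> l" "g y \<le> m" "l < x" "m' < x"
    by blast
  then show False using ascending_covered[OF g a b, of x y] r by auto
qed

lemma feasible_unique:
  assumes c: "conn s g" and r: "l \<in> {1..s}" "m \<in> {1..s}" "m' \<in> {1..s}"
    and a: "\<not> bad3 s g l m" "\<not> crossed s g l m"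
    and b: "\<not> bad3 s g l m'" "\<not> crossed s g l m'"
  shows "m = m'"
  using feasible_unique_aux[OF c, of l m m'] feasible_unique_aux[OF c, of l m' m] assms
  by (metis atLeastAtMost_iff linorder_neqE_nat)

section \<open>Copies of a kernel involution\<close>

text \<open>One function numbers both the elements of K and its gaps: for j outside K it is the
  index of the nearest element of K to the left, hence the convention that gap l follows element
  l.\<close>

definition rk :: "nat set \<Rightarrow> nat \<Rightarrow> nat" where
  "rk K j = card {k \<in> K. k \<le> j}"

lemma rk_mono: "finite K \<Longrightarrow> i \<le> j \<Longrightarrow> rk K i \<le> rk K j"
  unfolding rk_def by (rule card_mono) auto

lemma rk_less:
  assumes "finite K" "e \<in> K" "y < e"
  shows "rk K y < rk K e"
  unfolding rk_def
proof (rule psubset_card_mono)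
  show "{k \<in> K. k \<le> y} \<subset> {k \<in> K. k \<le> e}" using assms by force
qed (use assms in auto)

lemma rk_le_iff: "finite K \<Longrightarrow> e \<in> K \<Longrightarrow> rk K e \<le> rk K y \<longleftrightarrow> e \<le> y"
  using rk_less[of K e y] rk_mono[of K e y] by (meson linorder_not_le)

lemma rk_less_iff: "finite K \<Longrightarrow> e \<in> K \<Longrightarrow> rk K y < rk K e \<longleftrightarrow> y < e"
  using rk_le_iff[of K e y] by linarith

lemma rk_le_card: "finite K \<Longrightarrow> rk K y \<le> card K"
  unfolding rk_def by (rule card_mono) auto

lemma rk_pos: "finite K \<Longrightarrow> e \<in> K \<Longrightarrow> e \<le> y \<Longrightarrow> 1 \<le> rk K y"
  unfolding rk_def by (auto simp: Suc_le_eq card_gt_0_iff)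

lemma inj_on_rk: "finite K \<Longrightarrow> inj_on (rk K) K"
  by (rule inj_onI) (metis rk_le_iff order.antisym order_refl)

lemma rk_image: "finite K \<Longrightarrow> rk K ` K = {1..card K}"
  by (rule card_subset_eq) (auto simp: card_image inj_on_rk rk_le_card intro: rk_pos[unfolded One_nat_def])

definition kpos :: "nat set \<Rightarrow> nat \<Rightarrow> nat" where
  "kpos K i = inv_into K (rk K) i"

lemma kpos:
  assumes "finite K" "i \<in> {1..card K}"
  shows "kpos K i \<in> K" "rk K (kpos K i) = i"
proof -
  have "i \<in> rk K ` K" using rk_image assms by blast
  then show "kpos K i \<in> K" "rk K (kpos K i) = i"
    unfolding kpos_def by (rule inv_into_into, rule f_inv_into_f)
qed

lemma kpos_rk: "finite K \<Longrightarrow> x \<in> K \<Longrightarrow> kpos K (rk K x) = x"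
  unfolding kpos_def by (rule inv_into_f_f[OF inj_on_rk])

text \<open>A copy of g in f, with no demand that K be the kernel. This generality is needed because
  \<open>infeasible_cell\<close> ranges over all copies, and because the frame of a filling is
  recognised as its kernel only afterwards.\<close>

definition emb :: "nat \<Rightarrow> (nat \<Rightarrow> nat) \<Rightarrow> nat set \<Rightarrow> nat \<Rightarrow> (nat \<Rightarrow> nat) \<Rightarrow> bool" where
  "emb n f K s g \<longleftrightarrow> inv_on n f \<and> K \<subseteq> {1..n} \<and> f ` K \<subseteq> K \<and> card K = s \<and>
     (\<forall>x\<in>K. g (rk K x) = rk K (f x))"

lemma embD:
  assumes "emb n f K s g"
  shows "inv_on n f" "K \<subseteq> {1..n}" "finite K" "card K = s"
    "\<And>x. x \<in> K \<Longrightarrow> f x \<in> K" "\<And>x. x \<in> K \<Longrightarrow> g (rk K x) = rk K (f x)"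
    "\<And>x. x \<in> {1..n} \<Longrightarrow> f x \<in> K \<longleftrightarrow> x \<in> K"
proof -
  show 1: "inv_on n f" "K \<subseteq> {1..n}" "card K = s"
    "\<And>x. x \<in> K \<Longrightarrow> f x \<in> K" "\<And>x. x \<in> K \<Longrightarrow> g (rk K x) = rk K (f x)"
    using assms by (auto simp: emb_def)
  show "finite K" using finite_subset[OF 1(2)] by simp
  show "f x \<in> K \<longleftrightarrow> x \<in> K" if "x \<in> {1..n}" for x
    using 1(4)[of x] 1(4)[of "f x"] inv_onD(3)[OF 1(1), of x] that by auto
qed

lemma emb_kpos:
  assumes "emb n f K s g" "i \<in> {1..s}"
  shows "f (kpos K i) = kpos K (g i)"
proof -
  note e = embD[OF assms(1)]
  have k: "kpos K i \<in> K" "rk K (kpos K i) = i" using kpos e assms(2) by auto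
  then have "g i = rk K (f (kpos K i))" using e(6) by metis
  then show ?thesis using kpos_rk[OF e(3)] e(5)[OF k(1)] by simp
qed

lemma emb_inv_on:
  assumes "emb n f K s g"
  shows "inv_on s g"
  unfolding inv_on_def
proof
  fix i assume i: "i \<in> {1..s}"
  note e = embD[OF assms]
  define x where "x = kpos K i"
  have x: "x \<in> K" "rk K x = i" using kpos e i by (auto simp: x_def)
  have fx: "f x \<in> K" "f (f x) = x"
    using e(5)[OF x(1)] inv_onD(3)[OF e(1)] x(1) e(2) by auto
  have "g i = rk K (f x)" using e(6)[OF x(1)] x(2) by simp
  moreover have "g (rk K (f x)) = i" using e(6)[OF fx(1)] fx(2) x(2) by simp
  moreover have "rk K (f x) \<in> {1..s}" using rk_image[OF e(3)] fx(1) e(4) by blast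
  ultimately show "g i \<in> {1..s} \<and> g (g i) = i" by simp
qed

lemma occ_rk:
  assumes e: "emb n f K s g" and o: "occ n f i j k l" and K: "i \<in> K" "j \<in> K" "k \<in> K" "l \<in> K"
  shows "occ s g (rk K i) (rk K j) (rk K k) (rk K l)"
  using o K embD(5)[OF e] rk_pos[OF embD(3)[OF e] K(1) order_refl] rk_le_card[OF embD(3)[OF e], of l]
  by (auto simp: occ_def rk_less_iff embD[OF e])

lemma occ_kpos:
  assumes e: "emb n f K s g" and o: "occ s g i j k l"
  shows "occ n f (kpos K i) (kpos K j) (kpos K k) (kpos K l)"
proof -
  note E = embD[OF e] and g = emb_inv_on[OF e]
  have r: "i \<in> {1..s}" "j \<in> {1..s}" "k \<in> {1..s}" "l \<in> {1..s}" using o by (auto simp: occ_def)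
  have gr: "g i \<in> {1..s}" "g j \<in> {1..s}" "g k \<in> {1..s}" "g l \<in> {1..s}"
    using r g by (auto simp: inv_on_def)
  have lt: "kpos K a < kpos K b \<longleftrightarrow> a < b" if "a \<in> {1..s}" "b \<in> {1..s}" for a b
    using rk_less_iff[OF E(3), of "kpos K b" "kpos K a"] kpos[OF E(3)] that E(4) by simp
  have "kpos K i \<in> {1..n}" "kpos K l \<in> {1..n}" using kpos(1)[OF E(3)] r E(2,4) by blast+
  then show ?thesis
    using o r gr by (auto simp: occ_def lt emb_kpos[OF e])
qed

lemma Occ_kpos:
  assumes e: "emb n f K s g" and o: "w \<in> Occ s g"
  shows "kpos K ` w \<in> Occ n f" "kpos K ` w \<subseteq> K"
proof -
  obtain i j k l where ijkl: "occ s g i j k l" "w = {i, j, k, l}" using o by (rule OccE)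
  show "kpos K ` w \<in> Occ n f" using OccI[OF occ_kpos[OF e ijkl(1)]] ijkl(2) by simp
  show "kpos K ` w \<subseteq> K"
    using kpos(1)[OF embD(3)[OF e]] Occ_subset[OF o] embD(4)[OF e] by blast
qed

lemma Occ_rk:
  assumes e: "emb n f K s g" and o: "w \<in> Occ n f" "w \<subseteq> K"
  shows "rk K ` w \<in> Occ s g"
proof -
  obtain i j k l where ijkl: "occ n f i j k l" "w = {i, j, k, l}" using o(1) by (rule OccE)
  then show ?thesis using OccI[OF occ_rk[OF e ijkl(1)]] o(2) by simp
qed

text \<open>Whether x forms an occurrence with three elements of K depends only on the gaps of x and
  \<open>f x\<close>, not on the places inside them. Together with \<open>bad3_occ\<close> this
  makes it a property of the cell, expressed in g.\<close>

lemma occ_bad3: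
  assumes e: "emb n f K s g" and o: "occ n f i j k l"
    and x: "x \<in> {i, j, k, l}" "x \<notin> K" "{i, j, k, l} - {x} \<subseteq> K"
  shows "bad3 s g (rk K x) (rk K (f x))"
proof -
  note E = embD[OF e]
  have lt: "i < j" "j < k" "k < l" "f k < f l" "f l < f i" "f i < f j"
    and r: "i \<in> {1..n}" "j \<in> {1..n}" "k \<in> {1..n}" "l \<in> {1..n}"
    using o by (auto simp: occ_def)
  have fx: "f x \<notin> K" using E(7) x r by auto
  have G: "g (rk K a) = rk K (f a)" if "a \<in> K" for a using E(6) that .
  have L: "rk K a < rk K b \<longleftrightarrow> a < b" if "b \<in> K" for a b using rk_less_iff[OF E(3) that] .
  have M: "rk K a \<le> rk K b" if "a < b" for a b using rk_mono[OF E(3)] that by simp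
  have P: "1 \<le> rk K a" "rk K a \<le> s" if "a \<in> K" for a
    using rk_pos[OF E(3) that order_refl] rk_le_card[OF E(3)] E(4) by auto
  have mono: "rk K i \<le> rk K j" "rk K j \<le> rk K k" "rk K k \<le> rk K l"
    "rk K (f k) \<le> rk K (f l)" "rk K (f l) \<le> rk K (f i)" "rk K (f i) \<le> rk K (f j)"
    using lt by (auto intro: M)
  have S: "rk K a < rk K b" if "b \<in> K" "a < b" for a b using L that by simp
  note F = E(5)
  have mem: "a \<in> K" if "a \<in> {i, j, k, l}" "a \<noteq> x" for a using x(3) that by blast
  consider "x = i" | "x = j" | "x = k" | "x = l" using x(1) by blast
  then show ?thesis
  proof cases
    case 1
    then have K: "j \<in> K" "k \<in> K" "l \<in> K" using lt(1-3) by (auto intro!: mem)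
    show ?thesis
      using mono P[OF K(1)] P[OF K(3)] S[OF K(1) lt(1)] S[OF K(2) lt(2)] S[OF K(3) lt(3)]
        S[OF F[OF K(3)] lt(4)] S[OF F[OF K(1)] lt(6)] G[OF K(1)] G[OF K(2)] G[OF K(3)] 1
      by (intro bad3_cases_I(1)[of "rk K j" "rk K k" "rk K l"]; simp)
  next
    case 2
    then have K: "i \<in> K" "k \<in> K" "l \<in> K" using lt(1-3) by (auto intro!: mem)
    show ?thesis
      using mono P[OF K(1)] P[OF K(3)] S[OF K(2) lt(2)] S[OF K(3) lt(3)]
        S[OF F[OF K(3)] lt(4)] S[OF F[OF K(1)] lt(5)] G[OF K(1)] G[OF K(2)] G[OF K(3)] 2
      by (intro bad3_cases_I(2)[of "rk K i" "rk K k" "rk K l"]; simp)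
  next
    case 3
    then have K: "i \<in> K" "j \<in> K" "l \<in> K" using lt(1-3) by (auto intro!: mem)
    show ?thesis
      using mono P[OF K(1)] P[OF K(3)] S[OF K(2) lt(1)] S[OF K(3) lt(3)]
        S[OF F[OF K(3)] lt(4)] S[OF F[OF K(1)] lt(5)] S[OF F[OF K(2)] lt(6)]
        G[OF K(1)] G[OF K(2)] G[OF K(3)] 3
      by (intro bad3_cases_I(3)[of "rk K i" "rk K j" "rk K l"]; simp)
  next
    case 4
    then have K: "i \<in> K" "j \<in> K" "k \<in> K" using lt(1-3) by (auto intro!: mem)
    show ?thesis
      using mono P[OF K(1)] P[OF K(3)] S[OF K(2) lt(1)] S[OF K(3) lt(2)]
        S[OF F[OF K(1)] lt(5)] S[OF F[OF K(2)] lt(6)]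
        G[OF K(1)] G[OF K(2)] G[OF K(3)] 4
      by (intro bad3_cases_I(4)[of "rk K i" "rk K j" "rk K k"]; simp)
  qed
qed

lemma bad3_occ:
  assumes e: "emb n f K s g" and x: "x \<in> {1..n}" "x \<notin> K"
    and b: "bad3 s g (rk K x) (rk K (f x))"
  obtains w where "w \<in> Occ n f" "x \<in> w" "w - {x} \<subseteq> K"
proof -
  note E = embD[OF e]
  obtain i' j' k' where ijk': "1 \<le> i'" "i' < j'" "j' < k'" "k' \<le> s"
    and d': "(rk K x < i' \<and> g j' < g k' \<and> g k' \<le> rk K (f x) \<and> rk K (f x) < g i') \<or>
      (i' \<le> rk K x \<and> rk K x < j' \<and> g j' < g k' \<and> g k' < g i' \<and> g i' \<le> rk K (f x)) \<or>
      (j' \<le> rk K x \<and> rk K x < k' \<and> rk K (f x) < g k' \<and> g k' < g i' \<and> g i' < g j') \<or>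
      (k' \<le> rk K x \<and> g k' \<le> rk K (f x) \<and> rk K (f x) < g i' \<and> g i' < g j')"
    using b unfolding bad3_def by blast
  define i j k where "i = kpos K i'" and "j = kpos K j'" and "k = kpos K k'"
  have K: "i \<in> K" "j \<in> K" "k \<in> K" and R: "rk K i = i'" "rk K j = j'" "rk K k = k'"
    using kpos[OF E(3)] ijk' E(4) by (auto simp: i_def j_def k_def)
  have FK: "f i \<in> K" "f j \<in> K" "f k \<in> K" using E(5) K by auto
  have r: "i \<in> {1..n}" "j \<in> {1..n}" "k \<in> {1..n}" using K E(2) by auto
  have fx: "f x \<notin> K" using E(7) x by auto
  have ne: "i \<noteq> x" "j \<noteq> x" "k \<noteq> x" "f i \<noteq> f x" "f j \<noteq> f x" "f k \<noteq> f x"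
    using K FK x fx by auto
  have G: "g i' = rk K (f i)" "g j' = rk K (f j)" "g k' = rk K (f k)"
    using E(6) K R by auto
  have L: "rk K a < rk K b \<longleftrightarrow> a < b" if "b \<in> K" for a b using rk_less_iff[OF E(3) that] .
  have M: "rk K a \<le> rk K b \<longleftrightarrow> a \<le> b" if "a \<in> K" for a b using rk_le_iff[OF E(3) that] .
  have ijk: "i < j" "j < k" using ijk'(2,3) K unfolding R[symmetric] by (simp_all add: L)
  have d: "(x < i \<and> f j < f k \<and> f k \<le> f x \<and> f x < f i) \<or>
      (i \<le> x \<and> x < j \<and> f j < f k \<and> f k < f i \<and> f i \<le> f x) \<or>
      (j \<le> x \<and> x < k \<and> f x < f k \<and> f k < f i \<and> f i < f j) \<or>
      (k \<le> x \<and> f k \<le> f x \<and> f x < f i \<and> f i < f j)"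
    using d' unfolding G unfolding R[symmetric] by (simp add: L M K FK)
  from d show thesis
  proof (elim disjE conjE)
    assume "x < i" "f j < f k" "f k \<le> f x" "f x < f i"
    then have "occ n f x i j k" using ijk r x ne by (auto simp: occ_def)
    from that[OF OccI[OF this]] show thesis using K by auto
  next
    assume "i \<le> x" "x < j" "f j < f k" "f k < f i" "f i \<le> f x"
    then have "occ n f i x j k" using ijk r x ne by (auto simp: occ_def)
    from that[OF OccI[OF this]] show thesis using K by auto
  next
    assume "j \<le> x" "x < k" "f x < f k" "f k < f i" "f i < f j"
    then have "occ n f i j x k" using ijk r x ne by (auto simp: occ_def)
    from that[OF OccI[OF this]] show thesis using K by auto
  next
    assume "k \<le> x" "f k \<le> f x" "f x < f i" "f i < f j"
    then have "occ n f i j k x" using ijk r x ne by (auto simp: occ_def)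
    from that[OF OccI[OF this]] show thesis using K by auto
  qed
qed

section \<open>Crossing arcs\<close>

definition sep :: "nat \<Rightarrow> nat \<Rightarrow> nat \<Rightarrow> bool" where
  "sep u v y \<longleftrightarrow> min u v < y \<and> y < max u v"

lemma sep_commute: "sep u v y = sep v u y"
  by (simp add: sep_def min.commute max.commute)

text \<open>Neither end of the arc at x belongs to K, so the half-open interval of indices in
  \<open>crossed\<close> and the open interval of \<open>sep\<close> select the same elements of
  K.\<close>

lemma crossed_iff_sep:
  assumes e: "emb n f K s g" and x: "x \<in> {1..n}" "x \<notin> K"
  shows "crossed s g (rk K x) (rk K (f x)) \<longleftrightarrow> (\<exists>e\<in>K. sep x (f x) e \<and> \<not> sep x (f x) (f e))"
proof -
  note E = embD[OF e]
  have fx: "f x \<notin> K" using E(7) x by auto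
  have in_iff: "rk K k \<in> {min (rk K x) (rk K (f x))<..max (rk K x) (rk K (f x))} \<longleftrightarrow> sep x (f x) k"
    if k: "k \<in> K" for k
  proof -
    have L: "rk K a < rk K k \<longleftrightarrow> a < k" for a using rk_less_iff[OF E(3) k] .
    have M: "rk K k \<le> rk K a \<longleftrightarrow> k \<le> a" for a using rk_le_iff[OF E(3) k] .
    have "k \<noteq> x" "k \<noteq> f x" using k x fx by auto
    then show ?thesis unfolding sep_def
      by (auto simp: L M min_less_iff_disj le_max_iff_disj less_max_iff_disj)
  qed
  have img: "{1..s} = rk K ` K" using rk_image[OF E(3)] E(4) by simp
  have iff: "(rk K k \<in> {min (rk K x) (rk K (f x))<..max (rk K x) (rk K (f x))} \<and>
       g (rk K k) \<notin> {min (rk K x) (rk K (f x))<..max (rk K x) (rk K (f x))}) \<longleftrightarrow>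
     sep x (f x) k \<and> \<not> sep x (f x) (f k)" if "k \<in> K" for k
    unfolding E(6)[OF that] in_iff[OF that] in_iff[OF E(5)[OF that]] ..
  show ?thesis unfolding crossed_def img bex_simps(7)
    by (rule bex_cong[OF refl]) (rule iff)
qed

text \<open>Exactly one end of the arc at y lies under the arc at x, and no end is shared, so the
  arcs cross. Which of them starts first is decided by the side on which \<open>f y\<close>
  lies.\<close>

lemma sep_occ:
  assumes f: "inv_on n f" and x: "x \<in> {1..n}" and y: "y \<in> {1..n}"
    and s: "sep x (f x) y" "\<not> sep x (f x) (f y)" and ne: "f y \<notin> {x, f x}"
  shows "{x, f x, y, f y} \<in> Occ n f"
proof -
  define u v where "u = min x (f x)" and "v = max x (f x)"
  have uv: "u \<in> {1..n}" "f u = v" "f v = u" "u < v" "{x, f x} = {u, v}"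
    using x s inv_onD[OF f, of x] by (auto simp: u_def v_def sep_def min_def max_def)
  have y': "u < y" "y < v" "\<not> (u < f y \<and> f y < v)" "f y \<noteq> u" "f y \<noteq> v"
    using s ne uv(5) by (auto simp: u_def v_def sep_def)
  note fy = inv_onD[OF f, of y]
  have "{u, v, y, f y} \<in> Occ n f"
  proof (cases "v < f y")
    case True
    have "occ n f u y (f u) (f y)"
      by (rule occ_crossing_arcs[OF f]) (use uv y y' True in auto)
    from OccI[OF this] show ?thesis using uv by (simp add: insert_commute)
  next
    case False
    then have "f y < u" using y' by auto
    then have "occ n f (f y) u (f (f y)) (f u)"
      by (intro occ_crossing_arcs[OF f]) (use uv y y' fy in auto)
    from OccI[OF this] show ?thesis using uv fy y by (simp add: insert_commute)
  qed
  moreover have "{x, f x, y, f y} = {u, v, y, f y}" using uv(5) by auto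
  ultimately show ?thesis by simp
qed

lemma rk_eqI:
  assumes "finite K" "\<And>k. k \<in> K \<Longrightarrow> \<not> (min y z < k \<and> k \<le> max y z)"
  shows "rk K y = rk K z"
proof -
  have "k \<le> y \<longleftrightarrow> k \<le> z" if "k \<in> K" for k
    using assms(2)[OF that] by linarith
  then have "{k \<in> K. k \<le> y} = {k \<in> K. k \<le> z}" by blast
  then show ?thesis by (simp add: rk_def)
qed

lemma rk_eqD: "finite K \<Longrightarrow> rk K y = rk K z \<Longrightarrow> k \<in> K \<Longrightarrow> k \<le> y \<longleftrightarrow> k \<le> z"
  using rk_le_iff by metis

section \<open>The crossing component of the first arc\<close>

text \<open>The inequality of truth values says that exactly one end of the arc at x lies under the
  arc at y, that is, that these arcs cross.\<close>

inductive_set arcs1 :: "(nat \<Rightarrow> nat) \<Rightarrow> nat set \<Rightarrow> nat set" for f K where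
  arcs1_one: "1 \<in> arcs1 f K"
| arcs1_image_one: "f 1 \<in> arcs1 f K"
| arcs1_step: "x \<in> arcs1 f K \<Longrightarrow> y \<in> K \<Longrightarrow> sep y (f y) x \<noteq> sep y (f y) (f x) \<Longrightarrow> y \<in> arcs1 f K"

text \<open>Closedness of K under occurrences is deliberately not assumed. It holds when K is the
  kernel, but for a filling it is the conclusion to be drawn. The absence of crossings is common to
  both cases and already yields the gap structure. A third instance takes all of g as K, for the
  bound on the size.\<close>

locale framed =
  fixes n :: nat and f :: "nat \<Rightarrow> nat" and K :: "nat set" and s :: nat and g :: "nat \<Rightarrow> nat"
  assumes emb: "emb n f K s g" and one: "1 \<in> K" and conn: "conn s g"
    and uncrossed: "\<And>x. x \<in> {1..n} \<Longrightarrow> x \<notin> K \<Longrightarrow> \<not> crossed s g (rk K x) (rk K (f x))"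
begin

lemmas f = embD(1)[OF emb] and K_sub = embD(2)[OF emb] and finK = embD(3)[OF emb]
  and K_card = embD(4)[OF emb] and K_closed = embD(5)[OF emb] and K_iff = embD(7)[OF emb]
  and g_rk = embD(6)[OF emb]
  and g = emb_inv_on[OF emb]

abbreviation "X \<equiv> arcs1 f K"

lemma f_f: "x \<in> {1..n} \<Longrightarrow> f (f x) = x" "x \<in> {1..n} \<Longrightarrow> f x \<in> {1..n}"
  using f by (auto simp: inv_on_def)

lemma X_sub: "X \<subseteq> K"
proof
  fix x assume "x \<in> X"
  then show "x \<in> K" by induction (use one K_closed in auto)
qed

lemma finX: "finite X"
  using finite_subset[OF X_sub finK] .

lemma X_closed: "x \<in> X \<Longrightarrow> f x \<in> X"
proof (induction rule: arcs1.induct)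
  case arcs1_one
  show ?case by (rule arcs1.arcs1_image_one)
next
  case arcs1_image_one
  have "1 \<in> {1..n}" using one K_sub by blast
  then show ?case using f_f(1)[of 1] arcs1.arcs1_one by simp
next
  case (arcs1_step x y)
  have "y \<in> {1..n}" using arcs1_step(2) K_sub by blast
  then show ?case
    using arcs1.arcs1_step[OF arcs1_step(1) K_closed[OF arcs1_step(2)]] arcs1_step(3) f_f(1)[of y]
    by (simp add: sep_commute)
qed

lemma X_iff: "x \<in> {1..n} \<Longrightarrow> f x \<in> X \<longleftrightarrow> x \<in> X"
  using X_closed f_f by metis

lemma same_side:
  assumes t: "t \<in> {1..n}" "t \<notin> X" and x: "x \<in> X"
  shows "sep t (f t) x = sep t (f t) (f x)"
proof (cases "t \<in> K")
  case True
  then show ?thesis using arcs1.arcs1_step[OF x, of t] t by blast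
next
  case False
  have "\<not> (\<exists>e\<in>K. sep t (f t) e \<and> \<not> sep t (f t) (f e))"
    using uncrossed[OF t(1) False] crossed_iff_sep[OF emb t(1) False] by simp
  moreover have "x \<in> K" "f x \<in> K" "f (f x) = x" using x X_sub K_closed f_f K_sub by blast+
  ultimately show ?thesis by metis
qed

text \<open>An arc outside X crosses no arc of X, so an arc of X lies under it with both ends or
  with none. The arc at 1 does not. If the arc at y did, so would everything under y, in particular
  one end of the arc at x that crosses it and comes earlier in the induction.\<close>

lemma X_not_inside:
  assumes t: "t \<in> {1..n}" "t \<notin> X" and x: "x \<in> X"
  shows "\<not> sep t (f t) x"
  using x
proof (induction rule: arcs1.induct)
  case arcs1_one
  show ?case using t f_f[OF t(1)] by (auto simp: sep_def)
next
  case arcs1_image_one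
  have "\<not> sep t (f t) 1" using t f_f[OF t(1)] by (auto simp: sep_def)
  then show ?case using same_side[OF t arcs1.arcs1_one] by simp
next
  case (arcs1_step x y)
  show ?case
  proof
    assume y: "sep t (f t) y"
    have yX: "y \<in> X" by (rule arcs1.arcs1_step) (use arcs1_step in auto)
    have fy: "sep t (f t) (f y)" using same_side[OF t yX] y by simp
    have "sep y (f y) z \<Longrightarrow> sep t (f t) z" for z
      using y fy by (auto simp: sep_def)
    moreover have "\<not> sep t (f t) x" "\<not> sep t (f t) (f x)"
      using arcs1_step(4) same_side[OF t arcs1_step(1)] by auto
    ultimately show False using arcs1_step(3) by blast
  qed
qed

lemma rk_X_mirror:
  assumes "t \<in> {1..n}" "t \<notin> X"
  shows "rk X (f t) = rk X t"
proof (rule rk_eqI[OF finX])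
  fix k assume k: "k \<in> X"
  have "k \<noteq> t" "k \<noteq> f t" using k assms X_iff by auto
  then show "\<not> (min (f t) t < k \<and> k \<le> max (f t) t)"
    using X_not_inside[OF assms k] by (auto simp: sep_def min_def max_def split: if_splits)
qed

text \<open>These are gaps of X, not of K: they may contain elements of K, and by
  \<open>rk_X_mirror\<close> they are mapped to themselves by f. Hence they are boxes on the
  diagonal to which \<open>box_first\<close> and \<open>box_second\<close> apply.\<close>

definition gap :: "nat \<Rightarrow> nat set" where
  "gap t = {y \<in> {1..n} - X. rk X y = rk X t}"

lemma gap_sub: "gap t \<subseteq> {1..n}"
  by (auto simp: gap_def)

lemma gap_self: "t \<in> {1..n} \<Longrightarrow> t \<notin> X \<Longrightarrow> t \<in> gap t"
  by (simp add: gap_def)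

lemma gap_closed: "f ` gap t \<subseteq> gap t"
  using rk_X_mirror X_iff f_f by (auto simp: gap_def)

lemma gap_convex: "convex_set (gap t)"
  unfolding convex_set_def
proof (intro ballI allI impI)
  fix x z y assume xz: "x \<in> gap t" "z \<in> gap t" and y: "x \<le> y \<and> y \<le> z"
  have r: "rk X x = rk X t" "rk X z = rk X t" using xz by (auto simp: gap_def)
  have 1: "rk X y = rk X t" using rk_mono[OF finX, of x y] rk_mono[OF finX, of y z] y r by linarith
  have "y \<notin> X"
  proof
    assume "y \<in> X"
    then have "y \<le> x" using rk_le_iff[OF finX, of y x] r 1 by simp
    then show False using y xz \<open>y \<in> X\<close> by (auto simp: gap_def)
  qed
  then show "y \<in> gap t" using 1 y xz by (auto simp: gap_def)
qed

lemma occ_gap: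
  assumes o: "occ n f i j k l" and a: "a \<in> {i, j, k, l}" "a \<notin> X" and out: "\<not> {i, j, k, l} \<subseteq> gap a"
  shows "(a \<in> {i, j} \<and> k \<in> X \<and> l \<in> X \<and> (\<forall>x\<in>gap a. f k < f l \<and> f l < x \<and> x < k \<and> k < l)) \<or>
    (a \<in> {k, l} \<and> i \<in> X \<and> j \<in> X \<and> (\<forall>x\<in>gap a. i < j \<and> j < x \<and> x < f i \<and> f i < f j))"
proof -
  have r: "i \<in> {1..n}" "j \<in> {1..n}" "k \<in> {1..n}" "l \<in> {1..n}" using o by (auto simp: occ_def)
  have aN: "a \<in> {1..n}" using a r by blast
  have aG: "a \<in> gap a" using gap_self aN a by simp
  \<comment> \<open>An arc outside X has both ends in one gap of X; if it passes over a, that gap is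
    the gap of a.\<close>
  have spanX: "y \<in> X" if y: "y \<in> {1..n}" and b: "(f y < a \<and> a < y) \<or> (y < a \<and> a < f y)"
    and yG: "y \<notin> gap a" for y
  proof (rule ccontr)
    assume "y \<notin> X"
    then have "rk X (f y) = rk X y" by (rule rk_X_mirror[OF y])
    then have "rk X a = rk X y"
      using rk_mono[OF finX, of y a] rk_mono[OF finX, of a y] rk_mono[OF finX, of "f y" a]
        rk_mono[OF finX, of a "f y"] b by auto
    then show False using yG y \<open>y \<notin> X\<close> by (simp add: gap_def)
  qed
  show ?thesis
  proof (cases "a \<in> {i, j}")
    case True
    then have meet: "i \<in> gap a \<or> j \<in> gap a" using aG by auto
    note B = box_first[OF f o gap_convex gap_closed gap_sub meet out]
    have "k \<notin> gap a" "l \<notin> gap a" using B[of k] B[of l] by auto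
    then have "k \<in> X" "l \<in> X" using spanX[OF r(3)] spanX[OF r(4)] B[OF aG] by auto
    then show ?thesis using True B by blast
  next
    case False
    then have T: "a \<in> {k, l}" using a by blast
    then have meet: "k \<in> gap a \<or> l \<in> gap a" using aG by auto
    note B = box_second[OF f o gap_convex gap_closed gap_sub meet out]
    have "i \<notin> gap a" "j \<notin> gap a" using B[of i] B[of j] by auto
    then have "i \<in> X" "j \<in> X" using spanX[OF r(1)] spanX[OF r(2)] B[OF aG] by auto
    then show ?thesis using T B by blast
  qed
qed

text \<open>The spanning pair is required to come from X. It then avoids all gaps, so heaviness is
  constant on each gap of X, as \<open>heavy_gap\<close> records.\<close>

definition heavy :: "nat \<Rightarrow> bool" where
  "heavy a \<longleftrightarrow> (\<exists>c\<in>X. \<exists>d\<in>X. c < d \<and> f c < f d \<and> f d < a \<and> a < c)"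

lemma heavyI: "c \<in> X \<Longrightarrow> d \<in> X \<Longrightarrow> c < d \<Longrightarrow> f c < f d \<Longrightarrow> f d < a \<Longrightarrow> a < c \<Longrightarrow> heavy a"
  unfolding heavy_def by blast

lemma span_gap:
  assumes a: "a \<notin> X" and b: "b \<in> gap a" and cd: "c \<in> X" "d \<in> X" "f d < a" "a < c"
  shows "f d < b" "b < c"
proof -
  have fd: "f d \<in> X" using cd(2) by (rule X_closed)
  have "rk X b = rk X a" "b \<notin> X" using b by (auto simp: gap_def)
  then have "f d \<le> a \<longleftrightarrow> f d \<le> b" "c \<le> a \<longleftrightarrow> c \<le> b"
    using rk_eqD[OF finX, of b a] fd cd by auto
  moreover have "b \<noteq> f d" using fd \<open>b \<notin> X\<close> by blast
  ultimately show "f d < b" "b < c" using cd by auto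
qed

lemma heavy_gap: "a \<notin> X \<Longrightarrow> heavy a \<Longrightarrow> b \<in> gap a \<Longrightarrow> heavy b"
  unfolding heavy_def using span_gap by meson

lemma occ_gap_heavy:
  assumes w: "w \<in> Occ n f" and a: "a \<in> w" "a \<notin> X" and out: "\<not> w \<subseteq> gap a"
  shows "heavy a"
proof -
  obtain i j k l where o: "occ n f i j k l" "w = {i, j, k, l}" using w by (rule OccE)
  have aN: "a \<in> {1..n}" using a Occ_subset[OF w] by blast
  have aG: "a \<in> gap a" using gap_self aN a by simp
  have ff: "f (f i) = i" "f (f j) = j" using o(1) f_f by (auto simp: occ_def)
  have "(k \<in> X \<and> l \<in> X \<and> f k < f l \<and> f l < a \<and> a < k \<and> k < l) \<or>
    (i \<in> X \<and> j \<in> X \<and> i < j \<and> j < a \<and> a < f i \<and> f i < f j)"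
    using occ_gap[OF o(1), of a] a out o(2) aG by blast
  then show ?thesis
  proof
    assume "k \<in> X \<and> l \<in> X \<and> f k < f l \<and> f l < a \<and> a < k \<and> k < l"
    then show ?thesis using heavyI[of k l a] by blast
  next
    assume "i \<in> X \<and> j \<in> X \<and> i < j \<and> j < a \<and> a < f i \<and> f i < f j"
    then show ?thesis using heavyI[of "f i" "f j" a] X_closed ff by simp
  qed
qed

text \<open>This is connectivity of g carried over by \<open>kpos\<close>. Only occurrences inside K
  need to preserve T, since these are the ones that come from g.\<close>

lemma K_induct:
  assumes "1 \<in> T" "f 1 \<in> T" "\<And>w. w \<in> Occ n f \<Longrightarrow> w \<subseteq> K \<Longrightarrow> w \<inter> T \<noteq> {} \<Longrightarrow> w \<subseteq> T"
  shows "K \<subseteq> T"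
proof -
  have "1 \<in> {1..n}" using one K_sub by blast
  have rk1: "rk K 1 = 1"
  proof -
    have "{k \<in> K. k \<le> 1} = {1}" using one K_sub by force
    then show ?thesis by (simp add: rk_def)
  qed
  have k1: "kpos K 1 = 1" using kpos_rk[OF finK one] rk1 by simp
  have s1: "1 \<in> {1..s}" using conn by (simp add: conn_def)
  have "{1..s} \<subseteq> {i \<in> {1..s}. kpos K i \<in> T}"
  proof (rule conn_induct[OF conn])
    show "1 \<in> {i \<in> {1..s}. kpos K i \<in> T}" using s1 k1 assms(1) by simp
    have "kpos K (g 1) = f 1" using emb_kpos[OF emb s1] k1 by simp
    moreover have "g 1 \<in> {1..s}" using g s1 by (auto simp: inv_on_def)
    ultimately show "g 1 \<in> {i \<in> {1..s}. kpos K i \<in> T}" using assms(2) by simp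
  next
    fix w assume w: "w \<in> Occ s g" "w \<inter> {i \<in> {1..s}. kpos K i \<in> T} \<noteq> {}"
    have "kpos K ` w \<subseteq> T"
      by (rule assms(3)[OF Occ_kpos[OF emb w(1)]]) (use w(2) in blast)
    then show "w \<subseteq> {i \<in> {1..s}. kpos K i \<in> T}" using Occ_subset[OF w(1)] by blast
  qed
  then have "kpos K (rk K x) \<in> T" if "x \<in> K" for x
    using rk_image[OF finK] K_card that by blast
  then show ?thesis using kpos_rk[OF finK] by auto
qed

text \<open>An element outside X that is not heavy has all its occurrences inside its own gap, where
  nothing is heavy either. Hence connectivity never reaches it from X, and gaps that are not heavy
  contain no element of K.\<close>

lemma K_heavy: "K \<subseteq> {x \<in> K. x \<in> X \<or> heavy x}"
proof (rule K_induct)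
  show "1 \<in> {x \<in> K. x \<in> X \<or> heavy x}" using one arcs1_one by simp
  show "f 1 \<in> {x \<in> K. x \<in> X \<or> heavy x}" using K_closed[OF one] arcs1_image_one by simp
next
  fix w assume w: "w \<in> Occ n f" "w \<subseteq> K" "w \<inter> {x \<in> K. x \<in> X \<or> heavy x} \<noteq> {}"
  then obtain y where y: "y \<in> w" "y \<in> X \<or> heavy y" by blast
  have "b \<in> X \<or> heavy b" if b: "b \<in> w" for b
  proof (rule ccontr)
    assume no: "\<not> (b \<in> X \<or> heavy b)"
    then have "w \<subseteq> gap b" using occ_gap_heavy[OF w(1) b] by blast
    then have "y \<in> gap b" using y by blast
    then have "y \<notin> X" "b \<in> gap y" using Occ_subset[OF w(1)] b no by (auto simp: gap_def)
    then show False using heavy_gap[of y b] y(2) no by blast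
  qed
  then show "w \<subseteq> {x \<in> K. x \<in> X \<or> heavy x}" using w(2) by blast
qed

lemma light_gap_disjoint:
  assumes x: "x \<in> {1..n}" "x \<notin> K" "\<not> heavy x"
  shows "gap x \<inter> K = {}"
proof (rule ccontr)
  assume "gap x \<inter> K \<noteq> {}"
  then obtain y where y: "y \<in> gap x" "y \<in> K" by blast
  then have "y \<notin> X" "x \<in> gap y" using x X_sub by (auto simp: gap_def)
  moreover have "heavy y" using K_heavy y(2) \<open>y \<notin> X\<close> by blast
  ultimately show False using heavy_gap x(3) by blast
qed

lemma light_gap_rk:
  assumes x: "x \<in> {1..n}" "x \<notin> K" "\<not> heavy x" and y: "y \<in> gap x"
  shows "rk K y = rk K x"
proof (rule rk_eqI[OF finK])
  fix k assume k: "k \<in> K"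
  have xG: "x \<in> gap x" using gap_self x X_sub by blast
  show "\<not> (min y x < k \<and> k \<le> max y x)"
  proof
    assume "min y x < k \<and> k \<le> max y x"
    then have "k \<in> gap x"
      using convex_setD[OF gap_convex[of x] xG y, of k] convex_setD[OF gap_convex[of x] y xG, of k]
      by (auto simp: min_def max_def split: if_splits)
    then show False using light_gap_disjoint[OF x] k by blast
  qed
qed

end

text \<open>The condition on the content inside one cell; \<open>bad3\<close> and
  \<open>crossed\<close> restrict only which cells may be occupied.\<close>

definition ascents_light :: "nat \<Rightarrow> (nat \<Rightarrow> nat) \<Rightarrow> nat set \<Rightarrow> nat \<Rightarrow> (nat \<Rightarrow> nat) \<Rightarrow> bool" where
  "ascents_light n f K s g \<longleftrightarrow> (\<forall>x\<in>{1..n} - K. \<forall>y\<in>{1..n} - K.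
     x < y \<and> rk K x = rk K y \<and> rk K (f x) = rk K (f y) \<and> f x < f y \<longrightarrow> light s g (rk K x))"

section \<open>Occurrences that leave K\<close>

context framed
begin

lemma occ_gap_span:
  assumes o: "occ n f i j k l" and x: "x \<in> {i, j}" "x \<notin> X" and k: "k \<in> X"
  shows "f l < x \<and> f l < f x \<and> x < k \<and> f x < k"
proof -
  have r: "x \<in> {1..n}" "x \<notin> {k, l}" using o x(1) by (auto simp: occ_def)
  have G: "x \<in> gap x" by (rule gap_self[OF r(1) x(2)])
  have "k \<notin> gap x" using k by (simp add: gap_def)
  then have "\<forall>y\<in>gap x. f l < y \<and> y < k"
    using occ_gap[OF o, of x] x r(2) by blast
  then show ?thesis using G gap_closed[of x] by blast
qed

text \<open>If a and b lie in different cells, one of them forms a 3412 with three elements of K or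
  has its arc crossed, by \<open>ascending_covered\<close>. If they share a cell,
  \<open>ascents_light\<close> declares its column light, while c and d span it.\<close>

lemma covered_ascent:
  assumes no_bad: "\<And>x. x \<in> {1..n} \<Longrightarrow> x \<notin> K \<Longrightarrow> \<not> bad3 s g (rk K x) (rk K (f x))"
    and asc: "ascents_light n f K s g"
    and a: "a \<in> {1..n}" "a \<notin> K" and b: "b \<in> {1..n}" "b \<notin> K" and ab: "a < b" "f a < f b"
    and c: "c \<in> K" and d: "d \<in> K" and cd: "c < d" "f c < f d" "f d < a" "f d < f a" "b < c" "f b < c"
  shows False
proof -
  have fd: "f d \<in> K" and fc: "f c \<in> K" using K_closed c d by auto
  have r: "g (rk K c) < g (rk K d)" "rk K c < rk K d" "rk K d \<le> s" "g (rk K d) \<le> rk K a"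
    "g (rk K d) \<le> rk K (f a)" "rk K b < rk K c" "rk K (f b) < rk K c" "1 \<le> rk K c"
    using cd g_rk[OF c] g_rk[OF d] rk_less_iff[OF finK fd] rk_less_iff[OF finK d]
      rk_less_iff[OF finK c] rk_le_iff[OF finK fd] rk_le_card[OF finK, of d] K_card
      rk_pos[OF finK c order_refl] by simp_all
  have le: "rk K a \<le> rk K b" "rk K (f a) \<le> rk K (f b)"
    using rk_mono[OF finK] ab by simp_all
  show False
  proof (cases "rk K a < rk K b \<or> rk K (f a) < rk K (f b)")
    case True
    show False
      by (rule ascending_covered[OF g no_bad[OF a] uncrossed[OF a] no_bad[OF b] uncrossed[OF b]
            le True r(2,1,3,4,5,6,7)])
  next
    case False
    then have "rk K a = rk K b" "rk K (f a) = rk K (f b)" "a \<in> {1..n} - K" "b \<in> {1..n} - K"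
      using le a b by auto
    then have "light s g (rk K a)"
      using asc ab unfolding ascents_light_def by blast
    moreover have "covered s g (rk K a) (rk K a)"
      by (rule coveredI[OF r(8,2,3,1,4)]) (use r le in linarith)
    ultimately show False by simp
  qed
qed

text \<open>Let a in w be outside K. If w leaves the gap of a, two of its entries are in X and span
  that gap; the other two form an ascent with one or both entries outside K, which
  \<open>bad3\<close> or \<open>covered_ascent\<close> excludes. If w stays in a heavy gap, half of
  w is an ascent below the spanning pair of that gap, with the same contradiction. What remains is a
  gap that is not heavy, and K does not meet it.\<close>

lemma occ_in_light_gap:
  assumes no_bad: "\<And>x. x \<in> {1..n} \<Longrightarrow> x \<notin> K \<Longrightarrow> \<not> bad3 s g (rk K x) (rk K (f x))"
    and asc: "ascents_light n f K s g"
    and w: "w \<in> Occ n f" and out: "\<not> w \<subseteq> K"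
  shows "\<exists>l\<in>{1..s}. light s g l \<and> w \<subseteq> {x \<in> {1..n} - K. rk K x = l}"
proof -
  obtain i j k l where o: "occ n f i j k l" and w_eq: "w = {i, j, k, l}" using w by (rule OccE)
  have wN: "w \<subseteq> {1..n}" by (rule Occ_subset[OF w])
  obtain a where a: "a \<in> w" "a \<notin> K" using out by blast
  have aN: "a \<in> {1..n}" and aX: "a \<notin> X" using a wN X_sub by auto
  have aG: "a \<in> gap a" by (rule gap_self[OF aN aX])
  have lt: "i < j" "j < k" "k < l" "f k < f l" "f l < f i" "f i < f j" using o by (auto simp: occ_def)
  have ff: "f (f i) = i" "f (f j) = j" using w_eq wN f_f by auto
  have one_outside: False if b: "b \<in> w" "b \<notin> K" "w - {b} \<subseteq> K" for b
    using occ_bad3[OF emb o, of b] no_bad[of b] b w_eq wN by auto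
  \<comment> \<open>An ascent below a spanning pair of X cannot have an entry outside K. If exactly
    one entry is outside, the ascent and the pair form a 3412 with three entries in K.\<close>
  have pair: False if p: "p \<in> {1..n}" and q: "q \<in> {1..n}" and pq: "p < q" "f p < f q"
    and out: "p \<notin> K \<or> q \<notin> K"
    and c: "c \<in> X" and d: "d \<in> X" and cd: "c < d" "f c < f d" "f d < p" "f d < f p" "q < c" "f q < c"
    for p q c d
  proof (cases "p \<notin> K \<and> q \<notin> K")
    case True
    then show False
      using covered_ascent[OF no_bad asc p _ q _ pq _ _ cd] c d X_sub by blast
  next
    case False
    have cK: "c \<in> K" "d \<in> K" using c d X_sub by auto
    have "occ n f p q c d" using p q pq cd K_sub cK by (auto simp: occ_def)
    moreover from this have "p \<noteq> q" "p \<noteq> c" "p \<noteq> d" "q \<noteq> c" "q \<noteq> d" by (auto simp: occ_def)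
    ultimately show False
      using occ_bad3[OF emb, of p q c d p] occ_bad3[OF emb, of p q c d q] no_bad[OF p] no_bad[OF q]
        False out cK by blast
  qed
  have in_gap: "w \<subseteq> gap a"
  proof (rule ccontr)
    assume not_in: "\<not> w \<subseteq> gap a"
    have "(a \<in> {i, j} \<and> k \<in> X \<and> l \<in> X \<and> (\<forall>x\<in>gap a. f k < f l \<and> f l < x \<and> x < k \<and> k < l)) \<or>
      (a \<in> {k, l} \<and> i \<in> X \<and> j \<in> X \<and> (\<forall>x\<in>gap a. i < j \<and> j < x \<and> x < f i \<and> f i < f j))"
      using occ_gap[OF o, of a] a aX not_in w_eq by blast
    then show False
    proof
      assume A: "a \<in> {i, j} \<and> k \<in> X \<and> l \<in> X \<and> (\<forall>x\<in>gap a. f k < f l \<and> f l < x \<and> x < k \<and> k < l)"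
      have kl: "k \<in> K" "l \<in> K" using A X_sub by auto
      show False
      proof (cases "i \<notin> K \<and> j \<notin> K")
        case True
        then have "i \<notin> X" "j \<notin> X" using X_sub by blast+
        then have cov: "f l < x \<and> f l < f x \<and> x < k \<and> f x < k" if "x \<in> {i, j}" for x
          by (intro occ_gap_span[OF o]) (use that A in auto)
        show False
          using pair[of i j k l] True A lt cov[of i] cov[of j] w_eq wN by auto
      next
        case False
        then have "w - {a} \<subseteq> K" using A a w_eq kl by auto
        then show False by (rule one_outside[OF a])
      qed
    next
      assume A: "a \<in> {k, l} \<and> i \<in> X \<and> j \<in> X \<and> (\<forall>x\<in>gap a. i < j \<and> j < x \<and> x < f i \<and> f i < f j)"
      have ij: "i \<in> K" "j \<in> K" using A X_sub by auto
      show False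
      proof (cases "k \<notin> K \<and> l \<notin> K")
        case True
        then have kl: "k \<notin> X" "l \<notin> X" using X_sub by blast+
        have cov: "j < x \<and> j < f x \<and> x < f i \<and> f x < f i" if x: "x \<in> {k, l}" for x
        proof -
          have "x \<in> {1..n}" using x w_eq wN by auto
          then show ?thesis
            using occ_gap_span[OF occ_mirror[OF f o], of "f x"] x kl A X_closed X_iff[of x] f_f(1)[of x] ff
            by auto
        qed
        show False
          using pair[of k l "f i" "f j"] True A X_closed lt cov[of k] cov[of l] w_eq wN ff by auto
      next
        case False
        then have "w - {a} \<subseteq> K" using A a w_eq ij by auto
        then show False by (rule one_outside[OF a])
      qed
    qed
  qed
  have not_heavy: "\<not> heavy a"
  proof
    assume "heavy a"
    then obtain c d where cd: "c \<in> X" "d \<in> X" "c < d" "f c < f d" "f d < a" "a < c"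
      by (auto simp: heavy_def)
    have cov: "f d < x \<and> f d < f x \<and> x < c \<and> f x < c" if x: "x \<in> w" for x
    proof -
      have "x \<in> gap a" "f x \<in> gap a" using in_gap gap_closed x by blast+
      then show ?thesis using span_gap[OF aX _ cd(1,2,5,6)] by blast
    qed
    have "a \<in> {i, j} \<or> a \<in> {k, l}" using a w_eq by blast
    then show False
      using pair[of i j c d] pair[of k l c d] cd cov[of i] cov[of j] cov[of k] cov[of l] lt a w_eq wN
      by auto
  qed
  have "w \<inter> K = {}" using light_gap_disjoint[OF aN a(2) not_heavy] in_gap by blast
  moreover have rk: "rk K x = rk K a" if "x \<in> w" for x
    using light_gap_rk[OF aN a(2) not_heavy] in_gap that by blast
  ultimately have sub: "w \<subseteq> {x \<in> {1..n} - K. rk K x = rk K a}" using wN by auto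
  \<comment> \<open>Absence of heaviness concerns X only, whereas \<open>light\<close> refers to all
    of g. The ascent from i to j lies in a single cell, so \<open>ascents_light\<close> supplies the
    missing statement.\<close>
  have "i \<in> {1..n} - K" "j \<in> {1..n} - K" "rk K (f i) = rk K (f j)"
  proof -
    show "i \<in> {1..n} - K" "j \<in> {1..n} - K" using sub w_eq by auto
    have "f i \<in> gap a" "f j \<in> gap a" using in_gap w_eq gap_closed by blast+
    then show "rk K (f i) = rk K (f j)" using light_gap_rk[OF aN a(2) not_heavy] by simp
  qed
  moreover have "rk K i = rk K a" "rk K j = rk K a" using rk w_eq by auto
  ultimately have "light s g (rk K a)"
    using asc lt(1,6) unfolding ascents_light_def by metis
  moreover have "rk K a \<in> {1..s}"
    using rk_pos[OF finK one, of a] rk_le_card[OF finK, of a] K_card aN by simp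
  ultimately show ?thesis using sub by blast
qed

text \<open>An occurrence that leaves the gap of z has two entries in X by \<open>occ_gap\<close>.
  If w stays in the gap, the half of w containing z is kept and the other half is exchanged for the
  pair of X spanning the gap.\<close>

lemma kernel_heavy_occ:
  assumes z: "z \<in> K" "z \<notin> X" and w: "w \<in> Occ n f" "z \<in> w" "w \<subseteq> K"
  shows "\<exists>w'\<in>Occ n f. z \<in> w' \<and> w' \<subseteq> K \<and> card (w' - X) \<le> 2"
proof -
  obtain i j k l where o: "occ n f i j k l" and w_eq: "w = {i, j, k, l}" using w(1) by (rule OccE)
  have zN: "z \<in> {1..n}" using z K_sub by auto
  have card2: "card {p, q} \<le> 2" for p q :: nat by (simp add: card_insert_if)
  show ?thesis
  proof (cases "w \<subseteq> gap z")
    case False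
    then have "k \<in> X \<and> l \<in> X \<or> i \<in> X \<and> j \<in> X"
      using occ_gap[OF o, of z] w(2) z w_eq by blast
    then have "w - X \<subseteq> {i, j} \<or> w - X \<subseteq> {k, l}" using w_eq by blast
    then have "card (w - X) \<le> 2"
      using card_mono[of "{i, j}" "w - X"] card_mono[of "{k, l}" "w - X"] card2[of i j] card2[of k l]
      by auto
    then show ?thesis using w by blast
  next
    case True
    have "heavy z" using K_heavy z by blast
    then obtain c d where cd: "c \<in> X" "d \<in> X" "c < d" "f c < f d" "f d < z" "z < c"
      by (auto simp: heavy_def)
    have lt: "i < j" "j < k" "k < l" "f k < f l" "f l < f i" "f i < f j" using o by (auto simp: occ_def)
    have cov: "f d < x \<and> f d < f x \<and> x < c \<and> f x < c" if x: "x \<in> w" for x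
    proof -
      have "x \<in> gap z" "f x \<in> gap z" using True gap_closed x by blast+
      then show ?thesis using span_gap[OF z(2) _ cd(1,2,5,6)] by blast
    qed
    have new: "\<exists>w'\<in>Occ n f. z \<in> w' \<and> w' \<subseteq> K \<and> card (w' - X) \<le> 2"
      if pq: "p \<in> w" "q \<in> w" "p < q" "f p < f q" "z \<in> {p, q}" for p q
    proof -
      have "d \<in> {1..n}" using cd X_sub K_sub by blast
      then have "occ n f p q c d"
        using cov[OF pq(1)] cov[OF pq(2)] pq cd Occ_subset[OF w(1)] by (auto simp: occ_def)
      then have h1: "{p, q, c, d} \<in> Occ n f" by (rule OccI)
      have h2: "{p, q, c, d} \<subseteq> K" using pq w(3) cd X_sub by blast
      have h3: "card ({p, q, c, d} - X) \<le> 2"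
      proof -
        have "{p, q, c, d} - X \<subseteq> {p, q}" using cd by blast
        then show ?thesis using card_mono[of "{p, q}" "{p, q, c, d} - X"] card2[of p q] by simp
      qed
      have h4: "z \<in> {p, q, c, d}" using pq(5) by blast
      show ?thesis by (rule bexI[OF _ h1]) (intro conjI h2 h3 h4)
    qed
    consider "z \<in> {i, j}" | "z \<in> {k, l}" using w(2) w_eq by blast
    then show ?thesis
    proof cases
      case 1
      show ?thesis by (rule new[OF _ _ lt(1,6) 1]) (simp_all add: w_eq)
    next
      case 2
      show ?thesis by (rule new[OF _ _ lt(3,4) 2]) (simp_all add: w_eq)
    qed
  qed
qed

end

section \<open>Copies closed under occurrences\<close>

lemma closed_no_bad3:
  assumes e: "emb n f K s g" and A: "\<And>w. w \<in> Occ n f \<Longrightarrow> w \<inter> K \<noteq> {} \<Longrightarrow> w \<subseteq> K"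
    and x: "x \<in> {1..n}" "x \<notin> K"
  shows "\<not> bad3 s g (rk K x) (rk K (f x))"
proof
  assume "bad3 s g (rk K x) (rk K (f x))"
  then obtain w where w: "w \<in> Occ n f" "x \<in> w" "w - {x} \<subseteq> K"
    by (rule bad3_occ[OF e x])
  obtain i j k l where "occ n f i j k l" "w = {i, j, k, l}" using w(1) by (rule OccE)
  then have "i \<in> w" "j \<in> w" "i \<noteq> j" by (auto simp: occ_def)
  then have "w \<inter> K \<noteq> {}" using w(3) by blast
  then show False using A[OF w(1)] w(2) x by blast
qed

lemma closed_uncrossed:
  assumes e: "emb n f K s g" and A: "\<And>w. w \<in> Occ n f \<Longrightarrow> w \<inter> K \<noteq> {} \<Longrightarrow> w \<subseteq> K"
    and x: "x \<in> {1..n}" "x \<notin> K"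
  shows "\<not> crossed s g (rk K x) (rk K (f x))"
proof
  note E = embD[OF e]
  assume "crossed s g (rk K x) (rk K (f x))"
  then obtain y where y: "y \<in> K" "sep x (f x) y" "\<not> sep x (f x) (f y)"
    using crossed_iff_sep[OF e x] by blast
  have "f y \<in> K" "f x \<notin> K" "y \<in> {1..n}" using E(2,5,7) y(1) x by auto
  then have "{x, f x, y, f y} \<in> Occ n f"
    by (intro sep_occ[OF E(1) x(1) _ y(2,3)]) (use x in auto)
  then show False using A[of "{x, f x, y, f y}"] y(1) x(2) by blast
qed

lemma closed_framed:
  assumes "emb n f K s g" "1 \<in> K" "conn s g" "\<And>w. w \<in> Occ n f \<Longrightarrow> w \<inter> K \<noteq> {} \<Longrightarrow> w \<subseteq> K"
  shows "framed n f K s g"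
  using assms closed_uncrossed[OF assms(1,4)] by unfold_locales auto

text \<open>In every other case the cell is spanned: by assumption on the diagonal, by
  \<open>off_diagonal_covered\<close> elsewhere. The spanning pair and the ascent would be an
  occurrence that meets K and leaves it.\<close>

lemma closed_ascent:
  assumes e: "emb n f K s g" and one: "1 \<in> K" and c: "conn s g"
    and A: "\<And>w. w \<in> Occ n f \<Longrightarrow> w \<inter> K \<noteq> {} \<Longrightarrow> w \<subseteq> K"
    and x: "x \<in> {1..n}" "x \<notin> K" and y: "y \<in> {1..n}" "y \<notin> K"
    and xy: "x < y" "f x < f y" "rk K x = rk K y" "rk K (f x) = rk K (f y)"
  shows "rk K (f x) = rk K x \<and> light s g (rk K x)"
proof (rule ccontr)
  assume neg: "\<not> ?thesis"
  note E = embD[OF e]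
  define l m where "l = rk K x" and "m = rk K (f x)"
  have fx: "f x \<in> {1..n}" "f x \<notin> K" "f y \<in> {1..n}" "f y \<notin> K"
    using E(1,7) x y by (auto simp: inv_on_def)
  have r: "1 \<le> l" "l \<le> s" "1 \<le> m" "m \<le> s"
    using rk_pos[OF E(3) one] rk_le_card[OF E(3)] E(4) x fx by (auto simp: l_def m_def)
  have nc: "\<not> crossed s g l m" using closed_uncrossed[OF e A x] by (simp add: l_def m_def)
  have "covered s g (min l m) (max l m)"
  proof (cases "l = m")
    case True
    then show ?thesis using neg by (simp add: l_def m_def)
  next
    case False
    then have "min l m < max l m" by auto
    moreover have "\<not> crossed s g (min l m) (max l m)"
      using nc crossed_commute by (auto simp: min_def max_def)
    ultimately show ?thesis using off_diagonal_covered[OF c, of "min l m" "max l m"] r by auto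
  qed
  then obtain c' d' where cd': "1 \<le> c'" "c' < d'" "d' \<le> s" "g c' < g d'" "g d' \<le> min l m"
    "max l m < c'"
    unfolding covered_def by blast
  define c d where "c = kpos K c'" and "d = kpos K d'"
  have K: "c \<in> K" "d \<in> K" "rk K c = c'" "rk K d = d'"
    using kpos[OF E(3)] cd' E(4) by (auto simp: c_def d_def)
  have fK: "f c \<in> K" "f d \<in> K" "rk K (f c) = g c'" "rk K (f d) = g d'" using E(5,6) K by auto
  have "c < d" "f c < f d"
    using cd' K fK rk_less_iff[OF E(3), of d c] rk_less_iff[OF E(3), of "f d" "f c"] by auto
  moreover have "f d < z \<and> z < c" if z: "z \<notin> K" "rk K z = l \<or> rk K z = m" for z
  proof -
    have "rk K (f d) \<le> rk K z" "rk K z < rk K c" using z cd' K fK by auto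
    then have "f d \<le> z" "z < c" using rk_le_iff[OF E(3) fK(2)] rk_less_iff[OF E(3) K(1)] by auto
    then show ?thesis using z fK by (metis le_neq_implies_less)
  qed
  then have "f d < x" "y < c" "f d < f x" using x y fx xy by (auto simp: l_def m_def)
  ultimately have "occ n f x y c d" using x y xy K E(2) by (auto simp: occ_def)
  from A[OF OccI[OF this]] show False using K x by blast
qed

section \<open>The size of a kernel\<close>

context framed
begin

text \<open>The summand 2 pays for the starting set consisting of 1 and \<open>f 1\<close>, which
  may contain no occurrence. Every enlargement by at most two elements that completes a new
  occurrence keeps the bound, as \<open>few_extend\<close> shows.\<close>

definition few :: "nat set \<Rightarrow> bool" where
  "few Y \<longleftrightarrow> Y \<subseteq> K \<and> card Y \<le> 2 * card {w \<in> Occ n f. w \<subseteq> Y} + 2"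

lemma few_extend:
  assumes Y: "few Y" and w: "w \<in> Occ n f" "\<not> w \<subseteq> Y"
    and Z: "Y \<union> w \<subseteq> Z" "Z \<subseteq> K" "card (Z - Y) \<le> 2"
  shows "few Z"
proof -
  have fin: "finite Z" "finite Y" using finite_subset[OF Z(2) finK] Z(1) finite_subset by auto
  have "insert w {w \<in> Occ n f. w \<subseteq> Y} \<subseteq> {w \<in> Occ n f. w \<subseteq> Z}" using w Z by blast
  then have "card (insert w {w \<in> Occ n f. w \<subseteq> Y}) \<le> card {w \<in> Occ n f. w \<subseteq> Z}"
    by (intro card_mono) (auto simp: finite_Occ)
  then have "card {w \<in> Occ n f. w \<subseteq> Y} + 1 \<le> card {w \<in> Occ n f. w \<subseteq> Z}"
    using w(2) by (simp add: finite_Occ)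
  moreover have "card Z = card (Z - Y) + card Y"
    using card_Un_disjoint[of "Z - Y" Y] fin Z(1) by (simp add: Un_absorb2 inf_commute)
  ultimately show ?thesis using Y Z unfolding few_def by auto
qed

lemma few_component: "\<exists>Y. few Y \<and> X \<subseteq> Y"
proof -
  define S where "S = {Y. few Y \<and> 1 \<in> Y \<and> f ` Y \<subseteq> Y}"
  have fin: "finite S"
    by (rule finite_subset[of _ "Pow K"]) (auto simp: S_def few_def finK)
  have one_N: "1 \<in> {1..n}" using one K_sub by blast
  have "card {1, f 1} \<le> 2" by (simp add: card_insert_if)
  then have "{1, f 1} \<in> S"
    using one K_closed[OF one] f_f(1)[OF one_N] by (simp add: S_def few_def)
  then obtain Y where Y: "Y \<in> S" and max: "\<forall>Z\<in>S. Y \<subseteq> Z \<longrightarrow> Y = Z"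
    using finite_has_maximal[OF fin] by blast
  have YK: "Y \<subseteq> K" "few Y" "1 \<in> Y" and fY: "f ` Y \<subseteq> Y" using Y by (auto simp: S_def few_def)
  have "x \<in> Y" if "x \<in> X" for x
    using that
  proof induction
    case arcs1_one
    show ?case by (rule YK(3))
  next
    case arcs1_image_one
    show ?case using YK(3) fY by blast
  next
    case (arcs1_step x y)
    have N: "x \<in> {1..n}" "y \<in> {1..n}" using arcs1_step YK K_sub by auto
    have xY: "x \<in> Y" "f x \<in> Y" using arcs1_step(4) fY by auto
    show ?case
    proof (rule ccontr)
      assume yY: "y \<notin> Y"
      then have fyY: "f y \<notin> Y" using fY f_f(1)[OF N(2)] by force
      \<comment> \<open>The end of the arc at x that lies under the arc at y, so that
        \<open>sep_occ\<close> applies to the two crossing arcs.\<close>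
      define e where "e = (if sep y (f y) x then x else f x)"
      have e: "sep y (f y) e" "\<not> sep y (f y) (f e)" "e \<in> {1..n}" "f e \<notin> {y, f y}" "e \<in> Y" "f e \<in> Y"
        using arcs1_step(3) f_f[OF N(1)] N(1) xY yY fyY by (auto simp: e_def)
      define w where "w = {y, f y, e, f e}"
      have w: "w \<in> Occ n f" unfolding w_def by (rule sep_occ[OF f N(2) e(3,1,2,4)])
      have "few (Y \<union> {y, f y})"
      proof (rule few_extend[OF YK(2) w])
        show "\<not> w \<subseteq> Y" using yY by (auto simp: w_def)
        show "Y \<union> w \<subseteq> Y \<union> {y, f y}" using e by (auto simp: w_def)
        show "Y \<union> {y, f y} \<subseteq> K" using YK K_closed arcs1_step(2) by auto
        have "Y \<union> {y, f y} - Y = {y, f y}" using yY fyY by blast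
        then show "card (Y \<union> {y, f y} - Y) \<le> 2" by (simp add: card_insert_if)
      qed
      then have "Y \<union> {y, f y} \<in> S" using YK fY f_f(1)[OF N(2)] by (auto simp: S_def)
      then have "Y = Y \<union> {y, f y}" by (rule max[rule_format]) blast
      then show False using yY by blast
    qed
  qed
  then show ?thesis using YK by blast
qed

lemma few_K: "few K"
proof -
  define S where "S = {Y. few Y \<and> X \<subseteq> Y}"
  have fin: "finite S"
    by (rule finite_subset[of _ "Pow K"]) (auto simp: S_def few_def finK)
  have "S \<noteq> {}" using few_component by (auto simp: S_def)
  then obtain Y where Y: "Y \<in> S" and max: "\<forall>Z\<in>S. Y \<subseteq> Z \<longrightarrow> Y = Z"
    using finite_has_maximal[OF fin] by blast
  have YK: "few Y" "X \<subseteq> Y" "Y \<subseteq> K" using Y by (auto simp: S_def few_def)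
  have "K \<subseteq> Y"
  proof (rule ccontr)
    assume "\<not> K \<subseteq> Y"
    then obtain z where z: "z \<in> K" "z \<notin> Y" by blast
    have zX: "z \<notin> X" using z YK by blast
    \<comment> \<open>Otherwise K without z would contain 1 and \<open>f 1\<close> and be closed
      under the occurrences inside K, against connectivity.\<close>
    have "\<exists>w\<in>Occ n f. w \<subseteq> K \<and> z \<in> w"
    proof (rule ccontr)
      assume no: "\<not> ?thesis"
      have "K \<subseteq> K - {z}"
        by (rule K_induct) (use no one K_closed zX arcs1_one arcs1_image_one in auto)
      then show False using z by blast
    qed
    then obtain w0 where "w0 \<in> Occ n f" "z \<in> w0" "w0 \<subseteq> K" by blast
    then obtain w where w: "w \<in> Occ n f" "z \<in> w" "w \<subseteq> K" "card (w - X) \<le> 2"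
      using kernel_heavy_occ[OF z(1) zX] by blast
    have "few (Y \<union> w)"
    proof (rule few_extend[OF YK(1) w(1)])
      have "Y \<union> w - Y \<subseteq> w - X" using YK by blast
      then show "card (Y \<union> w - Y) \<le> 2"
        using w(4) card_mono[of "w - X" "Y \<union> w - Y"] finite_subset[OF w(3) finK] by simp
    qed (use w z YK in auto)
    then have "Y \<union> w \<in> S" using YK by (auto simp: S_def)
    then have "Y = Y \<union> w" by (rule max[rule_format]) blast
    then show False using z w by blast
  qed
  then have "Y = K" by (rule subset_antisym[OF YK(3)])
  then show ?thesis using YK(1) by simp
qed

end

lemma rk_atLeastAtMost: "x \<in> {1..s} \<Longrightarrow> rk {1..s} x = x"
proof -
  assume x: "x \<in> {1..s}"
  then have "{k \<in> {1..s}. k \<le> x} = {1..x}" by auto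
  then show ?thesis by (simp add: rk_def)
qed

text \<open>With all of g as K nothing lies outside K, so the condition on crossings is vacuous and
  \<open>few_K\<close> is the desired bound.\<close>

lemma conn_size:
  assumes "conn s g"
  shows "s \<le> 2 * card (Occ s g) + 2"
proof -
  have g: "inv_on s g" "1 \<le> s" using assms by (auto simp: conn_def)
  have "framed s g {1..s} s g"
  proof
    show "emb s g {1..s} s g" unfolding emb_def
      using g by (auto simp: inv_on_def rk_atLeastAtMost[unfolded One_nat_def])
  qed (use assms g in auto)
  then interpret framed s g "{1..s}" s g .
  have "{w \<in> Occ s g. w \<subseteq> {1..s}} = Occ s g" using Occ_subset by blast
  then show ?thesis using few_K unfolding few_def by simp
qed

section \<open>One-line notation\<close>

definition plist :: "nat \<Rightarrow> (nat \<Rightarrow> nat) \<Rightarrow> nat list" where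
  "plist n f = map f [1..<Suc n]"

lemma length_plist [simp]: "length (plist n f) = n"
  by (simp add: plist_def)

lemma entry_plist: "i \<in> {1..n} \<Longrightarrow> entry (plist n f) i = f i"
  by (auto simp: entry_def plist_def nth_append nth_upt simp del: upt_Suc)

lemma plist_entry: "length p = n \<Longrightarrow> plist n (entry p) = p"
  by (rule nth_equalityI) (auto simp: entry_def plist_def nth_upt simp del: upt_Suc)

lemma plist_cong: "(\<And>i. i \<in> {1..n} \<Longrightarrow> f i = g i) \<Longrightarrow> plist n f = plist n g"
  by (auto simp: plist_def)

lemma set_plist: "set (plist n f) = f ` {1..n}"
  by (auto simp: plist_def simp del: upt_Suc)

lemma inv_on_cong: "(\<And>i. i \<in> {1..n} \<Longrightarrow> f i = g i) \<Longrightarrow> inv_on n f \<longleftrightarrow> inv_on n g"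
  unfolding inv_on_def by (metis (no_types, lifting))

lemma inv_on_image: "inv_on n f \<Longrightarrow> f ` {1..n} = {1..n}"
proof (intro equalityI subsetI)
  show "x \<in> {1..n}" if "inv_on n f" "x \<in> f ` {1..n}" for x
    using that by (auto simp: inv_on_def)
  show "x \<in> f ` {1..n}" if "inv_on n f" "x \<in> {1..n}" for x
    by (rule image_eqI[of _ _ "f x"]) (use that in \<open>auto simp: inv_on_def\<close>)
qed

lemma involutions_iff: "p \<in> involutions n \<longleftrightarrow> length p = n \<and> inv_on n (entry p)"
proof
  assume p: "p \<in> involutions n"
  then have perm: "distinct p" "set p = {1..n}" "\<forall>i\<in>{1..n}. entry p (entry p i) = i"
    by (auto simp: involutions_def permutations_of_set_def)
  have len: "length p = n" using distinct_card[OF perm(1)] perm(2) by simp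
  moreover have "entry p i \<in> {1..n}" if "i \<in> {1..n}" for i
  proof -
    have "i - 1 < length p" using that len by auto
    then show ?thesis using nth_mem[of "i - 1" p] perm(2) by (simp add: entry_def)
  qed
  ultimately show "length p = n \<and> inv_on n (entry p)" using perm(3) by (auto simp: inv_on_def)
next
  assume a: "length p = n \<and> inv_on n (entry p)"
  then have eq: "p = plist n (entry p)" by (simp add: plist_entry)
  have "set p = {1..n}"
    using a inv_on_image by (subst eq) (simp add: set_plist)
  moreover have "distinct p"
    using a inv_on_inj[of n "entry p"] 
    by (subst eq) (simp add: plist_def distinct_map atLeastLessThanSuc_atLeastAtMost del: upt_Suc)
  ultimately show "p \<in> involutions n" using a
    by (auto simp: involutions_def permutations_of_set_def inv_on_def)
qed

lemma plist_involution: "inv_on n f \<Longrightarrow> plist n f \<in> involutions n"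
  unfolding involutions_iff using inv_on_cong[of n "entry (plist n f)" f] entry_plist by simp

lemma set_involution: "p \<in> involutions n \<Longrightarrow> set p = {1..n}"
  by (auto simp: involutions_def permutations_of_set_def)

lemma distinct_involution: "p \<in> involutions n \<Longrightarrow> distinct p"
  by (auto simp: involutions_def permutations_of_set_def)

lemma occ_cong: "(\<And>i. i \<in> {1..n} \<Longrightarrow> f i = f' i) \<Longrightarrow> occ n f i j k l \<longleftrightarrow> occ n f' i j k l"
  by (auto simp: occ_def)

lemma Occ_cong: "(\<And>i. i \<in> {1..n} \<Longrightarrow> f i = f' i) \<Longrightarrow> Occ n f = Occ n f'"
  using occ_cong[of n f f'] by (simp add: Occ_def)

lemma subseq_eq_filter:
  assumes "subseq w p" "distinct p"
  shows "w = filter (\<lambda>x. x \<in> set w) p"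
  using assms
proof (induction rule: list_emb.induct)
  case (list_emb_Nil ys)
  then show ?case by simp
next
  case (list_emb_Cons xs ys y)
  have "y \<notin> set xs" using list_emb_Cons by (auto dest: list_emb_set)
  then show ?case using list_emb_Cons by simp
next
  case (list_emb_Cons2 x y xs ys)
  have "filter (\<lambda>z. z \<in> set (x # xs)) ys = filter (\<lambda>z. z \<in> set xs) ys"
    using list_emb_Cons2 by (intro filter_cong) auto
  then show ?case using list_emb_Cons2 by simp
qed

lemma order_iso_3412:
  "order_iso w [3, 4, 1, 2] \<longleftrightarrow> (\<exists>a b c d. w = [a, b, c, d] \<and> c < d \<and> d < a \<and> a < b)"
proof
  assume o: "order_iso w [3, 4, 1, 2]"
  then have "length w = 4" by (simp add: order_iso_def)
  then obtain a b c d where w: "w = [a, b, c, d]"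
    by (auto simp: numeral_eq_Suc length_Suc_conv)
  have "w ! i < w ! j \<longleftrightarrow> [3, 4, 1, 2 :: nat] ! i < [3, 4, 1, 2] ! j" if "i < 4" "j < 4" for i j
    using o that by (auto simp: order_iso_def)
  from this[of 2 3] this[of 3 0] this[of 0 1] w
  show "\<exists>a b c d. w = [a, b, c, d] \<and> c < d \<and> d < a \<and> a < b" by simp
next
  assume "\<exists>a b c d. w = [a, b, c, d] \<and> c < d \<and> d < a \<and> a < b"
  then show "order_iso w [3, 4, 1, 2]"
    by (auto simp: order_iso_def less_Suc_eq numeral_eq_Suc)
qed

text \<open>Occurrences are lists of values on one side and sets of positions on the other. The
  values of an occurrence are the positions of its mirror image, so taking the set of the list is
  enough.\<close>

lemma bij_betw_occ3412:
  assumes p: "p \<in> involutions n"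
  shows "bij_betw set (occ3412 p) (Occ n (entry p))"
proof -
  define f where "f = entry p"
  have f: "inv_on n f" and p_eq: "p = map f [1..<Suc n]"
    using p plist_entry[of p n] by (auto simp: involutions_iff f_def plist_def)
  have ff: "f (f i) = i" "f i \<in> {1..n}" if "i \<in> {1..n}" for i
    using f that by (auto simp: inv_on_def)
  have "inj_on set (occ3412 p)"
  proof (rule inj_onI)
    fix w w' assume "w \<in> occ3412 p" "w' \<in> occ3412 p" and eq: "set w = set w'"
    then have "subseq w p" "subseq w' p" by (auto simp: occurrences_def)
    then show "w = w'"
      using subseq_eq_filter[OF _ distinct_involution[OF p], of w]
        subseq_eq_filter[OF _ distinct_involution[OF p], of w'] eq by simp
  qed
  moreover have "set ` occ3412 p = Occ n f"
  proof (intro equalityI subsetI)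
    fix V assume "V \<in> set ` occ3412 p"
    then obtain w where V: "V = set w" and w: "subseq w p" "order_iso w [3, 4, 1, 2]"
      by (auto simp: occurrences_def)
    obtain a b c d where abcd: "w = [a, b, c, d]" "c < d" "d < a" "a < b"
      using w(2) unfolding order_iso_3412 by blast
    \<comment> \<open>In an involution the position of the value x is \<open>f x\<close>, so the
      list p increases with respect to f.\<close>
    have "sorted_wrt (\<lambda>x y. f x < f y) p"
      unfolding p_eq sorted_wrt_map using ff
      by (intro sorted_wrt_mono_rel[OF _ sorted_wrt_upt]) (auto simp del: upt_Suc)
    moreover have "w = filter (\<lambda>x. x \<in> set w) p"
      by (rule subseq_eq_filter[OF w(1) distinct_involution[OF p]])
    ultimately have "sorted_wrt (\<lambda>x y. f x < f y) w"
      using sorted_wrt_filter[of "\<lambda>x y. f x < f y" p] by metis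
    then have pos: "f a < f b" "f b < f c" "f c < f d" using abcd(1) by auto
    have N: "a \<in> {1..n}" "b \<in> {1..n}" "c \<in> {1..n}" "d \<in> {1..n}"
      using list_emb_set[OF w(1)] abcd(1) set_involution[OF p] by auto
    have "occ n f c d a b" using N pos abcd by (auto simp: occ_def)
    then have "{c, d, a, b} \<in> Occ n f" by (rule OccI)
    moreover have "V = {c, d, a, b}" using V abcd(1) by auto
    ultimately show "V \<in> Occ n f" by simp
  next
    fix V assume "V \<in> Occ n f"
    then obtain i j k l where o: "occ n f i j k l" and V: "V = {i, j, k, l}" by (rule OccE)
    have o': "occ n f (f k) (f l) (f i) (f j)" by (rule occ_mirror[OF f o])
    have N: "i \<in> {1..n}" "j \<in> {1..n}" "k \<in> {1..n}" "l \<in> {1..n}" using o by (auto simp: occ_def)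
    have "subseq [f k, f l, f i, f j] [1..<Suc n]"
      by (rule sorted_subset_imp_subseq) (use o' N ff(2)[OF N(1)] ff(2)[OF N(2)] ff(2)[OF N(3)] ff(2)[OF N(4)] in
        \<open>auto simp: occ_def simp del: upt_Suc\<close>)
    then have "subseq (map f [f k, f l, f i, f j]) p" unfolding p_eq by (rule subseq_map)
    then have "subseq [k, l, i, j] p" using ff N by simp
    moreover have "order_iso [k, l, i, j] [3, 4, 1, 2]"
      unfolding order_iso_3412 using o by (auto simp: occ_def)
    ultimately have "[k, l, i, j] \<in> occ3412 p" by (simp add: occurrences_def)
    moreover have "V = set [k, l, i, j]" using V by auto
    ultimately show "V \<in> set ` occ3412 p" by blast
  qed
  ultimately show ?thesis by (simp add: bij_betw_def f_def)
qed

lemma card_occ3412: "p \<in> involutions n \<Longrightarrow> card (occ3412 p) = card (Occ n (entry p))"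
  by (rule bij_betw_same_card[OF bij_betw_occ3412])

text \<open>Write m for \<open>f 1\<close>. If m is left of j, the arcs at 1 and at
  \<open>f k\<close> cross; if m is right of l, the arcs at 1 and j do; in between, m can replace k,
  because its value is the minimum 1.\<close>

lemma occ_one_linked:
  assumes f: "inv_on n f" and o: "occ n f 1 j k l"
  shows "\<exists>w\<in>Occ n f. 1 \<in> w \<and> f 1 \<in> w"
proof -
  define m where "m = f 1"
  have lt: "1 < j" "j < k" "k < l" "f k < f l" "f l < m" "m < f j"
    and N: "1 \<le> n" "j \<le> n" "k \<le> n" "l \<le> n"
    using o by (auto simp: occ_def m_def)
  have fm: "f m = 1" "m \<le> n" "1 \<le> m" using inv_onD[OF f, of 1] N by (auto simp: m_def)
  note fj = inv_onD[OF f, of j] and fk = inv_onD[OF f, of k] and fl = inv_onD[OF f, of l]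
  have "m \<noteq> j" "m \<noteq> l" using fm lt fk N by auto
  then consider "m < j" | "j < m" "m < l" | "l < m" by linarith
  then show ?thesis
  proof cases
    case 1
    have "f k \<noteq> 1" using fk N lt fm 1 by (metis less_irrefl less_trans m_def nat_less_le)
    then have "occ n f 1 (f k) (f 1) (f (f k))"
      unfolding m_def[symmetric] using f lt N fk 1
      by (intro occ_crossing_arcs[OF f, of 1, folded m_def]) auto
    from OccI[OF this] show ?thesis by (rule bexI[rotated]) simp
  next
    case 2
    have "occ n f 1 j m l" using 2 lt N fm fk fl unfolding occ_def m_def[symmetric] by auto
    from OccI[OF this] show ?thesis by (rule bexI[rotated]) (simp add: m_def)
  next
    case 3
    have "occ n f 1 j (f 1) (f j)"
      unfolding m_def[symmetric] using 3 lt N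
      by (intro occ_crossing_arcs[OF f, of 1, folded m_def]) auto
    from OccI[OF this] show ?thesis by (rule bexI[rotated]) simp
  qed
qed

lemma kernel_entries_eq:
  assumes p: "p \<in> involutions n" and n: "1 \<le> n"
  shows "kernel_entries p = ker n (entry p)"
proof -
  define f where "f = entry p"
  have f: "inv_on n f" using p by (simp add: involutions_iff f_def)
  have setp: "set p = {1..n}" by (rule set_involution[OF p])
  have Occ_eq: "Occ n f = set ` occ3412 p"
    using bij_betw_occ3412[OF p] by (simp add: bij_betw_def f_def)
  define R where "R = (graph_edges p)\<^sup>*"
  have link: "(Inl a, Inl b) \<in> R" if V: "V \<in> Occ n f" "a \<in> V" "b \<in> V" for V a b
  proof -
    obtain w where w: "w \<in> occ3412 p" "V = set w" using V(1)[unfolded Occ_eq] by blast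
    have "(Inl a, Inr w) \<in> graph_edges p" "(Inr w, Inl b) \<in> graph_edges p"
      using w V(2,3) unfolding graph_edges_def by blast+
    then show ?thesis unfolding R_def by (rule converse_rtrancl_into_rtrancl[OF _ r_into_rtrancl])
  qed
  have fwd: "case v of Inl a \<Rightarrow> a \<in> ker n f | Inr w \<Rightarrow> set w \<subseteq> ker n f"
    if "(Inl 1, v) \<in> R" for v
    using that unfolding R_def
  proof (induction rule: rtrancl_induct)
    case base
    show ?case by (simp only: sum.case) (rule ker_one)
  next
    case (step u v)
    from step(2) consider a w where "u = Inl a" "v = Inr w" "w \<in> occ3412 p" "a \<in> set w"
      | a w where "u = Inr w" "v = Inl a" "w \<in> occ3412 p" "a \<in> set w"
      by (auto simp: graph_edges_def)
    then show ?case
    proof cases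
      case 1
      then have "set w \<in> Occ n f" "a \<in> ker n f" using step(3) by (simp_all add: Occ_eq)
      then have "set w \<subseteq> ker n f" using ker_occ 1(4) by blast
      then show ?thesis using 1(2) by simp
    next
      case 2
      then show ?thesis using step(3) by auto
    qed
  qed
  have bwd: "(Inl 1, Inl a) \<in> R \<or> a = f 1" if "a \<in> ker n f" for a
    using that
  proof induction
    case ker_one
    show ?case by (simp add: R_def)
  next
    case ker_image_one
    show ?case by simp
  next
    case (ker_step w a b)
    show ?case
    proof (cases "(Inl 1, Inl a) \<in> R")
      case True
      then have "(Inl 1, Inl b) \<in> R"
        using link[OF ker_step(1,2,4)] unfolding R_def by (rule rtrancl_trans)
      then show ?thesis ..
    next
      case False
      \<comment> \<open>The mirror image of w contains the position 1, so some occurrence links 1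
        with \<open>f 1\<close> after all.\<close>
      then have a: "a = f 1" using ker_step by blast
      have "f (f 1) = 1" using inv_onD(3)[OF f, of 1] n by simp
      then have "1 \<in> f ` w" using a ker_step(2) by (metis imageI)
      moreover have "f ` w \<in> Occ n f" by (rule Occ_mirror[OF f ker_step(1)])
      ultimately obtain i j k l where o: "occ n f i j k l" "1 \<in> {i, j, k, l}"
        by (metis OccE)
      then have "i = 1" by (auto simp: occ_def)
      then obtain w' where "w' \<in> Occ n f" "1 \<in> w'" "f 1 \<in> w'"
        using occ_one_linked[OF f] o by blast
      then have "(Inl 1, Inl a) \<in> R" using link a by blast
      then show ?thesis using False by simp
    qed
  qed
  have "ker n f \<subseteq> {1..n}" by (rule ker_subset[OF f n])
  then have "kernel_entries p = ker n f"
    unfolding kernel_entries_def setp f_def[symmetric] R_def[symmetric]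
    using fwd bwd ker_image_one[of f n] by (fastforce dest: fwd)
  then show ?thesis by (simp add: f_def)
qed

lemma nth_sorted_list_kpos:
  assumes K: "finite K" and i: "i < card K"
  shows "sorted_list_of_set K ! i = kpos K (Suc i)"
proof -
  define xs where "xs = sorted_list_of_set K"
  have xs: "sorted_wrt (<) xs" "set xs = K" "length xs = card K" "distinct xs"
    using K by (simp_all add: xs_def)
  have "{k \<in> K. k \<le> xs ! i} = (!) xs ` {..i}"
  proof (intro equalityI subsetI)
    fix k assume "k \<in> {k \<in> K. k \<le> xs ! i}"
    then obtain j where j: "j < length xs" "k = xs ! j" "xs ! j \<le> xs ! i"
      using xs(2) by (auto simp: in_set_conv_nth)
    then have "j \<le> i" using sorted_wrt_nth_less[OF xs(1), of i j] by (meson leD linorder_not_le)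
    then show "k \<in> (!) xs ` {..i}" using j by blast
  next
    fix k assume "k \<in> (!) xs ` {..i}"
    then obtain j where j: "k = xs ! j" "j \<le> i" by blast
    then show "k \<in> {k \<in> K. k \<le> xs ! i}"
      using sorted_wrt_nth_less[OF xs(1), of j i] xs(2,3) i nth_mem[of j xs]
      by (cases "j = i") auto
  qed
  moreover have "inj_on ((!) xs) {..i}" using xs(3,4) i by (auto intro!: inj_on_nth)
  ultimately have "rk K (xs ! i) = Suc i" by (simp add: rk_def card_image)
  moreover have "xs ! i \<in> K" using xs i nth_mem by metis
  ultimately show ?thesis using kpos_rk[OF K] by (metis xs_def)
qed

lemma filter_closed:
  assumes p: "p \<in> involutions n" and K: "K \<subseteq> {1..n}" "\<And>x. x \<in> K \<Longrightarrow> entry p x \<in> K"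
  shows "filter (\<lambda>a. a \<in> K) p = map (entry p) (sorted_list_of_set K)"
proof -
  define f where "f = entry p"
  have f: "inv_on n f" and p_eq: "p = map f [1..<Suc n]"
    using p plist_entry[of p n] by (auto simp: involutions_iff f_def plist_def)
  have "f i \<in> K \<longleftrightarrow> i \<in> K" if "i \<in> {1..n}" for i
    using K(2)[of i] K(2)[of "f i"] inv_onD(3)[OF f, of i] that by (auto simp: f_def)
  then have "filter (\<lambda>a. a \<in> K) p = map f (filter (\<lambda>i. i \<in> K) [1..<Suc n])"
    unfolding p_eq filter_map by (intro arg_cong[of _ _ "map f"] filter_cong) (auto simp: o_def)
  moreover have "filter (\<lambda>i. i \<in> K) [1..<Suc n] = sorted_list_of_set K"
  proof (rule strict_sorted_equal)
    show "sorted_wrt (<) (filter (\<lambda>i. i \<in> K) [1..<Suc n])" by (intro sorted_wrt_filter sorted_wrt_upt)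
    show "set (filter (\<lambda>i. i \<in> K) [1..<Suc n]) = set (sorted_list_of_set K)"
      using K(1) finite_subset[OF K(1)] by auto
  qed simp
  ultimately show ?thesis by (simp add: f_def)
qed

lemma standardise_closed:
  assumes p: "p \<in> involutions n" and K: "K \<subseteq> {1..n}" "\<And>x. x \<in> K \<Longrightarrow> entry p x \<in> K"
  shows "standardise (filter (\<lambda>a. a \<in> K) p) = map (\<lambda>x. rk K (entry p x)) (sorted_list_of_set K)"
proof -
  have "set (filter (\<lambda>a. a \<in> K) p) = K" using K(1) set_involution[OF p] by auto
  then show ?thesis
    unfolding standardise_def using filter_closed[OF assms] by (simp add: rk_def)
qed

lemma standardise_emb:
  assumes p: "p \<in> involutions n" and K: "K \<subseteq> {1..n}" "\<And>x. x \<in> K \<Longrightarrow> entry p x \<in> K"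
  shows "standardise (filter (\<lambda>a. a \<in> K) p) = \<rho> \<longleftrightarrow>
    length \<rho> = card K \<and> emb n (entry p) K (length \<rho>) (entry \<rho>)"
proof -
  have fin: "finite K" using finite_subset[OF K(1)] by simp
  have f: "inv_on n (entry p)" using p by (simp add: involutions_iff)
  have std: "standardise (filter (\<lambda>a. a \<in> K) p) =
    map (\<lambda>x. rk K (entry p x)) (sorted_list_of_set K)"
    by (rule standardise_closed[OF p K])
  have "standardise (filter (\<lambda>a. a \<in> K) p) = \<rho> \<longleftrightarrow>
    length \<rho> = card K \<and> (\<forall>i<card K. rk K (entry p (kpos K (Suc i))) = \<rho> ! i)"
    unfolding std list_eq_iff_nth_eq
    using fin by (auto simp: nth_sorted_list_kpos)
  also have "\<dots> \<longleftrightarrow> length \<rho> = card K \<and> (\<forall>i\<in>{1..card K}. rk K (entry p (kpos K i)) = entry \<rho> i)"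
  proof -
    have "(\<forall>i<c. P (Suc i) (\<rho> ! i)) \<longleftrightarrow> (\<forall>i\<in>{1..c}. P i (entry \<rho> i))" for c P
    proof
      assume a: "\<forall>i<c. P (Suc i) (\<rho> ! i)"
      show "\<forall>i\<in>{1..c}. P i (entry \<rho> i)"
      proof
        fix i assume "i \<in> {1..c}"
        then have "i - 1 < c" "Suc (i - 1) = i" by auto
        then show "P i (entry \<rho> i)" using a unfolding entry_def by metis
      qed
    next
      assume a: "\<forall>i\<in>{1..c}. P i (entry \<rho> i)"
      show "\<forall>i<c. P (Suc i) (\<rho> ! i)"
      proof (intro allI impI)
        fix i assume "i < c"
        then show "P (Suc i) (\<rho> ! i)" using bspec[OF a, of "Suc i"] by (simp add: entry_def)
      qed
    qed
    from this[where P = "\<lambda>i x. rk K (entry p (kpos K i)) = x"] show ?thesis by (simp only:)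
  qed
  also have "\<dots> \<longleftrightarrow> length \<rho> = card K \<and> (\<forall>x\<in>K. rk K (entry p x) = entry \<rho> (rk K x))"
    using rk_image[OF fin] kpos[OF fin] kpos_rk[OF fin] by (metis image_eqI)
  also have "\<dots> \<longleftrightarrow> length \<rho> = card K \<and> emb n (entry p) K (length \<rho>) (entry \<rho>)"
    unfolding emb_def using K f by auto
  finally show ?thesis .
qed

text \<open>Each step that generates the kernel uses an occurrence lying wholly inside it, and
  \<open>rk\<close> turns this into an occurrence of g.\<close>

lemma conn_ker:
  assumes n: "1 \<le> n" and e: "emb n f (ker n f) s g"
  shows "conn s g"
proof -
  note E = embD[OF e]
  define K where "K = ker n f"
  note E = E[folded K_def]
  have one: "1 \<in> K" unfolding K_def by (rule ker_one)
  have "{k \<in> K. k \<le> 1} = {1}" using one E(2) by force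
  then have rk1: "rk K 1 = 1" by (simp add: rk_def)
  have g: "inv_on s g" by (rule emb_inv_on[OF e])
  have s: "1 \<le> s" using rk_le_card[OF E(3), of 1] rk1 E(4) by simp
  have "rk K x \<in> ker s g" if "x \<in> K" for x
    using that unfolding K_def
  proof induction
    case ker_one
    show ?case unfolding K_def[symmetric] rk1 by (rule ker.ker_one)
  next
    case ker_image_one
    show ?case
      unfolding K_def[symmetric] E(6)[OF one, symmetric] rk1 by (rule ker.ker_image_one)
  next
    case (ker_step w a b)
    have "w \<subseteq> K" using ker_occ[OF ker_step(1)] ker_step(2,3) by (auto simp: K_def)
    then have wO: "rk K ` w \<in> Occ s g" using Occ_rk[OF e ker_step(1)] by (simp add: K_def)
    show ?case unfolding K_def[symmetric]
      by (rule ker.ker_step[OF wO, of "rk K a"]) (use ker_step in \<open>auto simp: K_def\<close>)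
  qed
  then have "rk K ` K \<subseteq> ker s g" by (rule image_subsetI)
  then have "{1..s} \<subseteq> ker s g" unfolding rk_image[OF E(3)] E(4) .
  then show ?thesis using ker_subset[OF g s] s g by (auto simp: conn_def)
qed

text \<open>The way to recognise a kernel: connectivity of g makes K small enough, closedness under
  occurrences makes it large enough.\<close>

lemma ker_eqI:
  assumes e: "emb n f K s g" "1 \<in> K" "conn s g"
    and A: "\<And>w. w \<in> Occ n f \<Longrightarrow> w \<inter> K \<noteq> {} \<Longrightarrow> w \<subseteq> K"
  shows "ker n f = K"
proof
  interpret framed n f K s g by (rule closed_framed[OF e A])
  show "K \<subseteq> ker n f" 
    by (rule K_induct) (rule ker_one, rule ker_image_one, erule ker_occ)
  show "ker n f \<subseteq> K"
  proof
    fix x assume "x \<in> ker n f"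
    then show "x \<in> K"
      by induction (use one K_closed[OF one] A in auto)
  qed
qed

lemma kernel_shape_iff:
  assumes p: "p \<in> involutions n" and n: "1 \<le> n"
  shows "kernel_shape p = \<rho> \<longleftrightarrow>
    length \<rho> = card (ker n (entry p)) \<and> emb n (entry p) (ker n (entry p)) (length \<rho>) (entry \<rho>)"
  unfolding kernel_shape_def kernel_def kernel_entries_eq[OF p n]
  using p n ker_subset ker_closed by (intro standardise_emb[OF p]) (auto simp: involutions_iff)

lemma kernel_shape_conn:
  assumes p: "p \<in> involutions n" and n: "1 \<le> n"
  shows "emb n (entry p) (ker n (entry p)) (length (kernel_shape p)) (entry (kernel_shape p))"
    and "conn (length (kernel_shape p)) (entry (kernel_shape p))"
proof -
  show 1: "emb n (entry p) (ker n (entry p)) (length (kernel_shape p)) (entry (kernel_shape p))"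
    using kernel_shape_iff[OF p n, of "kernel_shape p"] by blast
  show "conn (length (kernel_shape p)) (entry (kernel_shape p))"
    by (rule conn_ker[OF n 1])
qed

lemma kernel_shapeI:
  assumes p: "p \<in> involutions n" and e: "emb n (entry p) K (length \<rho>) (entry \<rho>)" "1 \<in> K"
    "conn (length \<rho>) (entry \<rho>)"
    and A: "\<And>w. w \<in> Occ n (entry p) \<Longrightarrow> w \<inter> K \<noteq> {} \<Longrightarrow> w \<subseteq> K"
  shows "kernel_shape p = \<rho>" "kernel_entries p = K"
proof -
  have n: "1 \<le> n" using e(2) embD(2)[OF e(1)] by auto
  have k: "ker n (entry p) = K" by (rule ker_eqI[OF e A])
  show "kernel_shape p = \<rho>"
    unfolding kernel_shape_iff[OF p n] k using e(1) embD(4)[OF e(1)] by simp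
  show "kernel_entries p = K" using kernel_entries_eq[OF p n] k by simp
qed

section \<open>Filling the cells\<close>

text \<open>Only comparisons between values enter, so h need not commute with the maps. This covers
  both the frame, with h sending an index to its position, and the content of a free cell, with h a
  shift.\<close>

lemma card_Occ_restrict:
  assumes mono: "\<And>t u. t \<in> {1..m} \<Longrightarrow> u \<in> {1..m} \<Longrightarrow> t < u \<Longrightarrow> h t < h u"
    and into: "h ` {1..m} \<subseteq> {1..n}"
    and iso: "\<And>t u. t \<in> {1..m} \<Longrightarrow> u \<in> {1..m} \<Longrightarrow> f (h t) < f (h u) \<longleftrightarrow> q t < q u"
  shows "card {w \<in> Occ n f. w \<subseteq> h ` {1..m}} = card (Occ m q)"
proof -
  have inj: "inj_on h {1..m}"
    by (rule linorder_inj_onI) (use mono in \<open>force+\<close>)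
  have mono_iff: "h t < h u \<longleftrightarrow> t < u" if "t \<in> {1..m}" "u \<in> {1..m}" for t u
    using mono[OF that] mono[OF that(2,1)] by (cases t u rule: linorder_cases) auto
  have o: "occ n f (h i) (h j) (h k) (h l) \<longleftrightarrow> occ m q i j k l"
    if r: "i \<in> {1..m}" "j \<in> {1..m}" "k \<in> {1..m}" "l \<in> {1..m}" for i j k l
  proof -
    have "h i \<in> {1..n}" "h l \<in> {1..n}" using into r(1,4) by blast+
    then show ?thesis using r by (simp add: occ_def mono_iff iso)
  qed
  have "{w \<in> Occ n f. w \<subseteq> h ` {1..m}} = (\<lambda>w. h ` w) ` Occ m q"
  proof (intro equalityI subsetI)
    fix w assume "w \<in> {w \<in> Occ n f. w \<subseteq> h ` {1..m}}"
    then have w: "w \<in> Occ n f" "w \<subseteq> h ` {1..m}" by auto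
    obtain a b c d where abcd: "occ n f a b c d" "w = {a, b, c, d}" using w(1) by (rule OccE)
    then obtain i j k l where ijkl: "a = h i" "b = h j" "c = h k" "d = h l"
      "i \<in> {1..m}" "j \<in> {1..m}" "k \<in> {1..m}" "l \<in> {1..m}"
      using w(2) by auto
    then have "occ m q i j k l" using o abcd(1) by simp
    then have "{i, j, k, l} \<in> Occ m q" by (rule OccI)
    then show "w \<in> (\<lambda>w. h ` w) ` Occ m q"
      by (rule rev_image_eqI) (simp add: abcd(2) ijkl(1-4))
  next
    fix w assume "w \<in> (\<lambda>w. h ` w) ` Occ m q"
    then obtain v where v: "v \<in> Occ m q" "w = h ` v" by blast
    obtain i j k l where ijkl: "occ m q i j k l" "v = {i, j, k, l}" using v(1) by (rule OccE)
    have r: "i \<in> {1..m}" "j \<in> {1..m}" "k \<in> {1..m}" "l \<in> {1..m}"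
      using Occ_subset[OF v(1)] ijkl(2) by auto
    then have "occ n f (h i) (h j) (h k) (h l)" using o ijkl(1) by simp
    from OccI[OF this] show "w \<in> {w \<in> Occ n f. w \<subseteq> h ` {1..m}}"
      using v(2) ijkl(2) r by auto
  qed
  moreover have "inj_on (\<lambda>w. h ` w) (Occ m q)"
    by (rule inj_on_subset[OF inj_on_image_Pow[OF inj]]) (use Occ_subset in blast)
  ultimately show ?thesis by (simp add: card_image)
qed

lemma Occ_nonempty: "w \<in> Occ n f \<Longrightarrow> w \<noteq> {}"
  by (auto simp: Occ_def)

text \<open>\<open>Q l\<close> is the standardised content of column gap \<open>l\<close>, all of which lies in row gap \<open>sg l\<close>.\<close>

locale filling =
  fixes s :: nat and g :: "nat \<Rightarrow> nat" and sg :: "nat \<Rightarrow> nat" and Q :: "nat \<Rightarrow> nat list"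
  assumes conn: "conn s g"
    and sg: "\<And>l. l \<in> {1..s} \<Longrightarrow> sg l \<in> {1..s}" "\<And>l. l \<in> {1..s} \<Longrightarrow> sg (sg l) = l"
    and Q: "\<And>l. l \<in> {1..s} \<Longrightarrow> Q l \<in> involutions (length (Q l))"
    and Q_sg: "\<And>l. l \<in> {1..s} \<Longrightarrow> Q (sg l) = Q l"
    and Q_bad: "\<And>l. l \<in> {1..s} \<Longrightarrow> Q l \<noteq> [] \<Longrightarrow> \<not> bad3 s g l (sg l)"
    and Q_crossed: "\<And>l. l \<in> {1..s} \<Longrightarrow> Q l \<noteq> [] \<Longrightarrow> \<not> crossed s g l (sg l)"
    and Q_ascent: "\<And>l t u. l \<in> {1..s} \<Longrightarrow> 1 \<le> t \<Longrightarrow> t < u \<Longrightarrow> u \<le> length (Q l) \<Longrightarrow>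
      entry (Q l) t < entry (Q l) u \<Longrightarrow> light s g l"
begin

definition pos :: "nat \<Rightarrow> nat" where
  "pos l = l + (\<Sum>i\<in>{1..<l}. length (Q i))"

definition n :: nat where
  "n = s + (\<Sum>i\<in>{1..s}. length (Q i))"

definition K :: "nat set" where
  "K = pos ` {1..s}"

text \<open>The same involution \<open>Q l\<close> describes the passage from gap l to gap
  \<open>sg l\<close> and the way back. In general the two would be mutually inverse bijections; off
  the diagonal this loses nothing, since the content there is decreasing and a reversal is its own
  inverse.\<close>

definition infl :: "nat \<Rightarrow> nat" where
  "infl x = (if x \<in> K then pos (g (rk K x))
     else pos (sg (rk K x)) + entry (Q (rk K x)) (x - pos (rk K x)))"

lemma pos_one: "pos 1 = 1"
  by (simp add: pos_def)

lemma pos_Suc: "1 \<le> l \<Longrightarrow> pos (Suc l) = Suc (pos l + length (Q l))"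
  by (simp add: pos_def)

lemma pos_end: "pos (Suc s) = Suc n"
  by (simp add: pos_def n_def atLeastLessThanSuc_atLeastAtMost)

lemma pos_gap: "1 \<le> l \<Longrightarrow> l < m \<Longrightarrow> pos l + length (Q l) < pos m"
proof (induction m)
  case (Suc m)
  then show ?case
    by (cases "l = m") (auto simp: pos_Suc)
qed simp

lemma pos_less: "1 \<le> l \<Longrightarrow> l < m \<Longrightarrow> pos l < pos m"
  using pos_gap[of l m] by simp

lemma pos_le: "1 \<le> l \<Longrightarrow> l \<le> m \<Longrightarrow> pos l \<le> pos m"
  using pos_less[of l m] by (cases "l = m") auto

lemma g_inv: "inv_on s g"
  using conn by (simp add: conn_def)

lemma s_pos: "1 \<le> s"
  using conn by (simp add: conn_def)

lemma finite_K: "finite K"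
  by (simp add: K_def)

lemma rk_pos:
  assumes l: "l \<in> {1..s}" and t: "t \<le> length (Q l)"
  shows "rk K (pos l + t) = l"
proof -
  have "pos m \<le> pos l + t \<longleftrightarrow> m \<le> l" if "m \<in> {1..s}" for m
    using pos_gap[of l m] pos_le[of m l] that l t by (cases "m \<le> l") auto
  then have "{k \<in> K. k \<le> pos l + t} = pos ` {1..l}"
    using l by (auto simp: K_def)
  moreover have "inj_on pos {1..l}"
    by (rule linorder_inj_onI) (use pos_less in \<open>force+\<close>)
  ultimately show ?thesis by (simp add: rk_def card_image)
qed

lemma pos_in_K: "l \<in> {1..s} \<Longrightarrow> t \<le> length (Q l) \<Longrightarrow> pos l + t \<in> K \<longleftrightarrow> t = 0"
proof
  assume l: "l \<in> {1..s}" and t: "t \<le> length (Q l)"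
  assume "pos l + t \<in> K"
  then obtain m where m: "m \<in> {1..s}" "pos l + t = pos m" by (auto simp: K_def)
  then have "l = m" using rk_pos[OF l t] rk_pos[OF m(1), of 0] by simp
  then show "t = 0" using m by simp
qed (auto simp: K_def)

lemma infl_pos: "l \<in> {1..s} \<Longrightarrow> infl (pos l) = pos (g l)"
  using pos_in_K[of l 0] rk_pos[of l 0] by (simp add: infl_def)

lemma infl_gap:
  "l \<in> {1..s} \<Longrightarrow> 1 \<le> t \<Longrightarrow> t \<le> length (Q l) \<Longrightarrow> infl (pos l + t) = pos (sg l) + entry (Q l) t"
  using pos_in_K[of l t] rk_pos[of l t] by (simp add: infl_def)

lemma locate_aux: "1 \<le> x \<Longrightarrow> x < pos (Suc m) \<Longrightarrow> \<exists>l\<in>{1..m}. \<exists>t\<le>length (Q l). x = pos l + t"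
proof (induction m)
  case 0
  then show ?case using pos_one by simp
next
  case (Suc m)
  show ?case
  proof (cases "x < pos (Suc m)")
    case True
    with Suc show ?thesis by (metis atLeastAtMost_iff le_SucI)
  next
    case False
    have "x - pos (Suc m) \<le> length (Q (Suc m))"
      using Suc.prems(2) pos_Suc[of "Suc m"] by simp
    moreover have "x = pos (Suc m) + (x - pos (Suc m))" using False by simp
    moreover have "Suc m \<in> {1..Suc m}" by simp
    ultimately show ?thesis by blast
  qed
qed

lemma locate:
  assumes "x \<in> {1..n}"
  obtains l t where "l \<in> {1..s}" "t \<le> length (Q l)" "x = pos l + t"
  using locate_aux[of x s] assms pos_end by auto

lemma pos_range: "l \<in> {1..s} \<Longrightarrow> t \<le> length (Q l) \<Longrightarrow> pos l + t \<in> {1..n}"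
  using pos_gap[of l "Suc s"] pos_le[of 1 l] pos_end pos_one by auto

lemma Q_entry: "l \<in> {1..s} \<Longrightarrow> inv_on (length (Q l)) (entry (Q l))"
  using Q[of l] involutions_iff by blast

lemma infl_inv: "inv_on n infl"
  unfolding inv_on_def
proof
  fix x assume "x \<in> {1..n}"
  then obtain l t where lt: "l \<in> {1..s}" "t \<le> length (Q l)" "x = pos l + t" by (rule locate)
  show "infl x \<in> {1..n} \<and> infl (infl x) = x"
  proof (cases "t = 0")
    case True
    have gl: "g l \<in> {1..s}" "g (g l) = l" using g_inv lt(1) by (auto simp: inv_on_def)
    then show ?thesis using True lt infl_pos pos_range[of "g l" 0] by simp
  next
    case False
    define u where "u = entry (Q l) t"
    have u: "1 \<le> u" "u \<le> length (Q l)" "entry (Q l) u = t"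
      using inv_onD[OF Q_entry[OF lt(1)], of t] False lt(2) by (auto simp: u_def)
    have 1: "infl x = pos (sg l) + u" using infl_gap[OF lt(1)] False lt by (simp add: u_def)
    have 2: "infl (pos (sg l) + u) = pos (sg (sg l)) + entry (Q (sg l)) u"
      by (rule infl_gap) (use u sg Q_sg lt in auto)
    have "pos (sg l) + u \<in> {1..n}" by (rule pos_range) (use u sg Q_sg lt in auto)
    then show ?thesis using 1 2 u sg Q_sg lt by simp
  qed
qed

lemma kpos_K: "l \<in> {1..s} \<Longrightarrow> kpos K l = pos l"
  using kpos_rk[OF finite_K, of "pos l"] rk_pos[of l 0] by (simp add: K_def)

lemma card_K: "card K = s"
proof -
  have "inj_on pos {1..s}"
    by (rule linorder_inj_onI) (use pos_less in \<open>force+\<close>)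
  then show ?thesis by (simp add: K_def card_image)
qed

lemma emb: "emb n infl K s g"
  unfolding emb_def
proof (intro conjI ballI)
  show "inv_on n infl" by (rule infl_inv)
  show "K \<subseteq> {1..n}" using pos_range[of _ 0] by (auto simp: K_def)
  have gs: "g l \<in> {1..s}" if "l \<in> {1..s}" for l using g_inv that by (auto simp: inv_on_def)
  show "infl ` K \<subseteq> K" using infl_pos gs by (auto simp: K_def)
  show "card K = s" by (rule card_K)
  fix x assume "x \<in> K"
  then obtain l where l: "l \<in> {1..s}" "x = pos l" by (auto simp: K_def)
  then show "g (rk K x) = rk K (infl x)"
    using rk_pos[OF l(1), of 0] rk_pos[OF gs[OF l(1)], of 0] infl_pos[OF l(1)] by simp
qed

lemma one_K: "1 \<in> K"
  using pos_one s_pos unfolding K_def by (metis atLeastAtMost_iff imageI order_refl)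

lemma non_K:
  assumes "x \<in> {1..n}" "x \<notin> K"
  obtains l t where "l \<in> {1..s}" "1 \<le> t" "t \<le> length (Q l)" "x = pos l + t" "rk K x = l"
    "infl x = pos (sg l) + entry (Q l) t" "rk K (infl x) = sg l" "Q l \<noteq> []"
proof -
  obtain l t where lt: "l \<in> {1..s}" "t \<le> length (Q l)" "x = pos l + t" by (rule locate[OF assms(1)])
  have t: "1 \<le> t" using pos_in_K[OF lt(1,2)] lt(3) assms(2) by simp
  have e: "infl x = pos (sg l) + entry (Q l) t" using infl_gap[OF lt(1) t lt(2)] lt(3) by simp
  have "entry (Q l) t \<le> length (Q (sg l))"
    using inv_onD[OF Q_entry[OF lt(1)] t lt(2)] Q_sg[OF lt(1)] by simp
  then have "rk K (infl x) = sg l" unfolding e by (rule rk_pos[OF sg(1)[OF lt(1)]])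
  moreover have "rk K x = l" unfolding lt(3) by (rule rk_pos[OF lt(1,2)])
  moreover have "Q l \<noteq> []" using t lt(2) by auto
  ultimately show thesis using that lt t e by blast
qed

lemma framed: "framed n infl K s g"
proof
  fix x assume "x \<in> {1..n}" "x \<notin> K"
  then show "\<not> crossed s g (rk K x) (rk K (infl x))"
    by (rule non_K) (use Q_crossed in auto)
qed (fact emb one_K conn)+

lemma no_bad3:
  assumes "x \<in> {1..n}" "x \<notin> K"
  shows "\<not> bad3 s g (rk K x) (rk K (infl x))"
  using assms by (rule non_K) (use Q_bad in auto)

lemma ascents_light: "ascents_light n infl K s g"
  unfolding ascents_light_def
proof (intro ballI impI)
  fix x y assume x: "x \<in> {1..n} - K" and y: "y \<in> {1..n} - K"
    and xy: "x < y \<and> rk K x = rk K y \<and> rk K (infl x) = rk K (infl y) \<and> infl x < infl y"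
  have "x \<in> {1..n}" "x \<notin> K" "y \<in> {1..n}" "y \<notin> K" using x y by auto
  note xy' = this
  obtain l t where l: "l \<in> {1..s}" "1 \<le> t" "t \<le> length (Q l)" "x = pos l + t" "rk K x = l"
    "infl x = pos (sg l) + entry (Q l) t"
    by (rule non_K[OF xy'(1,2)])
  obtain m u where m: "m \<in> {1..s}" "1 \<le> u" "u \<le> length (Q m)" "y = pos m + u" "rk K y = m"
    "infl y = pos (sg m) + entry (Q m) u"
    by (rule non_K[OF xy'(3,4)])
  have "l = m" using xy l m by simp
  then have "t < u" "entry (Q l) t < entry (Q l) u" using xy l m by auto
  then have "light s g l" using Q_ascent[of l t u] l(1,2) m(3) \<open>l = m\<close> by simp
  then show "light s g (rk K x)" using l(5) by simp
qed

lemma occ_cases: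
  assumes "w \<in> Occ n infl" "\<not> w \<subseteq> K"
  shows "\<exists>l\<in>{1..s}. light s g l \<and> w \<subseteq> {x \<in> {1..n} - K. rk K x = l}"
proof -
  interpret framed n infl K s g by (rule framed)
  show ?thesis by (rule occ_in_light_gap[OF no_bad3 ascents_light assms])
qed

lemma K_occ_closed:
  assumes "w \<in> Occ n infl" "w \<inter> K \<noteq> {}"
  shows "w \<subseteq> K"
  using occ_cases[OF assms(1)] assms(2) by blast

text \<open>Two different gaps joined by an uncrossed arc are spanned by a crossing pair, so neither
  of them is light.\<close>

lemma light_fixed:
  assumes l: "l \<in> {1..s}" "Q l \<noteq> []" and light: "light s g l"
  shows "sg l = l"
proof (rule ccontr)
  assume ne: "sg l \<noteq> l"
  define a b where "a = min l (sg l)" and "b = max l (sg l)"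
  have "1 \<le> a" "a < b" "b \<le> s" using sg(1)[OF l(1)] l(1) ne by (auto simp: a_def b_def)
  moreover have "\<not> crossed s g a b"
    using Q_crossed[OF l] crossed_commute by (auto simp: a_def b_def min_def max_def)
  ultimately have "covered s g a b" by (rule off_diagonal_covered[OF conn])
  then obtain c d where "1 \<le> c" "c < d" "d \<le> s" "g c < g d" "g d \<le> a" "b < c"
    unfolding covered_def by blast
  then have "covered s g l l" by (intro coveredI[of c d]) (auto simp: a_def b_def)
  then show False using light by simp
qed

lemma gap_eq:
  assumes l: "l \<in> {1..s}"
  shows "{x \<in> {1..n} - K. rk K x = l} = (\<lambda>t. pos l + t) ` {1..length (Q l)}"
proof (intro equalityI subsetI)
  fix x assume "x \<in> {x \<in> {1..n} - K. rk K x = l}"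
  then have x: "x \<in> {1..n}" "x \<notin> K" "rk K x = l" by auto
  from x(1,2) show "x \<in> (\<lambda>t. pos l + t) ` {1..length (Q l)}"
    by (rule non_K) (use x(3) in auto)
next
  fix x assume "x \<in> (\<lambda>t. pos l + t) ` {1..length (Q l)}"
  then obtain t where "1 \<le> t" "t \<le> length (Q l)" "x = pos l + t" by (auto simp del: image_add_atLeastAtMost)
  then show "x \<in> {x \<in> {1..n} - K. rk K x = l}"
    using pos_range[OF l, of t] pos_in_K[OF l, of t] rk_pos[OF l, of t] by simp
qed

text \<open>By \<open>occ_cases\<close> an occurrence lies in the frame or in one light gap. Gaps
  that are not light contribute nothing, and \<open>light_fixed\<close> ensures that a nonempty
  light gap carries its content on the diagonal.\<close>

lemma card_Occ_infl:
  "card (Occ n infl) = card (Occ s g) +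
     (\<Sum>l | l \<in> {1..s} \<and> light s g l. card (Occ (length (Q l)) (entry (Q l))))"
proof -
  define L where "L = {l. l \<in> {1..s} \<and> light s g l}"
  have finL: "finite L" by (simp add: L_def)
  define gp where "gp l = {x \<in> {1..n} - K. rk K x = l}" for l
  define W where "W l = {w \<in> Occ n infl. w \<subseteq> gp l}" for l
  define WK where "WK = {w \<in> Occ n infl. w \<subseteq> K}"
  have gp_disj: "gp l \<inter> gp m = {}" if "l \<noteq> m" for l m using that by (auto simp: gp_def)
  have "Occ n infl = WK \<union> (\<Union>l\<in>L. W l)"
    using occ_cases unfolding WK_def W_def L_def gp_def by blast
  moreover have "WK \<inter> (\<Union>l\<in>L. W l) = {}"
    using Occ_nonempty unfolding WK_def W_def gp_def by blast
  moreover have "card (\<Union>l\<in>L. W l) = (\<Sum>l\<in>L. card (W l))"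
  proof (rule card_UN_disjoint[OF finL])
    show "\<forall>i\<in>L. finite (W i)" using finite_Occ by (auto simp: W_def)
    show "\<forall>i\<in>L. \<forall>j\<in>L. i \<noteq> j \<longrightarrow> W i \<inter> W j = {}"
      using Occ_nonempty gp_disj unfolding W_def by blast
  qed
  moreover have "finite WK" "finite (\<Union>l\<in>L. W l)"
    using finite_Occ finL by (auto simp: WK_def W_def)
  ultimately have 1: "card (Occ n infl) = card WK + (\<Sum>l\<in>L. card (W l))"
    by (simp add: card_Un_disjoint)
  have "card WK = card (Occ s g)"
    unfolding WK_def K_def
  proof (rule card_Occ_restrict)
    show "pos ` {1..s} \<subseteq> {1..n}" using pos_range[of _ 0] by auto
    show "pos t < pos u" if "t \<in> {1..s}" "u \<in> {1..s}" "t < u" for t u using pos_less that by simp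
    have "pos a < pos b \<longleftrightarrow> a < b" if "a \<in> {1..s}" "b \<in> {1..s}" for a b
      using pos_less[of a b] pos_less[of b a] that by (cases a b rule: linorder_cases) auto
    then show "infl (pos t) < infl (pos u) \<longleftrightarrow> g t < g u" if "t \<in> {1..s}" "u \<in> {1..s}" for t u
      using that g_inv by (auto simp: infl_pos inv_on_def)
  qed
  moreover have "card (W l) = card (Occ (length (Q l)) (entry (Q l)))" if l: "l \<in> L" for l
  proof (cases "Q l = []")
    case True
    have "gp l = {}" using gap_eq[of l] l True by (simp add: gp_def L_def)
    then have "W l = {}" using Occ_nonempty by (auto simp: W_def)
    moreover have "Occ (length (Q l)) (entry (Q l)) = {}" using True by (auto simp: Occ_def occ_def)
    ultimately show ?thesis by simp
  next
    case False
    have ls: "l \<in> {1..s}" using l by (simp add: L_def)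
    have sl: "sg l = l" by (rule light_fixed[OF ls False]) (use l in \<open>simp add: L_def\<close>)
    have "gp l = (\<lambda>t. pos l + t) ` {1..length (Q l)}" unfolding gp_def by (rule gap_eq[OF ls])
    moreover have "card {w \<in> Occ n infl. w \<subseteq> (\<lambda>t. pos l + t) ` {1..length (Q l)}} =
      card (Occ (length (Q l)) (entry (Q l)))"
    proof (rule card_Occ_restrict)
      show "(\<lambda>t. pos l + t) ` {1..length (Q l)} \<subseteq> {1..n}"
        by (rule image_subsetI, rule pos_range[OF ls]) simp
      show "infl (pos l + t) < infl (pos l + u) \<longleftrightarrow> entry (Q l) t < entry (Q l) u"
        if "t \<in> {1..length (Q l)}" "u \<in> {1..length (Q l)}" for t u
        using that infl_gap[OF ls] sl by simp
    qed simp
    ultimately show ?thesis by (simp add: W_def)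
  qed
  ultimately show ?thesis using 1 by (simp add: L_def)
qed

lemma plist_infl: "plist n infl \<in> involutions n"
  by (rule plist_involution[OF infl_inv])

lemma emb_cong:
  assumes "emb n f K' s' g'" "\<And>x. x \<in> {1..n} \<Longrightarrow> f x = f' x"
  shows "emb n f' K' s' g'"
proof -
  have "inv_on n f' \<longleftrightarrow> inv_on n f" by (rule inv_on_cong) (use assms in simp)
  moreover have "f' x = f x" if "x \<in> K'" for x using assms embD(2)[OF assms(1)] that by auto
  ultimately show ?thesis using assms(1) unfolding emb_def by auto
qed

lemma card_occ3412_infl:
  "card (occ3412 (plist n infl)) = card (Occ s g) +
     (\<Sum>l | l \<in> {1..s} \<and> light s g l. card (occ3412 (Q l)))"
proof -
  have "Occ n (entry (plist n infl)) = Occ n infl"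
    by (rule Occ_cong) (rule entry_plist)
  moreover have "card (occ3412 (Q l)) = card (Occ (length (Q l)) (entry (Q l)))"
    if "l \<in> {1..s}" for l
    by (rule card_occ3412[OF Q[OF that]])
  ultimately show ?thesis
    using card_occ3412[OF plist_infl] card_Occ_infl by simp
qed

lemma kernel_plist_infl:
  assumes "length \<rho> = s" "entry \<rho> = g"
  shows "kernel_shape (plist n infl) = \<rho>" "kernel_entries (plist n infl) = K"
proof -
  have eq: "infl x = entry (plist n infl) x" if "x \<in> {1..n}" for x
    using entry_plist[OF that] by simp
  have "emb n (entry (plist n infl)) K (length \<rho>) (entry \<rho>)"
    unfolding assms by (rule emb_cong[OF emb eq])
  moreover have "Occ n (entry (plist n infl)) = Occ n infl"
    by (rule Occ_cong) (rule entry_plist)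
  ultimately show "kernel_shape (plist n infl) = \<rho>" "kernel_entries (plist n infl) = K"
    using kernel_shapeI[OF plist_infl, of K \<rho>] one_K conn K_occ_closed assms by auto
qed

end

section \<open>Feasible cells\<close>

lemma grid_between:
  assumes K: "K \<subseteq> {1..n}" and l: "l \<in> {1..card K}" and j: "j \<in> {1..n}"
  shows "(sorted_list_of_set K @ [n + 1]) ! (l - 1) < j \<and> j < (sorted_list_of_set K @ [n + 1]) ! l
    \<longleftrightarrow> j \<notin> K \<and> rk K j = l"
proof -
  have fin: "finite K" using finite_subset[OF K] by simp
  have len: "length (sorted_list_of_set K) = card K" by simp
  have a: "(sorted_list_of_set K @ [n + 1]) ! (l - 1) = kpos K l"
  proof -
    have "l - 1 < card K" "Suc (l - 1) = l" using l by auto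
    then show ?thesis using nth_sorted_list_kpos[OF fin, of "l - 1"] by (simp add: nth_append)
  qed
  have kl: "kpos K l \<in> K" "rk K (kpos K l) = l" using kpos[OF fin] l by auto
  have lower: "kpos K l \<le> j \<longleftrightarrow> l \<le> rk K j" using rk_le_iff[OF fin kl(1), of j] kl(2) by simp
  have upper: "j < (sorted_list_of_set K @ [n + 1]) ! l \<longleftrightarrow> rk K j \<le> l"
  proof (cases "l = card K")
    \<comment> \<open>After the last element of K the upper bound is the sentinel n + 1, and no rank
      exceeds the size of K.\<close>
    case True
    then show ?thesis using rk_le_card[OF fin, of j] j len by (simp add: nth_append)
  next
    case False
    then have l': "l < card K" "Suc l \<in> {1..card K}" using l by auto
    have "kpos K (Suc l) \<in> K" "rk K (kpos K (Suc l)) = Suc l" using kpos[OF fin l'(2)] by auto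
    then have "j < kpos K (Suc l) \<longleftrightarrow> rk K j < Suc l" using rk_less_iff[OF fin, of "kpos K (Suc l)" j] by simp
    then show ?thesis using l'(1) by (simp add: nth_append nth_sorted_list_kpos[OF fin] less_Suc_eq_le)
  qed
  show ?thesis
  proof
    assume h: "(sorted_list_of_set K @ [n + 1]) ! (l - 1) < j \<and> j < (sorted_list_of_set K @ [n + 1]) ! l"
    then have r: "rk K j = l" using a lower upper by auto
    moreover have "j \<notin> K"
      using kpos_rk[OF fin, of j] r h a by auto
    ultimately show "j \<notin> K \<and> rk K j = l" by simp
  next
    assume h: "j \<notin> K \<and> rk K j = l"
    then have "kpos K l \<noteq> j" using kl(1) by auto
    then show "(sorted_list_of_set K @ [n + 1]) ! (l - 1) < j \<and> j < (sorted_list_of_set K @ [n + 1]) ! l"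
      using h a lower upper by auto
  qed
qed

lemma cell_eq:
  assumes p: "p \<in> involutions n" and K: "set k = K" "K \<subseteq> {1..n}" "\<And>x. x \<in> K \<Longrightarrow> entry p x \<in> K"
    and ml: "m \<in> {1..card K}" "l \<in> {1..card K}"
  shows "cell p k m l = {entry p j | j. j \<in> {1..n} - K \<and> rk K j = l \<and> rk K (entry p j) = m}"
proof -
  have len: "length p = n" and f: "inv_on n (entry p)" using p by (auto simp: involutions_iff)
  have mem: "entry p i \<in> K \<longleftrightarrow> i \<in> K" if "i \<in> {1..n}" for i
    using K(3)[of i] K(3)[of "entry p i"] inv_onD(3)[OF f, of i] that by auto
  then have "{i \<in> {1..n}. entry p i \<in> K} = K" using K(2) by auto
  then have gp: "grid_positions p k = sorted_list_of_set K @ [n + 1]"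
    by (simp add: grid_positions_def K(1) len)
  have gv: "grid_values p k = sorted_list_of_set K @ [n + 1]"
    by (simp add: grid_values_def K(1) len)
  have "grid_positions p k ! (l - 1) < j \<and> j < grid_positions p k ! l \<and>
     grid_values p k ! (m - 1) < entry p j \<and> entry p j < grid_values p k ! m \<longleftrightarrow>
     j \<notin> K \<and> rk K j = l \<and> rk K (entry p j) = m" if j: "j \<in> {1..n}" for j
  proof -
    have "entry p j \<in> {1..n}" using f j by (simp add: inv_on_def)
    from grid_between[OF K(2) ml(2) j] grid_between[OF K(2) ml(1) this] mem[OF j]
    show ?thesis unfolding gp gv by blast
  qed
  then show ?thesis unfolding cell_def len by blast
qed

lemma order_iso_sym: "order_iso xs ys \<Longrightarrow> order_iso ys xs"
  by (simp add: order_iso_def)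

lemma card_le_nth:
  assumes "distinct xs" "i < length xs"
  shows "card {b \<in> set xs. b \<le> xs ! i} = card {j. j < length xs \<and> xs ! j \<le> xs ! i}"
proof -
  have "{b \<in> set xs. b \<le> xs ! i} = (!) xs ` {j. j < length xs \<and> xs ! j \<le> xs ! i}"
    by (auto simp: in_set_conv_nth)
  moreover have "inj_on ((!) xs) {j. j < length xs \<and> xs ! j \<le> xs ! i}"
    using assms(1) by (intro inj_on_nth) auto
  ultimately show ?thesis by (simp add: card_image)
qed

lemma standardise_order_iso_eq:
  assumes o: "order_iso xs \<rho>" and "distinct xs" and \<rho>: "\<rho> \<in> involutions s"
  shows "standardise xs = \<rho>"
proof (rule nth_equalityI)
  show len: "length (standardise xs) = length \<rho>" using o by (simp add: order_iso_def standardise_def)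
  fix i assume "i < length (standardise xs)"
  then have i: "i < length xs" "i < length \<rho>" using len by (auto simp: standardise_def)
  have "xs ! j \<le> xs ! i \<longleftrightarrow> \<rho> ! j \<le> \<rho> ! i" if "j < length xs" for j
    using o i that unfolding order_iso_def by (metis linorder_not_less)
  then have "card {j. j < length xs \<and> xs ! j \<le> xs ! i} = card {j. j < length \<rho> \<and> \<rho> ! j \<le> \<rho> ! i}"
    using o unfolding order_iso_def by (metis (no_types, lifting))
  then have "standardise xs ! i = card {b \<in> set \<rho>. b \<le> \<rho> ! i}"
    using card_le_nth[OF assms(2) i(1)] card_le_nth[OF distinct_involution[OF \<rho>] i(2)] i
    by (simp add: standardise_def)
  moreover have "{b \<in> set \<rho>. b \<le> \<rho> ! i} = {1..\<rho> ! i}"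
    using set_involution[OF \<rho>] nth_mem[OF i(2)] by auto
  ultimately show "standardise xs ! i = \<rho> ! i" by simp
qed

text \<open>The column l comes first and the row m second, the reverse of the order in
  \<open>cell\<close>. \<open>feasible_cells_eq\<close> identifies this condition with
  feasibility.\<close>

definition feas :: "nat \<Rightarrow> (nat \<Rightarrow> nat) \<Rightarrow> nat \<Rightarrow> nat \<Rightarrow> bool" where
  "feas s g l m \<longleftrightarrow> l \<in> {1..s} \<and> m \<in> {1..s} \<and> \<not> bad3 s g l m \<and> \<not> crossed s g l m"

lemma feas_sym: "inv_on s g \<Longrightarrow> feas s g l m \<Longrightarrow> feas s g m l"
  unfolding feas_def using bad3_mirror[of s g m l] crossed_commute by blast

lemma feas_unique: "conn s g \<Longrightarrow> feas s g l m \<Longrightarrow> feas s g l m' \<Longrightarrow> m = m'"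
  unfolding feas_def using feasible_unique by blast

lemma light_feas: "inv_on s g \<Longrightarrow> l \<in> {1..s} \<Longrightarrow> light s g l \<Longrightarrow> feas s g l l"
  unfolding feas_def using light_not_bad3 not_crossed_diag by blast

lemma Occ_four:
  assumes "V \<in> Occ n f" "a \<in> V"
  obtains b c d where "V = {a, b, c, d}" "distinct [a, b, c, d]"
proof -
  obtain i j k l where o: "occ n f i j k l" "V = {i, j, k, l}" using assms(1) by (rule OccE)
  then have d: "i < j" "j < k" "k < l" by (auto simp: occ_def)
  consider "a = i" | "a = j" | "a = k" | "a = l" using assms(2) o(2) by blast
  then show thesis
  proof cases
    case 1
    show thesis by (rule that[of j k l]) (use 1 o(2) d in auto)
  next
    case 2
    show thesis by (rule that[of i k l]) (use 2 o(2) d in auto)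
  next
    case 3
    show thesis by (rule that[of i j l]) (use 3 o(2) d in auto)
  next
    case 4
    show thesis by (rule that[of i j k]) (use 4 o(2) d in auto)
  qed
qed

lemma copies_emb:
  assumes \<rho>: "\<rho> \<in> involutions s" and p: "p \<in> involutions n" and k: "k \<in> copies \<rho> p"
  shows "emb n (entry p) (set k) s (entry \<rho>)"
proof -
  have sub: "subseq k p" and iso: "order_iso k \<rho>" and closed: "\<And>x. x \<in> set k \<Longrightarrow> entry p x \<in> set k"
    using k by (auto simp: copies_def occurrences_def)
  have filt: "k = filter (\<lambda>a. a \<in> set k) p"
    by (rule subseq_eq_filter[OF sub distinct_involution[OF p]])
  then have K: "set k \<subseteq> {1..n}" using set_involution[OF p] by (metis filter_is_subset)
  have "distinct k" using filt distinct_involution[OF p] by (metis distinct_filter)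
  then have "standardise k = \<rho>" by (rule standardise_order_iso_eq[OF iso _ \<rho>])
  then have "standardise (filter (\<lambda>a. a \<in> set k) p) = \<rho>" using filt by simp
  then have "emb n (entry p) (set k) (length \<rho>) (entry \<rho>)"
    using standardise_emb[OF p K closed] by blast
  then show ?thesis using \<rho> by (simp add: involutions_iff)
qed

text \<open>Take a copy with an entry a in the cell that lies in no forbidden occurrence. Under
  \<open>bad3\<close> the entry a would be with three entries of the copy, any one of which serves
  as z. Under \<open>crossed\<close> it would be with the two ends of an arc of the copy, and z is
  the mirror image of a.\<close>

lemma feasible_cell_feas:
  assumes \<rho>: "\<rho> \<in> involutions s" and ml: "m \<in> {1..s}" "l \<in> {1..s}"
    and nf: "\<not> infeasible_cell \<rho> m l"
  shows "feas s (entry \<rho>) l m"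
proof -
  obtain n p k a where p: "p \<in> involutions n" and k: "k \<in> copies \<rho> p" and a: "a \<in> cell p k m l"
    and no: "\<And>w b c z. w \<in> occ3412 p \<Longrightarrow> b \<in> set k \<Longrightarrow> c \<in> set k \<Longrightarrow> z \<in> set p \<Longrightarrow>
      distinct [a, b, c, z] \<Longrightarrow> set w \<noteq> {a, b, c, z}"
    using nf unfolding infeasible_cell_def by blast
  define f K where "f = entry p" and "K = set k"
  have e: "emb n f K s (entry \<rho>)" unfolding f_def K_def by (rule copies_emb[OF \<rho> p k])
  note E = embD[OF e]
  obtain j where j: "a = f j" "j \<in> {1..n}" "j \<notin> K" "rk K j = l" "rk K (f j) = m"
    using a cell_eq[OF p K_def[symmetric] E(2)] E(4,5) ml unfolding f_def by auto
  have no': "V \<noteq> {a, b, c, z}"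
    if V: "V \<in> Occ n f" and bcz: "b \<in> K" "c \<in> K" "z \<in> {1..n}" "distinct [a, b, c, z]" for V b c z
  proof -
    have "V \<in> set ` occ3412 p"
      using V bij_betw_imp_surj_on[OF bij_betw_occ3412[OF p]] unfolding f_def by simp
    then obtain w where w: "w \<in> occ3412 p" "set w = V" by blast
    have "z \<in> set p" using bcz(3) set_involution[OF p] by simp
    then have "set w \<noteq> {a, b, c, z}" by (intro no[OF w(1)]) (use bcz in \<open>simp_all add: K_def\<close>)
    then show ?thesis using w(2) by simp
  qed
  have "\<not> bad3 s (entry \<rho>) l m"
  proof
    assume "bad3 s (entry \<rho>) l m"
    then obtain w where w: "w \<in> Occ n f" "j \<in> w" "w - {j} \<subseteq> K"
      using bad3_occ[OF e j(2,3)] j(4,5) by blast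
    \<comment> \<open>The occurrence found contains the position j, whereas a cell consists of
      values; reflection moves the occurrence to \<open>a = f j\<close>.\<close>
    have V: "f ` w \<in> Occ n f" by (rule Occ_mirror[OF E(1) w(1)])
    have "a \<in> f ` w" using w(2) j(1) by blast
    then obtain b c d where bcd: "f ` w = {a, b, c, d}" "distinct [a, b, c, d]"
      by (rule Occ_four[OF V])
    have "f ` w - {a} \<subseteq> K" using w(3) E(5) j(1) by blast
    then have "b \<in> K" "c \<in> K" "d \<in> {1..n}" using bcd E(2) by auto
    then show False using no'[OF V _ _ _ bcd(2)] bcd(1) by blast
  qed
  moreover have "\<not> crossed s (entry \<rho>) l m"
  proof
    assume "crossed s (entry \<rho>) l m"
    then obtain y where y: "y \<in> K" "sep j (f j) y" "\<not> sep j (f j) (f y)"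
      using crossed_iff_sep[OF e j(2,3)] j(4,5) by blast
    have fy: "f y \<in> K" "f j \<notin> K" "y \<in> {1..n}" using E(2,5,7) y(1) j(2,3) by auto
    then have V: "{j, f j, y, f y} \<in> Occ n f"
      by (intro sep_occ[OF E(1) j(2) _ y(2,3)]) (use j in auto)
    have "distinct [a, y, f y, j]"
      using y fy j by (auto simp: sep_def)
    from no'[OF V y(1) fy(1) j(2) this] show False using j(1) by auto
  qed
  ultimately show ?thesis using ml by (simp add: feas_def)
qed

lemma one_involution: "[1] \<in> involutions (length [1])"
  by (simp add: involutions_iff inv_on_def entry_def)

lemma nil_involution: "[] \<in> involutions (length ([] :: nat list))"
  by (simp add: involutions_iff inv_on_def)

lemma light_filling:
  assumes c: "conn s g" and l: "light s g l" and q: "q \<in> involutions (length q)"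
  shows "filling s g (\<lambda>i. i) (\<lambda>i. if i = l then q else [])"
proof -
  have "inv_on s g" using c by (simp add: conn_def)
  then show ?thesis
    using c l q light_not_bad3[of s g l] nil_involution
    by unfold_locales (auto simp: not_crossed_diag split: if_splits)
qed

lemma one_two_involution: "[1, 2] \<in> involutions (length [1, 2 :: nat])"
  by (auto simp: involutions_iff inv_on_def entry_def nth_Cons split: nat.splits)

lemma kernel_copy:
  assumes p: "p \<in> involutions n" and n: "1 \<le> n" and \<rho>: "kernel_shape p = \<rho>"
  shows "kernel p \<in> copies \<rho> p" "set (kernel p) = ker n (entry p)"
proof -
  have f: "inv_on n (entry p)" using p by (simp add: involutions_iff)
  show s: "set (kernel p) = ker n (entry p)"
    using kernel_entries_eq[OF p n] ker_subset[OF f n] set_involution[OF p] by (auto simp: kernel_def)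
  have "order_iso (kernel p) \<rho>"
    using order_iso_sym[OF standardise_order_iso[of "kernel p"]] \<rho> by (simp add: kernel_shape_def)
  moreover have "subseq (kernel p) p" by (simp add: kernel_def)
  ultimately show "kernel p \<in> copies \<rho> p"
    using s ker_closed[OF f n] by (simp add: copies_def occurrences_def)
qed

text \<open>The witness is a filling with one point in the cell and one in its mirror image. The
  frame becomes the kernel and is closed under occurrences, so the point shares no occurrence with a
  kernel entry.\<close>

lemma feas_feasible_cell:
  assumes c: "conn (length \<rho>) (entry \<rho>)" and fe: "feas (length \<rho>) (entry \<rho>) l m"
  shows "\<not> infeasible_cell \<rho> m l"
proof -
  define s g where "s = length \<rho>" and "g = entry \<rho>"
  \<comment> \<open>For l = m this is the identity and the point becomes a fixed point.\<close>
  define sg where "sg = Transposition.transpose l m"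
  define Q where "Q i = (if i \<in> {l, m} then [1::nat] else [])" for i
  have lm: "l \<in> {1..s}" "m \<in> {1..s}" using fe by (auto simp: feas_def s_def)
  have g: "inv_on s g" using c by (simp add: conn_def s_def g_def)
  have fe': "feas s g l m" "feas s g m l" using fe feas_sym[OF g] by (auto simp: s_def g_def)
  interpret filling s g sg Q
  proof
    show "conn s g" using c by (simp add: s_def g_def)
    show "sg i \<in> {1..s}" if "i \<in> {1..s}" for i using that lm by (auto simp: sg_def transpose_def)
    show "sg (sg i) = i" for i by (simp add: sg_def)
    show "Q i \<in> involutions (length (Q i))" for i
      using one_involution by (auto simp: Q_def involutions_iff inv_on_def)
    show "Q (sg i) = Q i" for i by (auto simp: Q_def sg_def transpose_def)
    show "\<not> bad3 s g i (sg i)" if "Q i \<noteq> []" for i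
      using that fe' by (auto simp: Q_def sg_def transpose_def feas_def split: if_splits)
    show "\<not> crossed s g i (sg i)" if "Q i \<noteq> []" for i
      using that fe' by (auto simp: Q_def sg_def transpose_def feas_def split: if_splits)
    show "light s g i" if "1 \<le> t" "t < u" "u \<le> length (Q i)" for i t u
      using that by (auto simp: Q_def split: if_splits)
  qed
  define p where "p = plist n infl"
  have p: "p \<in> involutions n" unfolding p_def by (rule plist_infl)
  have n: "1 \<le> n" using s_pos by (simp add: n_def)
  have ks: "kernel_shape p = \<rho>" "kernel_entries p = K"
    unfolding p_def by (rule kernel_plist_infl; simp add: s_def g_def)+
  have K: "ker n (entry p) = K" using ks(2) kernel_entries_eq[OF p n] by simp
  have ef: "entry p x = infl x" if "x \<in> {1..n}" for x unfolding p_def by (rule entry_plist[OF that])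
  have Ql: "length (Q l) = 1" by (simp add: Q_def)
  define x where "x = pos l + 1"
  have x: "x \<in> {1..n}" "x \<notin> K" "rk K x = l"
    using pos_range[OF lm(1), of 1] pos_in_K[OF lm(1), of 1] rk_pos[OF lm(1), of 1] Ql
    by (auto simp: x_def)
  have "rk K (infl x) = m"
    by (rule non_K[OF x(1,2)]) (use x(3) in \<open>simp add: sg_def\<close>)
  then have cell: "entry p x \<in> cell p (kernel p) m l"
    using cell_eq[OF p kernel_copy(2)[OF p n ks(1)], of m l] x ef[OF x(1)] lm
      embD[OF emb] card_K ker_closed[of n "entry p"] n p unfolding K
    by (auto simp: involutions_iff)
  have fx: "entry p x \<notin> K"
    using embD(7)[OF emb x(1)] x(2) ef[OF x(1)] by simp
  have no: "\<not> (\<exists>w\<in>occ3412 p. \<exists>b\<in>set (kernel p). \<exists>c\<in>set (kernel p). \<exists>z\<in>set p.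
          distinct [entry p x, b, c, z] \<and> set w = {entry p x, b, c, z})"
  proof
    assume "\<exists>w\<in>occ3412 p. \<exists>b\<in>set (kernel p). \<exists>c\<in>set (kernel p). \<exists>z\<in>set p.
          distinct [entry p x, b, c, z] \<and> set w = {entry p x, b, c, z}"
    then obtain w b where w: "w \<in> occ3412 p" "b \<in> set (kernel p)" "b \<in> set w" "entry p x \<in> set w"
      by auto
    have "set w \<in> Occ n (entry p)" using bij_betw_apply[OF bij_betw_occ3412[OF p] w(1)] .
    then have "set w \<subseteq> ker n (entry p)"
      by (rule ker_occ) (use w kernel_copy(2)[OF p n ks(1)] in auto)
    then show False using w(4) fx K by blast
  qed
  show ?thesis
    unfolding infeasible_cell_def using p kernel_copy(1)[OF p n ks(1)] cell no by blast
qed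

lemma sorted_wrt_filter_iff:
  "sorted_wrt R (filter P xs) \<longleftrightarrow> sorted_wrt (\<lambda>x y. P x \<longrightarrow> P y \<longrightarrow> R x y) xs"
  by (induction xs) auto

lemma decreasing_filter_iff:
  assumes "length p = n"
  shows "sorted_wrt (>) (filter P p) \<longleftrightarrow>
    (\<forall>i\<in>{1..n}. \<forall>j\<in>{1..n}. i < j \<and> P (entry p i) \<and> P (entry p j) \<longrightarrow> entry p j < entry p i)"
proof -
  define f where "f = entry p"
  have p_eq: "p = map f [1..<Suc n]" using plist_entry[OF assms] by (simp add: plist_def f_def)
  have "sorted_wrt (>) (filter P p) \<longleftrightarrow>
    sorted_wrt (\<lambda>i j. P (f i) \<longrightarrow> P (f j) \<longrightarrow> f j < f i) [1..<Suc n]"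
    by (simp only: p_eq sorted_wrt_filter_iff sorted_wrt_map)
  then have "sorted_wrt (>) (filter P p) \<longleftrightarrow>
    sorted_wrt (\<lambda>i j. P (entry p i) \<longrightarrow> P (entry p j) \<longrightarrow> entry p j < entry p i) [1..<Suc n]"
    unfolding f_def .
  also have "\<dots> \<longleftrightarrow> (\<forall>i\<in>{1..n}. \<forall>j\<in>{1..n}. i < j \<and> P (entry p i) \<and> P (entry p j) \<longrightarrow>
      entry p j < entry p i)" (is "?L \<longleftrightarrow> ?R")
  proof
    assume L: ?L
    show ?R
    proof (intro ballI impI)
      fix i j assume ij: "i \<in> {1..n}" "j \<in> {1..n}" "i < j \<and> P (entry p i) \<and> P (entry p j)"
      then have "i - 1 < j - 1" "j - 1 < length [1..<Suc n]" by auto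
      from sorted_wrt_nth_less[OF L this] show "entry p j < entry p i"
        using ij by (simp add: nth_upt del: upt_Suc)
    qed
  next
    assume R: ?R
    show ?L
      unfolding sorted_wrt_iff_nth_less using R by (auto simp: nth_upt simp del: upt_Suc)
  qed
  finally show ?thesis .
qed

lemma with_shape_closed:
  assumes "p \<in> involutions n" "1 \<le> n" "kernel_shape p = \<rho>"
  shows "emb n (entry p) (ker n (entry p)) (length \<rho>) (entry \<rho>)" "conn (length \<rho>) (entry \<rho>)"
    "1 \<in> ker n (entry p)"
    "\<And>w. w \<in> Occ n (entry p) \<Longrightarrow> w \<inter> ker n (entry p) \<noteq> {} \<Longrightarrow> w \<subseteq> ker n (entry p)"
  using kernel_shape_conn[OF assms(1,2)] assms(3) ker_occ by (auto simp: ker_one[unfolded One_nat_def])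

text \<open>An ascent is excluded by \<open>closed_ascent\<close> everywhere except in a light gap
  on the diagonal. There, two fixed points form an ascent without changing the kernel shape.\<close>

lemma necessarily_decreasing_iff:
  assumes c: "conn (length \<rho>) (entry \<rho>)" and ml: "m \<in> {1..length \<rho>}" "l \<in> {1..length \<rho>}"
  shows "necessarily_decreasing \<rho> m l \<longleftrightarrow> \<not> (m = l \<and> light (length \<rho>) (entry \<rho>) l)"
proof
  assume neg: "\<not> (m = l \<and> light (length \<rho>) (entry \<rho>) l)"
  show "necessarily_decreasing \<rho> m l"
    unfolding necessarily_decreasing_def
  proof
    fix p assume "p \<in> with_shape \<rho>"
    then obtain n where p: "1 \<le> n" "p \<in> involutions n" "kernel_shape p = \<rho>"
      by (auto simp: with_shape_def)
    define f K where "f = entry p" and "K = ker n f"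
    note W = with_shape_closed[OF p(2,1,3), folded f_def, folded K_def]
    note E = embD[OF W(1)]
    have cell: "cell p (kernel p) m l = {f j | j. j \<in> {1..n} - K \<and> rk K j = l \<and> rk K (f j) = m}"
      unfolding f_def
      by (rule cell_eq[OF p(2)])
        (use kernel_copy(2)[OF p(2,1,3)] E(2,4,5) ml in \<open>auto simp: K_def f_def\<close>)
    have f: "inv_on n f" by (rule E(1))
    show "sorted_wrt (>) (filter (\<lambda>a. a \<in> cell p (kernel p) m l) p)"
    proof (subst decreasing_filter_iff)
      show "length p = n" using p(2) by (simp add: involutions_iff)
      show "\<forall>i\<in>{1..n}. \<forall>j\<in>{1..n}. i < j \<and> entry p i \<in> cell p (kernel p) m l \<and>
        entry p j \<in> cell p (kernel p) m l \<longrightarrow> entry p j < entry p i"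
      proof (intro ballI impI, rule ccontr)
        fix i j assume i: "i \<in> {1..n}" and j: "j \<in> {1..n}"
          and h: "i < j \<and> entry p i \<in> cell p (kernel p) m l \<and> entry p j \<in> cell p (kernel p) m l"
          and nless: "\<not> entry p j < entry p i"
        have in_cell: "x \<notin> K \<and> rk K x = l \<and> rk K (f x) = m"
          if x: "x \<in> {1..n}" "f x \<in> cell p (kernel p) m l" for x
        proof -
          obtain y where y: "f x = f y" "y \<in> {1..n} - K" "rk K y = l" "rk K (f y) = m"
            using x(2) unfolding cell by blast
          then have "x = y" using inj_onD[OF inv_on_inj[OF f] y(1)] x(1) by blast
          then show ?thesis using y by simp
        qed
        have I: "i \<notin> K \<and> rk K i = l \<and> rk K (f i) = m" and J: "j \<notin> K \<and> rk K j = l \<and> rk K (f j) = m"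
          using in_cell[OF i] in_cell[OF j] h by (auto simp: f_def)
        have "f i \<noteq> f j" using inj_onD[OF inv_on_inj[OF f] _ i j] h by auto
        then have "f i < f j" using nless by (simp add: f_def)
        then have "rk K (f i) = rk K i \<and> light (length \<rho>) (entry \<rho>) (rk K i)"
          using closed_ascent[OF W(1,3,2,4) i _ j] I J h by simp
        then show False using neg I by simp
      qed
    qed
  qed
next
  assume dec: "necessarily_decreasing \<rho> m l"
  show "\<not> (m = l \<and> light (length \<rho>) (entry \<rho>) l)"
  proof
    assume ml': "m = l \<and> light (length \<rho>) (entry \<rho>) l"
    define s g where "s = length \<rho>" and "g = entry \<rho>"
    define sg where "sg = (\<lambda>i::nat. i)"
    define Q where "Q = (\<lambda>i. if i = l then [1::nat, 2] else [])"
    have lm: "l \<in> {1..s}" using ml by (simp add: s_def)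
    interpret filling s g sg Q
      unfolding sg_def Q_def
      by (rule light_filling[OF _ _ one_two_involution]) (use c ml' in \<open>simp_all add: s_def g_def\<close>)
    define p where "p = plist n infl"
    have p: "p \<in> involutions n" unfolding p_def by (rule plist_infl)
    have n: "1 \<le> n" using s_pos by (simp add: n_def)
    have ks: "kernel_shape p = \<rho>" "kernel_entries p = K"
      unfolding p_def by (rule kernel_plist_infl; simp add: s_def g_def)+
    have K: "ker n (entry p) = K" using ks(2) kernel_entries_eq[OF p n] by simp
    have ef: "entry p x = infl x" if "x \<in> {1..n}" for x unfolding p_def by (rule entry_plist[OF that])
    have Ql: "Q l = [1, 2]" by (simp add: Q_def)
    have cell: "cell p (kernel p) l l =
      {entry p j | j. j \<in> {1..n} - K \<and> rk K j = l \<and> rk K (entry p j) = l}"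
      by (rule cell_eq[OF p])
        (use kernel_copy(2)[OF p n ks(1)] embD[OF emb] lm card_K ef K in \<open>auto simp: subset_iff\<close>)
    have x: "pos l + t \<in> {1..n}" "entry p (pos l + t) = pos l + t"
      "entry p (pos l + t) \<in> cell p (kernel p) l l"
      if t: "t \<in> {1, 2}" for t
    proof -
      have t': "1 \<le> t" "t \<le> length (Q l)" using t Ql by auto
      show r: "pos l + t \<in> {1..n}" by (rule pos_range[OF lm t'(2)])
      have "entry [1, 2] t = t" using t by (auto simp: entry_def)
      then show e: "entry p (pos l + t) = pos l + t"
        using ef[OF r] infl_gap[OF lm t'] by (simp add: Ql sg_def)
      have h: "pos l + t \<notin> K" "rk K (pos l + t) = l"
        using pos_in_K[OF lm t'(2)] rk_pos[OF lm t'(2)] t'(1) by auto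
      show "entry p (pos l + t) \<in> cell p (kernel p) l l" unfolding cell
        by (intro CollectI exI[of _ "pos l + t"]) (use r e h in simp)
    qed
    have "p \<in> with_shape \<rho>" using p n ks(1) by (auto simp: with_shape_def)
    then have "sorted_wrt (>) (filter (\<lambda>a. a \<in> cell p (kernel p) l l) p)"
      using dec ml' unfolding necessarily_decreasing_def by blast
    then have dec': "\<forall>i\<in>{1..n}. \<forall>j\<in>{1..n}. i < j \<and> entry p i \<in> cell p (kernel p) l l \<and>
        entry p j \<in> cell p (kernel p) l l \<longrightarrow> entry p j < entry p i"
      by (subst (asm) decreasing_filter_iff) (simp_all add: p_def)
    note x1 = x[of 1, OF insertI1] and x2 = x[of 2, OF insertI2[OF singletonI]]
    from dec'[rule_format, OF x1(1) x2(1)] x1(3) x2(3)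
    have "entry p (pos l + 2) < entry p (pos l + 1)" by simp
    then show False using x(2)[of 1] x(2)[of 2] by simp
  qed
qed

section \<open>The involutions with a given kernel shape\<close>

text \<open>By \<open>feas_unique\<close> a column has at most one feasible cell. The default l for
  a column without one makes the map an involution, as a filling requires.\<close>

definition partner :: "nat \<Rightarrow> (nat \<Rightarrow> nat) \<Rightarrow> nat \<Rightarrow> nat" where
  "partner s g l = (if \<exists>m. feas s g l m then THE m. feas s g l m else l)"

lemma partner_eq: "conn s g \<Longrightarrow> feas s g l m \<Longrightarrow> partner s g l = m"
  unfolding partner_def using feas_unique by (auto intro: the_equality)

lemma feas_partner: "conn s g \<Longrightarrow> feas s g l m \<Longrightarrow> feas s g l (partner s g l)"
  using partner_eq by metis

lemma partner_range: "conn s g \<Longrightarrow> l \<in> {1..s} \<Longrightarrow> partner s g l \<in> {1..s}"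
  using partner_eq[of s g l] by (cases "\<exists>m. feas s g l m") (auto simp: feas_def partner_def)

lemma partner_partner:
  assumes "conn s g"
  shows "partner s g (partner s g l) = l"
proof (cases "\<exists>m. feas s g l m")
  case True
  then obtain m where m: "feas s g l m" by blast
  have "inv_on s g" using assms by (simp add: conn_def)
  then have "feas s g m l" using feas_sym m by blast
  then show ?thesis using partner_eq[OF assms] m by simp
next
  case False
  then have "partner s g l = l" by (simp add: partner_def)
  then show ?thesis by simp
qed

lemma partner_light: "conn s g \<Longrightarrow> l \<in> {1..s} \<Longrightarrow> light s g l \<Longrightarrow> partner s g l = l"
  using partner_eq light_feas by (metis conn_def)

section \<open>Contents of the cells\<close>

definition dec_list :: "nat \<Rightarrow> nat list" where
  "dec_list k = plist k (\<lambda>t. Suc k - t)"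

lemma length_dec_list [simp]: "length (dec_list k) = k"
  by (simp add: dec_list_def)

lemma entry_dec_list: "t \<in> {1..k} \<Longrightarrow> entry (dec_list k) t = Suc k - t"
  by (simp add: dec_list_def entry_plist)

lemma dec_list_involution: "dec_list k \<in> involutions k"
  unfolding dec_list_def by (rule plist_involution) (auto simp: inv_on_def)

text \<open>The last case comprises columns without a feasible cell and the larger of two distinct
  partners, whose content \<open>sym_ext\<close> copies from the smaller one.\<close>

definition fillers :: "nat \<Rightarrow> (nat \<Rightarrow> nat) \<Rightarrow> nat \<Rightarrow> nat list set" where
  "fillers s g l =
     (if light s g l then {q. q \<in> involutions (length q)}
      else if feas s g l (partner s g l) \<and> l \<le> partner s g l then range dec_list
      else {[]})"

text \<open>Mirror images of cells are filled together, so only the smaller of two partners is free.\<close>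

definition sym_ext :: "nat \<Rightarrow> (nat \<Rightarrow> nat) \<Rightarrow> (nat \<Rightarrow> nat list) \<Rightarrow> nat \<Rightarrow> nat list" where
  "sym_ext s g q l = q (min l (partner s g l))"

lemma fillers_involution: "q \<in> fillers s g l \<Longrightarrow> q \<in> involutions (length q)"
  using dec_list_involution nil_involution by (auto simp: fillers_def split: if_splits)

lemma filling_sym_ext:
  assumes c: "conn s g" and q: "q \<in> PiE {1..s} (fillers s g)"
  shows "filling s g (partner s g) (sym_ext s g q)"
proof
  have g: "inv_on s g" using c by (simp add: conn_def)
  show "conn s g" by (rule c)
  show "partner s g l \<in> {1..s}" if "l \<in> {1..s}" for l by (rule partner_range[OF c that])
  show "partner s g (partner s g l) = l" for l by (rule partner_partner[OF c])
  define mn where "mn l = min l (partner s g l)" for l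
  have mn: "mn l \<in> {1..s}" if "l \<in> {1..s}" for l
    using partner_range[OF c that] that by (auto simp: mn_def min_def)
  have ext: "sym_ext s g q l = q (mn l)" for l by (simp add: sym_ext_def mn_def)
  have qm: "q (mn l) \<in> fillers s g (mn l)" if "l \<in> {1..s}" for l using q mn[OF that] by auto
  show "sym_ext s g q l \<in> involutions (length (sym_ext s g q l))" if "l \<in> {1..s}" for l
    unfolding ext by (rule fillers_involution[OF qm[OF that]])
  show "sym_ext s g q (partner s g l) = sym_ext s g q l" for l
    by (simp add: sym_ext_def partner_partner[OF c] min.commute)
  \<comment> \<open>A light gap is its own partner, so the smaller of two partners can be light only
    if they coincide.\<close>
  have light_mn: "mn l = l" if "l \<in> {1..s}" "light s g (mn l)" for l
  proof -
    have "partner s g (mn l) = mn l" by (rule partner_light[OF c mn that(2)]) (rule that)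
    moreover have "mn l = l \<or> mn l = partner s g l" by (auto simp: mn_def)
    ultimately show ?thesis using partner_partner[OF c, of l] by metis
  qed
  have fe: "feas s g l (partner s g l)" if l: "l \<in> {1..s}" and ne: "sym_ext s g q l \<noteq> []" for l
  proof -
    have "light s g (mn l) \<or> feas s g (mn l) (partner s g (mn l))"
      using qm[OF l] ne by (auto simp: ext fillers_def split: if_splits)
    then have "feas s g (mn l) (partner s g (mn l))"
      using light_feas[OF g mn[OF l]] feas_partner[OF c] by blast
    moreover have "mn l = l \<or> mn l = partner s g l" by (auto simp: mn_def)
    ultimately show ?thesis using feas_sym[OF g] partner_partner[OF c, of l] by metis
  qed
  show "\<not> bad3 s g l (partner s g l)" "\<not> crossed s g l (partner s g l)"
    if "l \<in> {1..s}" "sym_ext s g q l \<noteq> []" for l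
    using fe[OF that] by (auto simp: feas_def)
  show "light s g l"
    if l: "l \<in> {1..s}" and tu: "1 \<le> t" "t < u" "u \<le> length (sym_ext s g q l)"
      and asc: "entry (sym_ext s g q l) t < entry (sym_ext s g q l) u" for l t u
  proof (rule ccontr)
    assume nl: "\<not> light s g l"
    have "\<not> light s g (mn l)"
    proof
      assume "light s g (mn l)"
      with light_mn[OF l this] nl show False by simp
    qed
    then have "q (mn l) \<in> range dec_list \<or> q (mn l) = []"
      using qm[OF l] by (auto simp: fillers_def split: if_splits)
    then obtain k where k: "q (mn l) = dec_list k" using tu by (auto simp: ext)
    have "entry (dec_list k) t = Suc k - t" "entry (dec_list k) u = Suc k - u"
      using tu k by (auto simp: ext intro!: entry_dec_list)
    then show False using asc tu k by (simp add: ext)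
  qed
qed

abbreviation fill_size :: "nat \<Rightarrow> (nat \<Rightarrow> nat) \<Rightarrow> (nat \<Rightarrow> nat list) \<Rightarrow> nat" where
  "fill_size s g q \<equiv> filling.n s (sym_ext s g q)"

definition assemble :: "nat \<Rightarrow> (nat \<Rightarrow> nat) \<Rightarrow> (nat \<Rightarrow> nat list) \<Rightarrow> nat list" where
  "assemble s g q = plist (fill_size s g q) (filling.infl s g (partner s g) (sym_ext s g q))"

lemma entry_list_eqI:
  assumes "length p = length q" "\<And>t. t \<in> {1..length p} \<Longrightarrow> entry p t = entry q t"
  shows "p = q"
  using plist_cong[of "length p" "entry p" "entry q"] assms plist_entry[of p] plist_entry[of q] by simp

text \<open>The frame is the kernel of the assembled involution, so it can be recovered from it, and
  with it the gaps and their contents. Where the content is only a copy, both choices are the empty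
  list.\<close>

lemma assemble_inj:
  assumes c: "conn s g" and \<rho>: "length \<rho> = s" "entry \<rho> = g"
  shows "inj_on (assemble s g) (PiE {1..s} (fillers s g))"
proof (rule inj_onI)
  fix q q' assume q: "q \<in> PiE {1..s} (fillers s g)" and q': "q' \<in> PiE {1..s} (fillers s g)"
    and eq: "assemble s g q = assemble s g q'"
  define Q Q' where "Q = sym_ext s g q" and "Q' = sym_ext s g q'"
  have F: "filling s g (partner s g) Q" and F': "filling s g (partner s g) Q'"
    unfolding Q_def Q'_def by (rule filling_sym_ext[OF c q], rule filling_sym_ext[OF c q'])
  interpret a: filling s g "partner s g" Q by (rule F)
  interpret b: filling s g "partner s g" Q' by (rule F')
  have p: "plist a.n a.infl = plist b.n b.infl" using eq by (simp add: assemble_def Q_def Q'_def)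
  then have n: "a.n = b.n" by (metis length_plist)
  have K: "a.K = b.K"
    using a.kernel_plist_infl(2)[OF \<rho>] b.kernel_plist_infl(2)[OF \<rho>] p by simp
  have pos: "a.pos l = b.pos l" if l: "l \<in> {1..Suc s}" for l
  proof (cases "l = Suc s")
    case True
    then show ?thesis using a.pos_end b.pos_end n by simp
  next
    case False
    then have "l \<in> {1..s}" using l by auto
    then show ?thesis using a.kpos_K b.kpos_K K by metis
  qed
  have infl: "a.infl x = b.infl x" if "x \<in> {1..a.n}" for x
    using entry_plist[of x a.n a.infl] entry_plist[of x b.n b.infl] p n that by simp
  have QQ: "Q l = Q' l" if l: "l \<in> {1..s}" for l
  proof (rule entry_list_eqI)
    have "a.pos (Suc l) = b.pos (Suc l)" "a.pos l = b.pos l" by (rule pos; use l in simp)+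
    then show len: "length (Q l) = length (Q' l)" using a.pos_Suc[of l] b.pos_Suc[of l] l by simp
    fix t assume t: "t \<in> {1..length (Q l)}"
    have "a.infl (a.pos l + t) = a.pos (partner s g l) + entry (Q l) t"
      by (rule a.infl_gap[OF l]) (use t in auto)
    moreover have "b.infl (b.pos l + t) = b.pos (partner s g l) + entry (Q' l) t"
      by (rule b.infl_gap[OF l]) (use t len in auto)
    moreover have "a.infl (a.pos l + t) = b.infl (b.pos l + t)"
      using infl[OF a.pos_range[OF l, of t]] t pos[of l] l by simp
    moreover have "a.pos (partner s g l) = b.pos (partner s g l)"
      by (rule pos) (use partner_range[OF c l] in auto)
    ultimately show "entry (Q l) t = entry (Q' l) t" by simp
  qed
  show "q = q'"
  proof (rule PiE_ext[OF q q'])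
    fix l assume l: "l \<in> {1..s}"
    show "q l = q' l"
    proof (cases "l \<le> partner s g l")
      case True
      then show ?thesis using QQ[OF l] by (simp add: Q_def Q'_def sym_ext_def min_def)
    next
      case False
      then have "\<not> light s g l" using partner_light[OF c l] by auto
      then have "fillers s g l = {[]}" using False by (simp add: fillers_def)
      then show ?thesis using q q' l by (metis PiE_mem singletonD)
    qed
  qed
qed

lemma decreasing_self_map:
  fixes h :: "nat \<Rightarrow> nat"
  assumes range: "\<And>t. t \<in> {1..G} \<Longrightarrow> h t \<in> {1..G}"
    and dec: "\<And>t u. 1 \<le> t \<Longrightarrow> t < u \<Longrightarrow> u \<le> G \<Longrightarrow> h u < h t"
    and t: "t \<in> {1..G}"
  shows "h t = Suc G - t"
proof -
  have up: "t + h t \<le> Suc G" if "1 \<le> t" "t \<le> G" for t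
    using that
  proof (induction t)
    case (Suc t)
    show ?case
    proof (cases "t = 0")
      case True
      then show ?thesis using range[of 1] Suc by simp
    next
      case False
      then show ?thesis using Suc dec[of t "Suc t"] by simp
    qed
  qed simp
  have down: "Suc d \<le> h (G - d)" if "d < G" for d
    using that
  proof (induction d)
    case 0
    then show ?case using range[of G] by simp
  next
    case (Suc d)
    have "h (G - d) < h (G - Suc d)" by (rule dec) (use Suc in auto)
    then show ?case using Suc by simp
  qed
  have "Suc (G - t) \<le> h t" using down[of "G - t"] t by simp
  then show ?thesis using up[of t] t by simp
qed

text \<open>Every point outside the kernel lies in a feasible cell, so all of column gap l goes to
  the row gap of its partner. The contents of partners are mutually inverse, and outside light gaps
  they are decreasing, so one admissible list describes both.\<close>

lemma assemble_surj:
  assumes c: "conn s g" and \<rho>: "length \<rho> = s" "entry \<rho> = g"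
    and p: "p \<in> involutions n" and n: "1 \<le> n" and ks: "kernel_shape p = \<rho>"
  shows "\<exists>q\<in>PiE {1..s} (fillers s g). assemble s g q = p"
proof -
  define f where "f = entry p"
  define K where "K = ker n f"
  note W = with_shape_closed[OF p n ks, folded f_def, folded K_def, unfolded \<rho>]
  note E = embD[OF W(1)]
  have f: "inv_on n f" by (rule E(1))
  have g: "inv_on s g" using c by (simp add: conn_def)
  have len_p: "length p = n" using p by (simp add: involutions_iff)
  have fN: "f x \<in> {1..n}" "f (f x) = x" if "x \<in> {1..n}" for x using f that by (auto simp: inv_on_def)
  define pa where "pa = partner s g"
  have pa: "pa l \<in> {1..s}" "pa (pa l) = l" if "l \<in> {1..s}" for l
    using partner_range[OF c that] partner_partner[OF c] by (auto simp: pa_def)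
  \<comment> \<open>The appended n + 1 acts as an additional kernel position, so that the last gap
    needs no separate formula.\<close>
  define P where "P l = (sorted_list_of_set K @ [n + 1]) ! (l - 1)" for l
  have P_kpos: "P l = kpos K l" if l: "l \<in> {1..s}" for l
  proof -
    have "l - 1 < card K" "Suc (l - 1) = l" using l E(4) by auto
    then show ?thesis using nth_sorted_list_kpos[OF E(3), of "l - 1"] by (simp add: P_def nth_append)
  qed
  have P_end: "P (Suc s) = Suc n" using E(4) by (simp add: P_def nth_append)
  have rkK: "rk K (P l) = l" "P l \<in> K" if l: "l \<in> {1..s}" for l
    using kpos[OF E(3)] E(4) l P_kpos[OF l] by auto
  have P_in: "P l \<in> {1..n}" if "l \<in> {1..s}" for l using rkK(2)[OF that] E(2) by blast
  have P_less: "P l < P (Suc l)" if l: "l \<in> {1..s}" for l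
  proof (cases "l = s")
    case True
    then show ?thesis using P_end P_in[OF l] by simp
  next
    case False
    then have l': "Suc l \<in> {1..s}" using l by auto
    show ?thesis using rk_less_iff[OF E(3) rkK(2)[OF l'], of "P l"] rkK(1)[OF l] rkK(1)[OF l'] by simp
  qed
  have P_le: "P (Suc l) \<le> Suc n" if l: "l \<in> {1..s}" for l
  proof (cases "l = s")
    case False
    then have "Suc l \<in> {1..s}" using l by auto
    then show ?thesis using P_in[of "Suc l"] by simp
  qed (simp add: P_end)
  define G where "G l = P (Suc l) - P l - 1" for l
  have P_Suc: "P (Suc l) = Suc (P l + G l)" if "l \<in> {1..s}" for l
    using P_less[OF that] by (simp add: G_def)
  have gap: "P l < x \<and> x < P (Suc l) \<longleftrightarrow> x \<notin> K \<and> rk K x = l" if "l \<in> {1..s}" "x \<in> {1..n}" for l x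
    using grid_between[OF E(2), of l x] that E(4) by (simp add: P_def)
  have gap_t: "P l + t \<in> {1..n}" "P l + t \<notin> K" "rk K (P l + t) = l"
    if l: "l \<in> {1..s}" and t: "t \<in> {1..G l}" for l t
  proof -
    have 1: "P l < P l + t \<and> P l + t < P (Suc l)" using P_Suc[OF l] t by simp
    then show "P l + t \<in> {1..n}" using P_le[OF l] by simp
    from gap[OF l this] 1 show "P l + t \<notin> K" "rk K (P l + t) = l" by blast+
  qed
  have feas_rk: "feas s g (rk K x) (rk K (f x))" if x: "x \<in> {1..n}" "x \<notin> K" for x
  proof -
    have fx: "f x \<in> {1..n}" using fN x by simp
    have "rk K x \<in> {1..s}" "rk K (f x) \<in> {1..s}"
      using rk_pos[OF E(3) W(3)] rk_le_card[OF E(3)] E(4) x fx by auto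
    then show ?thesis
      using closed_no_bad3[OF W(1,4) x] closed_uncrossed[OF W(1,4) x] by (simp add: feas_def)
  qed
  have image_t: "\<exists>u\<in>{1..G (pa l)}. f (P l + t) = P (pa l) + u"
    if l: "l \<in> {1..s}" and t: "t \<in> {1..G l}" for l t
  proof -
    define x where "x = P l + t"
    have x: "x \<in> {1..n}" "x \<notin> K" "rk K x = l" unfolding x_def by (rule gap_t[OF l t])+
    have fx: "f x \<in> {1..n}" "f x \<notin> K" using fN x E(7) by auto
    have "rk K (f x) = pa l" using partner_eq[OF c feas_rk[OF x(1,2)]] x(3) by (simp add: pa_def)
    then have "P (pa l) < f x \<and> f x < P (Suc (pa l))" using gap[OF pa(1)[OF l] fx(1)] fx(2) by simp
    then have "f x - P (pa l) \<in> {1..G (pa l)}" "f x = P (pa l) + (f x - P (pa l))"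
      using P_Suc[OF pa(1)[OF l]] by auto
    then show ?thesis unfolding x_def by blast
  qed
  define h where "h l t = f (P l + t) - P (pa l)" for l t
  have h: "f (P l + t) = P (pa l) + h l t" "h l t \<in> {1..G (pa l)}"
    if l: "l \<in> {1..s}" and t: "t \<in> {1..G l}" for l t
    using image_t[OF l t] by (auto simp: h_def)
  have hh: "h (pa l) (h l t) = t" if l: "l \<in> {1..s}" and t: "t \<in> {1..G l}" for l t
    using h[OF pa(1)[OF l] h(2)[OF l t]] fN(2)[OF gap_t(1)[OF l t]] h(1)[OF l t] pa(2)[OF l] by simp
  \<comment> \<open>\<open>h l\<close> maps gap l injectively into the partner gap; by symmetry
    partners have the same size.\<close>
  have G_le: "G l \<le> G (pa l)" if l: "l \<in> {1..s}" for l
  proof -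
    have "inj_on (h l) {1..G l}" by (rule inj_on_inverseI[of _ "h (pa l)"]) (rule hh[OF l])
    moreover have "h l ` {1..G l} \<subseteq> {1..G (pa l)}" using h(2)[OF l] by blast
    ultimately show ?thesis using card_inj_on_le[of "h l" "{1..G l}" "{1..G (pa l)}"] by simp
  qed
  have G_pa: "G (pa l) = G l" if l: "l \<in> {1..s}" for l
    using G_le[OF l] G_le[OF pa(1)[OF l]] pa(2)[OF l] by simp
  have h_dec: "h l t = Suc (G l) - t" if l: "l \<in> {1..s}" and nl: "\<not> light s g l" and t: "t \<in> {1..G l}"
    for l t
  proof (rule decreasing_self_map[OF _ _ t])
    show "h l t \<in> {1..G l}" if "t \<in> {1..G l}" for t using h(2)[OF l that] G_pa[OF l] by simp
    show "h l u < h l t" if tu: "1 \<le> t" "t < u" "u \<le> G l" for t u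
    proof (rule ccontr)
      assume not_less: "\<not> h l u < h l t"
      have T: "t \<in> {1..G l}" and U: "u \<in> {1..G l}" using tu by auto
      note x = gap_t[OF l T] and y = gap_t[OF l U]
      have "h l t \<noteq> h l u" using hh[OF l T] hh[OF l U] tu(2) by auto
      then have "f (P l + t) < f (P l + u)" using not_less h(1)[OF l T] h(1)[OF l U] by simp
      moreover have "rk K (f (P l + t)) = pa l" "rk K (f (P l + u)) = pa l"
        using partner_eq[OF c feas_rk[OF x(1,2)]] partner_eq[OF c feas_rk[OF y(1,2)]] x(3) y(3)
        by (auto simp: pa_def)
      ultimately have "light s g (rk K (P l + t))"
        using closed_ascent[OF W(1,3,2,4) x(1,2) y(1,2)] x(3) y(3) tu by simp
      then show False using nl x(3) by simp
    qed
  qed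
  define q where "q l = (if l \<in> {1..s} then if l \<le> pa l then plist (G l) (h l) else [] else undefined)" for l
  have q_fill: "q l \<in> fillers s g l" if l: "l \<in> {1..s}" for l
  proof (cases "light s g l")
    case True
    have pl: "pa l = l" using partner_light[OF c l True] by (simp add: pa_def)
    have "inv_on (G l) (h l)"
      unfolding inv_on_def using h(2)[OF l] hh[OF l] pl by auto
    then have "plist (G l) (h l) \<in> involutions (G l)" by (rule plist_involution)
    then show ?thesis using True l pl by (simp add: fillers_def q_def)
  next
    case False
    show ?thesis
    proof (cases "l \<le> pa l")
      case le: True
      have eq: "plist (G l) (h l) = dec_list (G l)"
        unfolding dec_list_def by (rule plist_cong) (rule h_dec[OF l False])
      show ?thesis
      proof (cases "feas s g l (pa l)")
        case True
        then show ?thesis using False le l eq by (simp add: fillers_def q_def pa_def)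
      next
        case nf: False
        have "G l = 0"
        proof (rule ccontr)
          assume "G l \<noteq> 0"
          then have 1: "1 \<in> {1..G l}" by simp
          note x = gap_t[OF l 1]
          from feas_partner[OF c feas_rk[OF x(1,2)]] x(3) nf show False by (simp add: pa_def)
        qed
        then show ?thesis using False nf l le by (simp add: fillers_def q_def pa_def plist_def)
      qed
    next
      case nle: False
      then show ?thesis using False l by (simp add: fillers_def q_def pa_def)
    qed
  qed
  have qP: "q \<in> PiE {1..s} (fillers s g)"
  proof (rule PiE_I)
    show "q l \<in> fillers s g l" if "l \<in> {1..s}" for l by (rule q_fill[OF that])
    show "q l = undefined" if "l \<notin> {1..s}" for l unfolding q_def using that by (rule if_not_P)
  qed
  define Q where "Q = sym_ext s g q"
  have Q_plist: "Q l = plist (G l) (h l)" if l: "l \<in> {1..s}" for l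
  proof (cases "l \<le> pa l")
    case True
    then show ?thesis using l by (simp add: Q_def sym_ext_def q_def pa_def[symmetric] min_def)
  next
    case False
    then have "\<not> light s g l" "\<not> light s g (pa l)"
      using partner_light[OF c l] partner_light[OF c pa(1)[OF l]] pa(2)[OF l] by (auto simp: pa_def)
    then have "plist (G (pa l)) (h (pa l)) = plist (G l) (h l)"
      unfolding G_pa[OF l] using h_dec[OF l] h_dec[OF pa(1)[OF l]] G_pa[OF l]
      by (intro plist_cong) simp
    moreover have "Q l = plist (G (pa l)) (h (pa l))"
      using False pa[OF l] by (simp add: Q_def sym_ext_def q_def pa_def[symmetric] min_def)
    ultimately show ?thesis by simp
  qed
  interpret filling s g "partner s g" Q unfolding Q_def by (rule filling_sym_ext[OF c qP])
  have pos_P: "pos l = P l" if "1 \<le> l" "l \<le> Suc s" for l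
    using that
  proof (induction l)
    case (Suc l)
    show ?case
    proof (cases "l = 0")
      case True
      have "1 \<in> {1..s}" using s_pos by simp
      moreover have "rk K 1 = 1"
      proof -
        have "{k \<in> K. k \<le> 1} = {1}" using W(3) E(2) by force
        then show ?thesis by (simp add: rk_def)
      qed
      then have "kpos K 1 = 1" using kpos_rk[OF E(3) W(3)] by simp
      ultimately show ?thesis using True P_kpos[of 1] pos_one by simp
    next
      case False
      then have l: "l \<in> {1..s}" using Suc by simp
      then show ?thesis using Suc pos_Suc[of l] P_Suc[OF l] Q_plist[OF l] by simp
    qed
  qed simp
  have n_eq: "filling.n s Q = n" using pos_end pos_P[of "Suc s"] P_end s_pos by simp
  have "infl x = f x" if x: "x \<in> {1..n}" for x
  proof -
    obtain l t where lt: "l \<in> {1..s}" "t \<le> length (Q l)" "x = pos l + t"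
      using locate[of x] x n_eq by auto
    have pos: "pos l = P l" "pos (g l) = P (g l)" "pos (pa l) = P (pa l)"
    proof -
      have "g l \<in> {1..s}" using g lt(1) by (auto simp: inv_on_def)
      then show "pos l = P l" "pos (g l) = P (g l)" "pos (pa l) = P (pa l)"
        using pos_P pa(1)[OF lt(1)] lt(1) by auto
    qed
    show ?thesis
    proof (cases "t = 0")
      case True
      have "g l \<in> {1..s}" using g lt(1) by (auto simp: inv_on_def)
      then have "f (P l) = P (g l)"
        using emb_kpos[OF W(1) lt(1)] P_kpos[OF lt(1)] P_kpos[of "g l"] by simp
      then show ?thesis using True lt infl_pos[OF lt(1)] pos by simp
    next
      case False
      then have t: "t \<in> {1..G l}" using lt Q_plist[OF lt(1)] by simp
      have "infl (pos l + t) = pos (pa l) + entry (Q l) t"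
        unfolding pa_def by (rule infl_gap[OF lt(1)]) (use False lt in auto)
      then show ?thesis using lt pos h(1)[OF lt(1) t] Q_plist[OF lt(1)] entry_plist[OF t] by simp
    qed
  qed
  then have "plist n infl = plist n f" by (rule plist_cong)
  also have "\<dots> = p" unfolding f_def by (rule plist_entry[OF len_p])
  finally have "assemble s g q = p" using n_eq by (simp add: assemble_def Q_def)
  then show ?thesis using qP by blast
qed

section \<open>Generating functions\<close>

text \<open>The product formula for tuples with additive weights. Finiteness is proved alongside,
  since the induction step needs it to add up cardinalities.\<close>

lemma fps_prod_card:
  fixes A :: "'i \<Rightarrow> 'a set" and w :: "'i \<Rightarrow> 'a \<Rightarrow> nat"
  assumes "finite I" "\<And>i n. i \<in> I \<Longrightarrow> finite {a \<in> A i. w i a = n}"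
  shows "(\<Prod>i\<in>I. Abs_fps (\<lambda>n. of_nat (card {a \<in> A i. w i a = n}))) =
      (Abs_fps (\<lambda>n. of_nat (card {q \<in> PiE I A. (\<Sum>i\<in>I. w i (q i)) = n})) :: 'c::comm_ring_1 fps)
    \<and> (\<forall>n. finite {q \<in> PiE I A. (\<Sum>i\<in>I. w i (q i)) = n})"
  using assms
proof (induction I rule: finite_induct)
  case empty
  have "{q :: 'i \<Rightarrow> 'a. q = (\<lambda>x. undefined) \<and> (0::nat) = n} = (if n = 0 then {\<lambda>x. undefined} else {})" for n
    by auto
  then show ?case by (auto simp: fps_eq_iff)
next
  case (insert i I)
  define F where "F k = {a \<in> A i. w i a = k}" for k
  define B where "B m = {q \<in> PiE I A. (\<Sum>j\<in>I. w j (q j)) = m}" for m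
  have fin: "finite (F k)" "finite (B m)" for k m
    using insert by (auto simp: F_def B_def)
  have sum_upd: "(\<Sum>j\<in>insert i I. w j ((q(i := a)) j)) = w i a + (\<Sum>j\<in>I. w j (q j))" for q a
    using insert(1,2) by (auto simp: intro!: sum.cong)
  have eq: "{q \<in> PiE (insert i I) A. (\<Sum>j\<in>insert i I. w j (q j)) = n} =
    (\<lambda>(a, q). q(i := a)) ` (\<Union>k\<in>{0..n}. F k \<times> B (n - k))" for n
  proof (intro equalityI subsetI)
    fix q assume "q \<in> {q \<in> PiE (insert i I) A. (\<Sum>j\<in>insert i I. w j (q j)) = n}"
    then have "q \<in> (\<lambda>(y, g). g(i := y)) ` (A i \<times> PiE I A)" and s: "(\<Sum>j\<in>insert i I. w j (q j)) = n"
      by (auto simp: PiE_insert_eq)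
    then obtain a q' where q: "q = q'(i := a)" "a \<in> A i" "q' \<in> PiE I A" by auto
    have "w i a + (\<Sum>j\<in>I. w j (q' j)) = n" using s unfolding q(1) sum_upd .
    then have "w i a \<in> {0..n}" "(a, q') \<in> F (w i a) \<times> B (n - w i a)" using q by (auto simp: F_def B_def)
    then show "q \<in> (\<lambda>(a, q). q(i := a)) ` (\<Union>k\<in>{0..n}. F k \<times> B (n - k))" using q(1) by force
  next
    fix q assume "q \<in> (\<lambda>(a, q). q(i := a)) ` (\<Union>k\<in>{0..n}. F k \<times> B (n - k))"
    then obtain k a q' where q: "k \<le> n" "a \<in> F k" "q' \<in> B (n - k)" "q = q'(i := a)" by auto
    have "q \<in> PiE (insert i I) A"
      unfolding PiE_insert_eq using q by (auto simp: F_def B_def intro!: rev_image_eqI[of "(a, q')"])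
    moreover have "(\<Sum>j\<in>insert i I. w j (q j)) = n"
      unfolding q(4) sum_upd using q(1-3) by (simp add: F_def B_def)
    ultimately show "q \<in> {q \<in> PiE (insert i I) A. (\<Sum>j\<in>insert i I. w j (q j)) = n}" by simp
  qed
  have inj: "inj_on (\<lambda>(a, q). q(i := a)) (\<Union>k\<in>{0..n}. F k \<times> B (n - k))" for n
  proof (rule inj_on_subset[OF inj_combinator[OF insert(2)]])
    show "(\<Union>k\<in>{0..n}. F k \<times> B (n - k)) \<subseteq> A i \<times> PiE I A" by (auto simp: F_def B_def)
  qed
  have "card {q \<in> PiE (insert i I) A. (\<Sum>j\<in>insert i I. w j (q j)) = n} =
    (\<Sum>k=0..n. card (F k) * card (B (n - k)))" for n
  proof -
    have "card (\<Union>k\<in>{0..n}. F k \<times> B (n - k)) = (\<Sum>k=0..n. card (F k \<times> B (n - k)))"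
      by (rule card_UN_disjoint) (use fin in \<open>auto simp: F_def\<close>)
    then show ?thesis unfolding eq card_image[OF inj] by (simp add: card_cartesian_product)
  qed
  moreover have "finite {q \<in> PiE (insert i I) A. (\<Sum>j\<in>insert i I. w j (q j)) = n}" for n
    unfolding eq using fin by blast
  moreover have "(\<Prod>i\<in>I. Abs_fps (\<lambda>n. of_nat (card {a \<in> A i. w i a = n}))) =
      (Abs_fps (\<lambda>n. of_nat (card (B n))) :: 'c fps)"
    using insert by (simp add: B_def)
  ultimately show ?case
    using insert(1,2) by (simp add: fps_eq_iff fps_mult_nth F_def[symmetric])
qed

lemma fps_all_ones: "Abs_fps (\<lambda>n. 1) = inverse (1 - fps_X :: rat fps)"
proof -
  have "inverse (inverse (Abs_fps (\<lambda>n. 1))) = (Abs_fps (\<lambda>n. 1) :: rat fps)"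
    by (rule fps_inverse_idempotent) simp
  then show ?thesis by (simp add: fps_inverse_gp')
qed

lemma fps_even_ones: "Abs_fps (\<lambda>n. if even n then 1 else 0) = inverse (1 - fps_X ^ 2 :: rat fps)"
proof -
  define A :: "rat fps" where "A = Abs_fps (\<lambda>n. if even n then 1 else 0)"
  have "A * (1 - fps_X ^ 2) = 1"
  proof (rule fps_ext)
    fix n
    have "fps_nth (A * fps_X ^ 2) n = (if n < 2 then 0 else fps_nth A (n - 2))"
      by (simp add: fps_X_power_mult_right_nth)
    then have "fps_nth (A * (1 - fps_X ^ 2)) n = fps_nth A n - (if n < 2 then 0 else fps_nth A (n - 2))"
      by (simp add: right_diff_distrib)
    also have "\<dots> = fps_nth 1 n"
      by (cases "n = 0"; cases "n = 1") (auto simp: A_def)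
    finally show "fps_nth (A * (1 - fps_X ^ 2)) n = fps_nth 1 n" .
  qed
  then show ?thesis
    using fps_inverse_unique[of A "1 - fps_X ^ 2"] unfolding A_def
    by (metis fps_inverse_unique mult.commute)
qed

lemma involutions_length: "p \<in> involutions n \<Longrightarrow> length p = n"
  by (simp add: involutions_iff)

lemma finite_involutions: "finite (involutions n)"
  by (simp add: involutions_def)

section \<open>Numbers of cells of each kind\<close>

lemma feasible_cells_eq:
  assumes c: "conn (length \<rho>) (entry \<rho>)"
  shows "feasible_cells \<rho> = {(m, l). feas (length \<rho>) (entry \<rho>) l m}"
proof -
  have \<rho>: "\<rho> \<in> involutions (length \<rho>)" using c by (simp add: involutions_iff conn_def)
  show ?thesis
    unfolding feasible_cells_def
    using feasible_cell_feas[OF \<rho>] feas_feasible_cell[OF c] by (auto simp: feas_def)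
qed

lemma num_free_eq:
  assumes c: "conn (length \<rho>) (entry \<rho>)"
  shows "num_free \<rho> = card {l \<in> {1..length \<rho>}. light (length \<rho>) (entry \<rho>) l}"
proof -
  have g: "inv_on (length \<rho>) (entry \<rho>)" using c by (simp add: conn_def)
  have "free_cells \<rho> = (\<lambda>l. (l, l)) ` {l \<in> {1..length \<rho>}. light (length \<rho>) (entry \<rho>) l}"
    unfolding free_cells_def feasible_cells_eq[OF c]
    using necessarily_decreasing_iff[OF c] light_feas[OF g] by (auto simp: feas_def)
  then show ?thesis unfolding num_free_def by (simp add: card_image inj_on_def)
qed

lemma num_diag_decr_eq:
  assumes c: "conn (length \<rho>) (entry \<rho>)"
  shows "num_diag_decr \<rho> = card {l \<in> {1..length \<rho>}. \<not> light (length \<rho>) (entry \<rho>) l \<and>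
    feas (length \<rho>) (entry \<rho>) l l}"
proof -
  have "diagonal_decreasing_cells \<rho> = (\<lambda>l. (l, l)) ` {l \<in> {1..length \<rho>}.
      \<not> light (length \<rho>) (entry \<rho>) l \<and> feas (length \<rho>) (entry \<rho>) l l}"
    unfolding diagonal_decreasing_cells_def feasible_cells_eq[OF c]
    using necessarily_decreasing_iff[OF c] by (auto simp: feas_def)
  then show ?thesis unfolding num_diag_decr_def by (simp add: card_image inj_on_def)
qed

text \<open>A default partner equals l, so \<open>l < partner\<close> already means that column l
  has a feasible cell, above the diagonal and therefore decreasing.\<close>

lemma num_decr_above_eq:
  assumes c: "conn (length \<rho>) (entry \<rho>)"
  shows "num_decr_above \<rho> = card {l \<in> {1..length \<rho>}. l < partner (length \<rho>) (entry \<rho>) l}"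
proof -
  define s g where "s = length \<rho>" and "g = entry \<rho>"
  have c': "conn s g" using c by (simp add: s_def g_def)
  have "{(m, l) \<in> decreasing_cells \<rho>. m > l} = {(m, l). feas s g l m \<and> l < m}"
    unfolding decreasing_cells_def feasible_cells_eq[OF c] s_def g_def
    using necessarily_decreasing_iff[OF c] by (auto simp: feas_def)
  also have "\<dots> = (\<lambda>l. (partner s g l, l)) ` {l \<in> {1..s}. l < partner s g l}"
  proof (intro equalityI subsetI)
    fix x assume "x \<in> {(m, l). feas s g l m \<and> l < m}"
    then obtain m l where x: "x = (m, l)" "feas s g l m" "l < m" by auto
    then have "partner s g l = m" "l \<in> {1..s}"
      using partner_eq[OF c'] by (auto simp: feas_def)
    then show "x \<in> (\<lambda>l. (partner s g l, l)) ` {l \<in> {1..s}. l < partner s g l}"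
      using x by (intro image_eqI[of _ _ l]) auto
  next
    fix x assume "x \<in> (\<lambda>l. (partner s g l, l)) ` {l \<in> {1..s}. l < partner s g l}"
    then obtain l where l: "x = (partner s g l, l)" "l < partner s g l" by auto
    then have "\<exists>m. feas s g l m" unfolding partner_def by (auto split: if_splits)
    then show "x \<in> {(m, l). feas s g l m \<and> l < m}" using l feas_partner[OF c'] by auto
  qed
  finally show ?thesis
    unfolding num_decr_above_def s_def[symmetric] g_def[symmetric]
    by (simp add: card_image inj_on_def)
qed

text \<open>The content of the smaller of two distinct partners appears twice in the assembled
  involution; the larger one has the empty filler and adds nothing.\<close>

definition weight :: "nat \<Rightarrow> (nat \<Rightarrow> nat) \<Rightarrow> nat \<Rightarrow> nat list \<Rightarrow> nat" where
  "weight s g l q = (if partner s g l = l then length q else 2 * length q)"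

lemma fill_size_eq:
  assumes c: "conn s g" and q: "q \<in> PiE {1..s} (fillers s g)"
  shows "fill_size s g q = s + (\<Sum>l\<in>{1..s}. weight s g l (q l))"
proof -
  interpret filling s g "partner s g" "sym_ext s g q" by (rule filling_sym_ext[OF c q])
  define pa where "pa = partner s g"
  have pa: "pa l \<in> {1..s}" "pa (pa l) = l" if "l \<in> {1..s}" for l
    using partner_range[OF c that] partner_partner[OF c] by (auto simp: pa_def)
  define a where "a l = length (q l)" for l
  define U E D where "U = {l \<in> {1..s}. l < pa l}" and "E = {l \<in> {1..s}. pa l = l}"
    and "D = {l \<in> {1..s}. pa l < l}"
  have part: "(\<Sum>l\<in>{1..s}. h l) = sum h U + sum h E + sum h D" for h :: "nat \<Rightarrow> nat"
  proof -
    have "{1..s} = (U \<union> E) \<union> D" by (auto simp: U_def E_def D_def)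
    then have "sum h {1..s} = sum h ((U \<union> E) \<union> D)" by simp
    also have "\<dots> = sum h (U \<union> E) + sum h D"
      by (rule sum.union_disjoint) (auto simp: U_def E_def D_def)
    also have "sum h (U \<union> E) = sum h U + sum h E"
      by (rule sum.union_disjoint) (auto simp: U_def E_def D_def)
    finally show ?thesis .
  qed
  have "(\<Sum>l\<in>D. a (pa l)) = (\<Sum>l\<in>U. a l)"
    by (rule sum.reindex_bij_witness[of _ pa pa]) (use pa in \<open>auto simp: U_def D_def\<close>)
  moreover have "(\<Sum>l\<in>D. weight s g l (q l)) = 0"
  proof (rule sum.neutral, rule ballI)
    fix l assume "l \<in> D"
    then have l: "l \<in> {1..s}" "pa l < l" by (auto simp: D_def)
    then have "\<not> light s g l" using partner_light[OF c, of l] by (auto simp: pa_def)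
    then have "fillers s g l = {[]}" using l by (simp add: fillers_def pa_def)
    then have "q l = []" using PiE_mem[OF q l(1)] by simp
    then show "weight s g l (q l) = 0" by (simp add: weight_def)
  qed
  moreover have "(\<Sum>l\<in>U. weight s g l (q l)) = (\<Sum>l\<in>U. a l) + (\<Sum>l\<in>U. a l)"
    unfolding sum.distrib[symmetric] by (rule sum.cong) (auto simp: U_def weight_def a_def pa_def)
  moreover have "(\<Sum>l\<in>E. weight s g l (q l)) = (\<Sum>l\<in>E. a l)"
    by (rule sum.cong) (auto simp: E_def weight_def a_def pa_def)
  moreover have "(\<Sum>l\<in>X. length (sym_ext s g q l)) = (\<Sum>l\<in>X. a (min l (pa l)))" for X
    by (simp add: sym_ext_def a_def pa_def)
  moreover have "(\<Sum>l\<in>U. a (min l (pa l))) = (\<Sum>l\<in>U. a l)"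
    by (rule sum.cong) (auto simp: U_def min_def)
  moreover have "(\<Sum>l\<in>E. a (min l (pa l))) = (\<Sum>l\<in>E. a l)"
    by (rule sum.cong) (auto simp: E_def min_def)
  moreover have "(\<Sum>l\<in>D. a (min l (pa l))) = (\<Sum>l\<in>D. a (pa l))"
    by (rule sum.cong) (auto simp: D_def min_def)
  ultimately show ?thesis unfolding n_def part by simp
qed

definition with_counts :: "nat \<Rightarrow> (nat \<Rightarrow> nat) \<Rightarrow> (nat \<Rightarrow> nat) \<Rightarrow> nat \<Rightarrow> nat list set" where
  "with_counts s g r l = {q \<in> fillers s g l. light s g l \<longrightarrow> card (occ3412 q) = r l}"

lemma finite_fillers: "finite {q \<in> with_counts s g r l. weight s g l q = n}"
proof (rule finite_subset)
  show "{q \<in> with_counts s g r l. weight s g l q = n} \<subseteq> (\<Union>k\<le>n. involutions k)"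
  proof
    fix q assume q: "q \<in> {q \<in> with_counts s g r l. weight s g l q = n}"
    then have "length q \<le> n" by (auto simp: weight_def split: if_splits)
    moreover have "q \<in> involutions (length q)"
      using q fillers_involution by (auto simp: with_counts_def)
    ultimately show "q \<in> (\<Union>k\<le>n. involutions k)" by blast
  qed
qed (simp add: finite_involutions)

text \<open>At most one of the three factors differs from 1, because a light gap or a feasible
  diagonal cell makes l its own partner. A decreasing content of length k weighs k on the diagonal
  and 2k off it.\<close>

lemma filler_gf:
  assumes c: "conn s g" and l: "l \<in> {1..s}"
  shows "Abs_fps (\<lambda>n. of_nat (card {q \<in> with_counts s g r l. weight s g l q = n})) =
    (if light s g l then inv_gf (r l) else 1) *
    (if \<not> light s g l \<and> feas s g l l then inverse (1 - fps_X) else 1) *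
    (if l < partner s g l then inverse (1 - fps_X ^ 2) else 1)" (is "?F = _")
proof -
  have dec_inj: "{q \<in> range dec_list. h (length q) = n} = dec_list ` {k. h k = n}" for h :: "nat \<Rightarrow> nat" and n
    by auto
  have inj: "inj_on dec_list X" for X by (rule inj_onI) (metis length_dec_list)
  consider "light s g l" | "\<not> light s g l" "feas s g l l" | "\<not> light s g l" "l < partner s g l"
    | "\<not> light s g l" "\<not> feas s g l l" "\<not> l < partner s g l" by blast
  then show ?thesis
  proof cases
    case 1
    have pl: "partner s g l = l" by (rule partner_light[OF c l 1])
    have "{q \<in> with_counts s g r l. weight s g l q = n} =
      {p \<in> involutions n. card (occ3412 p) = r l}" for n
      using 1 pl involutions_length by (auto simp: with_counts_def fillers_def weight_def)
    then show ?thesis using 1 pl by (simp add: inv_gf_def)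
  next
    case 2
    have pl: "partner s g l = l" by (rule partner_eq[OF c 2(2)])
    have "{q \<in> with_counts s g r l. weight s g l q = n} = dec_list ` {k. k = n}" for n
      using 2 pl dec_inj[of "\<lambda>k. k" n] by (simp add: with_counts_def fillers_def weight_def)
    then have "card {q \<in> with_counts s g r l. weight s g l q = n} = 1" for n by simp
    then show ?thesis using 2 pl by (simp add: fps_all_ones[symmetric])
  next
    case 3
    then have "\<exists>m. feas s g l m" by (auto simp: partner_def split: if_splits)
    then have fe: "feas s g l (partner s g l)" using feas_partner[OF c] by blast
    have nf: "\<not> feas s g l l" using partner_eq[OF c, of l l] 3 by auto
    have "{q \<in> with_counts s g r l. weight s g l q = n} = dec_list ` {k. 2 * k = n}" for n
      using 3 fe dec_inj[of "\<lambda>k. 2 * k" n] by (simp add: with_counts_def fillers_def weight_def)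
    moreover have "{k. 2 * k = n} = (if even n then {n div 2} else {})" for n :: nat by auto
    ultimately have "card {q \<in> with_counts s g r l. weight s g l q = n} = (if even n then 1 else 0)" for n
      by simp
    then have "?F = Abs_fps (\<lambda>n. if even n then 1 else 0)" by (simp add: fps_eq_iff)
    then show ?thesis using 3 nf by (simp add: fps_even_ones[symmetric])
  next
    case 4
    have "\<not> (feas s g l (partner s g l) \<and> l \<le> partner s g l)"
      using 4 by (metis nat_less_le)
    then have "{q \<in> with_counts s g r l. weight s g l q = n} = (if n = 0 then {[]} else {})" for n
      using 4 by (auto simp: with_counts_def fillers_def weight_def split: if_splits)
    then have "?F = 1" by (simp add: fps_eq_iff)
    then show ?thesis using 4 by simp
  qed
qed

lemma prod_if_card:
  "finite A \<Longrightarrow> (\<Prod>x\<in>A. if P x then c else 1) = (c :: 'a::comm_monoid_mult) ^ card {x \<in> A. P x}"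
  by (simp add: prod.inter_filter[symmetric])

lemma PiE_with_counts_gf:
  assumes c: "conn (length \<rho>) (entry \<rho>)" and s: "s = length \<rho>" and g: "g = entry \<rho>"
  shows "Abs_fps (\<lambda>n. of_nat (card {q \<in> PiE {1..s} (with_counts s g r). s + (\<Sum>l\<in>{1..s}. weight s g l (q l)) = n}))
    = fps_X ^ s / ((1 - fps_X ^ 2) ^ num_decr_above \<rho> * (1 - fps_X) ^ num_diag_decr \<rho>) *
      (\<Prod>l\<in>{l \<in> {1..s}. light s g l}. inv_gf (r l))"
proof -
  have c': "conn s g" using c s g by simp
  define P where "P = PiE {1..s} (with_counts s g r)"
  define W where "W q = (\<Sum>l\<in>{1..s}. weight s g l (q l))" for q
  define F where "F = (Abs_fps (\<lambda>n. of_nat (card {q \<in> P. W q = n})) :: rat fps)"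
  have "(\<Prod>l\<in>{1..s}. Abs_fps (\<lambda>n. of_nat (card {q \<in> with_counts s g r l. weight s g l q = n}))) = F"
    unfolding F_def P_def W_def
    by (rule conjunct1[OF fps_prod_card]) (use finite_fillers in auto)
  then have "F = (\<Prod>l\<in>{1..s}. (if light s g l then inv_gf (r l) else 1) *
      (if \<not> light s g l \<and> feas s g l l then inverse (1 - fps_X) else 1) *
      (if l < partner s g l then inverse (1 - fps_X ^ 2) else 1))"
    using filler_gf[OF c', of _ r] by simp
  also have "\<dots> = (\<Prod>l\<in>{l \<in> {1..s}. light s g l}. inv_gf (r l)) *
      inverse (1 - fps_X) ^ num_diag_decr \<rho> * inverse (1 - fps_X ^ 2) ^ num_decr_above \<rho>"
    unfolding prod.distrib num_diag_decr_eq[OF c] num_decr_above_eq[OF c] s[symmetric] g[symmetric]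
    by (simp add: prod_if_card prod.inter_filter[symmetric])
  finally have F: "F = \<dots>" .
  have "Abs_fps (\<lambda>n. of_nat (card {q \<in> P. s + W q = n})) = fps_X ^ s * F"
  proof (rule fps_ext)
    fix n
    have "{q \<in> P. s + W q = n} = (if n < s then {} else {q \<in> P. W q = n - s})" by auto
    then show "fps_nth (Abs_fps (\<lambda>n. of_nat (card {q \<in> P. s + W q = n}))) n = fps_nth (fps_X ^ s * F) n"
      by (simp add: F_def fps_X_power_mult_nth)
  qed
  moreover have "(x :: rat fps) / (a ^ i * b ^ j) = x * inverse a ^ i * inverse b ^ j"
    if "fps_nth a 0 = 1" "fps_nth b 0 = 1" for x a b i j
    using that by (simp add: fps_divide_unit fps_inverse_mult fps_inverse_power mult.assoc)
  from this[of "1 - fps_X ^ 2" "1 - fps_X" "fps_X ^ s" "num_decr_above \<rho>" "num_diag_decr \<rho>"]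
  have "fps_X ^ s / ((1 - fps_X ^ 2) ^ num_decr_above \<rho> * (1 - fps_X) ^ num_diag_decr \<rho>) =
    fps_X ^ s * inverse (1 - fps_X ^ 2) ^ num_decr_above \<rho> * inverse (1 - fps_X :: rat fps) ^ num_diag_decr \<rho>"
    by simp
  ultimately show ?thesis unfolding P_def[symmetric] W_def[symmetric] F by (simp add: mult_ac)
qed

section \<open>Counting involutions by kernel shape\<close>

lemma kernel_shape_Nil: "kernel_shape [] = []"
  by (simp add: kernel_shape_def kernel_def standardise_def)

lemma bij_betw_assemble:
  assumes c: "conn s g" and \<rho>: "length \<rho> = s" "entry \<rho> = g"
  shows "bij_betw (assemble s g)
    {q \<in> PiE {1..s} (fillers s g). s + (\<Sum>l\<in>{1..s}. weight s g l (q l)) = n \<and>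
       (\<Sum>l | l \<in> {1..s} \<and> light s g l. card (occ3412 (q l))) + capacity \<rho> = r}
    {p \<in> involutions n. kernel_shape p = \<rho> \<and> card (occ3412 p) = r}"
    (is "bij_betw _ ?S ?T")
proof -
  have s: "1 \<le> s" using c by (simp add: conn_def)
  have cap: "capacity \<rho> = card (Occ s g)"
    using card_occ3412[of \<rho> s] c \<rho> by (simp add: capacity_def involutions_iff conn_def)
  have asm: "assemble s g q \<in> involutions (s + (\<Sum>l\<in>{1..s}. weight s g l (q l)))"
    "kernel_shape (assemble s g q) = \<rho>"
    "card (occ3412 (assemble s g q)) =
      (\<Sum>l | l \<in> {1..s} \<and> light s g l. card (occ3412 (q l))) + capacity \<rho>"
    if q: "q \<in> PiE {1..s} (fillers s g)" for q
  proof -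
    interpret filling s g "partner s g" "sym_ext s g q" by (rule filling_sym_ext[OF c q])
    show "assemble s g q \<in> involutions (s + (\<Sum>l\<in>{1..s}. weight s g l (q l)))"
      using plist_infl fill_size_eq[OF c q] by (simp add: assemble_def)
    show "kernel_shape (assemble s g q) = \<rho>"
      using kernel_plist_infl(1)[OF \<rho>] by (simp add: assemble_def)
    have "(\<Sum>l | l \<in> {1..s} \<and> light s g l. card (occ3412 (sym_ext s g q l))) =
      (\<Sum>l | l \<in> {1..s} \<and> light s g l. card (occ3412 (q l)))"
      by (rule sum.cong) (use partner_light[OF c] in \<open>auto simp: sym_ext_def\<close>)
    then show "card (occ3412 (assemble s g q)) =
      (\<Sum>l | l \<in> {1..s} \<and> light s g l. card (occ3412 (q l))) + capacity \<rho>"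
      using card_occ3412_infl cap by (simp add: assemble_def)
  qed
  have "inj_on (assemble s g) ?S"
    by (rule inj_on_subset[OF assemble_inj[OF c \<rho>]]) blast
  moreover have "assemble s g ` ?S = ?T"
  proof (intro equalityI subsetI)
    fix p assume "p \<in> assemble s g ` ?S"
    then show "p \<in> ?T" using asm by auto
  next
    fix p assume p: "p \<in> ?T"
    have "n \<noteq> 0"
    proof
      assume "n = 0"
      then have "p = []" using p by (auto simp: involutions_iff)
      then show False using p kernel_shape_Nil \<rho>(1) s by auto
    qed
    then obtain q where q: "q \<in> PiE {1..s} (fillers s g)" "assemble s g q = p"
      using assemble_surj[OF c \<rho>, of p n] p by auto
    then have "s + (\<Sum>l\<in>{1..s}. weight s g l (q l)) = n"
      using asm(1)[OF q(1)] p by (auto simp: involutions_iff)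
    then show "p \<in> assemble s g ` ?S"
      using q asm(3)[OF q(1)] p by (intro image_eqI[of _ _ q]) auto
  qed
  ultimately show ?thesis by (simp add: bij_betw_def)
qed

lemma shape_gf:
  assumes c: "conn (length \<rho>) (entry \<rho>)"
  shows "Abs_fps (\<lambda>n. of_nat (card {p \<in> involutions n. kernel_shape p = \<rho> \<and> card (occ3412 p) = r})) =
    fps_X ^ length \<rho> / ((1 - fps_X ^ 2) ^ num_decr_above \<rho> * (1 - fps_X) ^ num_diag_decr \<rho>) *
       (\<Sum>rs | length rs = num_free \<rho> \<and> sum_list rs + capacity \<rho> = r.
          \<Prod>j<num_free \<rho>. inv_gf (rs ! j))"
proof -
  define s g where "s = length \<rho>" and "g = entry \<rho>"
  have c': "conn s g" using c by (simp add: s_def g_def)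
  define L where "L = {l \<in> {1..s}. light s g l}"
  have L: "finite L" "card L = num_free \<rho>"
    using num_free_eq[OF c] by (simp_all add: L_def s_def g_def)
  \<comment> \<open>This numbers the light gaps, so that \<open>rs ! idx l\<close> prescribes the
    number of occurrences in gap l and the inner sum can run over lists.\<close>
  then obtain idx where idx: "bij_betw idx L {..<num_free \<rho>}"
    using ex_bij_betw_finite_nat[OF L(1)] by (auto simp: lessThan_atLeast0)
  define R where "R = {rs. length rs = num_free \<rho> \<and> sum_list rs + capacity \<rho> = r}"
  have finR: "finite R"
  proof (rule finite_subset)
    show "R \<subseteq> {rs. set rs \<subseteq> {..r} \<and> length rs = num_free \<rho>}"
      using member_le_sum_list by (fastforce simp: R_def)
    show "finite {rs. set rs \<subseteq> {..r} \<and> length rs = num_free \<rho>}"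
      by (rule finite_lists_length_eq) simp
  qed
  define W where "W q = s + (\<Sum>l\<in>{1..s}. weight s g l (q l))" for q
  define T where "T rs n = {q \<in> PiE {1..s} (with_counts s g (\<lambda>l. rs ! idx l)). W q = n}" for rs n
  have finT: "finite (T rs n)" for rs n
  proof -
    have "finite {q \<in> PiE {1..s} (with_counts s g (\<lambda>l. rs ! idx l)).
      (\<Sum>l\<in>{1..s}. weight s g l (q l)) = n - s}"
      using conjunct2[OF fps_prod_card[of "{1..s}" "with_counts s g (\<lambda>l. rs ! idx l)" "weight s g"]]
        finite_fillers by blast
    \<comment> \<open>For n < s the set \<open>T rs n\<close> is empty, so the truncated difference
      does no harm.\<close>
    then show ?thesis by (rule rev_finite_subset) (auto simp: T_def W_def)
  qed
  have sum_idx: "sum_list rs = (\<Sum>l\<in>L. rs ! idx l)" if "length rs = num_free \<rho>" for rs :: "nat list"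
    using sum.reindex_bij_betw[OF idx, of "\<lambda>j. rs ! j"] that
    by (simp add: sum_list_sum_nth lessThan_atLeast0)
  have mem_T: "q \<in> T rs n \<longleftrightarrow> q \<in> PiE {1..s} (fillers s g) \<and> W q = n \<and>
      (\<forall>l\<in>L. card (occ3412 (q l)) = rs ! idx l)" for q rs n
    by (auto simp: T_def with_counts_def PiE_iff L_def)
  have "{q \<in> PiE {1..s} (fillers s g). W q = n \<and> (\<Sum>l\<in>L. card (occ3412 (q l))) + capacity \<rho> = r} =
    (\<Union>rs\<in>R. T rs n)" for n
  proof (intro equalityI subsetI)
    fix q assume q: "q \<in> {q \<in> PiE {1..s} (fillers s g). W q = n \<and>
      (\<Sum>l\<in>L. card (occ3412 (q l))) + capacity \<rho> = r}"
    define rs where "rs = map (\<lambda>j. card (occ3412 (q (inv_into L idx j)))) [0..<num_free \<rho>]"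
    have len: "length rs = num_free \<rho>" by (simp add: rs_def)
    have nth: "rs ! idx l = card (occ3412 (q l))" if "l \<in> L" for l
    proof -
      have "idx l < num_free \<rho>" using bij_betw_apply[OF idx that] by simp
      moreover have "inv_into L idx (idx l) = l" by (rule bij_betw_inv_into_left[OF idx that])
      ultimately show ?thesis by (simp add: rs_def)
    qed
    have "rs \<in> R" using len sum_idx[OF len] nth q by (simp add: R_def)
    moreover have "q \<in> T rs n" using q nth by (simp add: mem_T)
    ultimately show "q \<in> (\<Union>rs\<in>R. T rs n)" by blast
  next
    fix q assume "q \<in> (\<Union>rs\<in>R. T rs n)"
    then obtain rs where rs: "rs \<in> R" "q \<in> T rs n" by blast
    then show "q \<in> {q \<in> PiE {1..s} (fillers s g). W q = n \<and>
      (\<Sum>l\<in>L. card (occ3412 (q l))) + capacity \<rho> = r}"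
      using sum_idx[of rs] by (simp add: mem_T R_def)
  qed
  moreover have "card (\<Union>rs\<in>R. T rs n) = (\<Sum>rs\<in>R. card (T rs n))" for n
  proof (rule card_UN_disjoint[OF finR])
    show "\<forall>rs\<in>R. finite (T rs n)" using finT by simp
    show "\<forall>rs\<in>R. \<forall>rs'\<in>R. rs \<noteq> rs' \<longrightarrow> T rs n \<inter> T rs' n = {}"
    \<comment> \<open>A filling determines its list of counts: \<open>idx\<close> reaches every
      index, so two lists realised by the same q agree everywhere.\<close>
    proof (intro ballI impI, rule ccontr)
      fix rs rs' assume rs: "rs \<in> R" "rs' \<in> R" "rs \<noteq> rs'" and "T rs n \<inter> T rs' n \<noteq> {}"
      then obtain q where "q \<in> T rs n" "q \<in> T rs' n" by blast
      then have eq: "rs ! idx l = rs' ! idx l" if "l \<in> L" for l using that by (simp add: mem_T)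
      have "rs = rs'"
      proof (rule nth_equalityI)
        show "length rs = length rs'" using rs by (simp add: R_def)
        fix j assume "j < length rs"
        then have "j \<in> idx ` L" using rs bij_betw_imp_surj_on[OF idx] by (simp add: R_def)
        then show "rs ! j = rs' ! j" using eq by auto
      qed
      then show False using rs by simp
    qed
  qed
  ultimately have card_eq: "card {p \<in> involutions n. kernel_shape p = \<rho> \<and> card (occ3412 p) = r} =
    (\<Sum>rs\<in>R. card (T rs n))" for n
    using bij_betw_same_card[OF bij_betw_assemble[OF c' s_def[symmetric] g_def[symmetric], of n r]]
    by (simp add: L_def W_def)
  have gf: "Abs_fps (\<lambda>n. of_nat (card (T rs n))) =
    fps_X ^ s / ((1 - fps_X ^ 2) ^ num_decr_above \<rho> * (1 - fps_X) ^ num_diag_decr \<rho>) *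
      (\<Prod>j<num_free \<rho>. inv_gf (rs ! j))" for rs
    unfolding T_def W_def PiE_with_counts_gf[OF c s_def g_def]
    using prod.reindex_bij_betw[OF idx, of "\<lambda>j. inv_gf (rs ! j)"] by (simp add: L_def)
  have "Abs_fps (\<lambda>n. of_nat (card {p \<in> involutions n. kernel_shape p = \<rho> \<and> card (occ3412 p) = r})) =
    (\<Sum>rs\<in>R. Abs_fps (\<lambda>n. of_nat (card (T rs n)) :: rat))"
    unfolding card_eq by (simp add: fps_eq_iff fps_sum_nth)
  also have "\<dots> = fps_X ^ s / ((1 - fps_X ^ 2) ^ num_decr_above \<rho> * (1 - fps_X) ^ num_diag_decr \<rho>) *
       (\<Sum>rs\<in>R. \<Prod>j<num_free \<rho>. inv_gf (rs ! j))"
    by (simp add: gf sum_distrib_left)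
  finally show ?thesis by (simp add: R_def s_def)
qed

text \<open>The gap after the last entry is always light, since no arc of the shape ends to its
  right. Putting t - s fixed points there gives an involution of size t with the same kernel
  shape.\<close>

lemma conn_kernel_shape_self:
  assumes c: "conn (length \<rho>) (entry \<rho>)" and t: "length \<rho> \<le> t"
  shows "\<rho> \<in> kernel_shapes t"
proof -
  define s g where "s = length \<rho>" and "g = entry \<rho>"
  have s: "1 \<le> s" using c by (simp add: conn_def s_def)
  define sg where "sg = (\<lambda>i::nat. i)"
  define q where "q = plist (t - s) (\<lambda>i. i)"
  define Q where "Q = (\<lambda>i. if i = s then q else [])"
  have "inv_on (t - s) (\<lambda>i. i)" by (simp add: inv_on_def)
  then have q: "q \<in> involutions (length q)" unfolding q_def by (simp add: plist_involution)
  interpret filling s g sg Q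
    unfolding sg_def Q_def
    by (rule light_filling[OF _ _ q]) (use c in \<open>simp_all add: s_def g_def covered_def\<close>)
  have "(\<Sum>i\<in>{1..s}. length (Q i)) = (\<Sum>i\<in>{1..s}. if i = s then t - s else 0)"
    by (rule sum.cong) (auto simp: Q_def q_def)
  then have "n = s + (t - s)" unfolding n_def using s by simp
  then have "n = t" using t[folded s_def] by simp
  moreover have "kernel_shape (plist n infl) = \<rho>"
    by (rule kernel_plist_infl) (simp_all add: s_def g_def)
  ultimately show ?thesis using plist_infl unfolding kernel_shapes_def by blast
qed

text \<open>The occurrences of the shape inject into those of p, so the bound of
  \<open>conn_size\<close> for the shape holds with the number of occurrences of p; padding then
  brings the shape up to the required size.\<close>

lemma kernel_shape_in_kernel_shapes:
  assumes p: "p \<in> involutions n" and n: "1 \<le> n"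
  shows "kernel_shape p \<in> kernel_shapes (2 * card (occ3412 p) + 2)"
proof -
  define \<rho> f K where "\<rho> = kernel_shape p" and "f = entry p" and "K = ker n f"
  have e: "emb n f K (length \<rho>) (entry \<rho>)" and c: "conn (length \<rho>) (entry \<rho>)"
    using kernel_shape_conn[OF p n] by (simp_all add: \<rho>_def K_def f_def)
  define s where "s = length \<rho>"
  have "(\<lambda>w. kpos K ` w) ` Occ s (entry \<rho>) \<subseteq> Occ n f"
    using Occ_kpos(1)[OF e] by (auto simp: s_def)
  moreover have "inj_on (\<lambda>w. kpos K ` w) (Occ s (entry \<rho>))"
  proof (rule inj_on_subset[OF inj_on_image_Pow])
    show "inj_on (kpos K) {1..s}"
      by (rule inj_on_inverseI[of _ "rk K"])
        (use kpos(2)[OF embD(3)[OF e]] embD(4)[OF e] in \<open>simp add: s_def\<close>)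
    show "Occ s (entry \<rho>) \<subseteq> Pow {1..s}" using Occ_subset by blast
  qed
  ultimately have "card (Occ s (entry \<rho>)) \<le> card (occ3412 p)"
    using card_inj_on_le[OF _ _ finite_Occ] card_occ3412[OF p] by (metis f_def)
  then have "length \<rho> \<le> 2 * card (occ3412 p) + 2" using conn_size[OF c] by (simp add: s_def)
  then show ?thesis using conn_kernel_shape_self[OF c] by (simp add: \<rho>_def)
qed

lemma conn_kernel_shapes:
  assumes "\<rho> \<in> kernel_shapes t" "1 \<le> t"
  shows "conn (length \<rho>) (entry \<rho>)"
  using assms kernel_shape_conn(2) by (auto simp: kernel_shapes_def)

theorem theorem3p1:
  fixes r :: nat
  assumes "r \<ge> 1"
  shows "inv_gf r =
    (\<Sum>\<rho>\<in>kernel_shapes (2 * r + 2).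
       fps_X ^ length \<rho> /
         ((1 - fps_X ^ 2) ^ num_decr_above \<rho> * (1 - fps_X) ^ num_diag_decr \<rho>) *
       (\<Sum>rs | length rs = num_free \<rho> \<and> sum_list rs + capacity \<rho> = r.
          \<Prod>j<num_free \<rho>. inv_gf (rs ! j)))"
proof -
  define S where "S = kernel_shapes (2 * r + 2)"
  define T where "T \<rho> n = {p \<in> involutions n. kernel_shape p = \<rho> \<and> card (occ3412 p) = r}" for \<rho> n
  have finS: "finite S" by (simp add: S_def kernel_shapes_def finite_involutions)
  have "{p \<in> involutions n. card (occ3412 p) = r} = (\<Union>\<rho>\<in>S. T \<rho> n)" for n
  proof (intro equalityI subsetI)
    fix p assume p: "p \<in> {p \<in> involutions n. card (occ3412 p) = r}"
    \<comment> \<open>The empty permutation has no entry 1 and hence no kernel; it has no occurrence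
      either, so it is excluded by \<open>r \<ge> 1\<close>.\<close>
    have "n \<noteq> 0"
    proof
      assume n0: "n = 0"
      then have "Occ n (entry p) = {}" by (auto simp: Occ_def occ_def)
      then show False using p card_occ3412[of p n] assms by auto
    qed
    then have "kernel_shape p \<in> S"
      using kernel_shape_in_kernel_shapes[of p n] p by (simp add: S_def)
    then show "p \<in> (\<Union>\<rho>\<in>S. T \<rho> n)" using p by (simp add: T_def)
  qed (auto simp: T_def)
  moreover have "card (\<Union>\<rho>\<in>S. T \<rho> n) = (\<Sum>\<rho>\<in>S. card (T \<rho> n))" for n
    by (rule card_UN_disjoint[OF finS]) (auto simp: T_def finite_involutions)
  ultimately have "inv_gf r = (\<Sum>\<rho>\<in>S. Abs_fps (\<lambda>n. of_nat (card (T \<rho> n))))"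
    by (simp add: inv_gf_def fps_eq_iff fps_sum_nth)
  then show ?thesis
    unfolding T_def S_def using shape_gf conn_kernel_shapes by simp
qed

end
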